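(* Let $\mathcal{E}$ be a connected atomic topos with a point $p:\mathcal{S}\to\mathcal{E}$, let $\mathcal{C}\subset\mathcal{E}$ be the full subcategory of all non-empty connected objects, and let $F=p^*|_{\mathcal{C}}:\mathcal{C}\to\mathcal{S}$. Assume that the point $p$ is proessential. Then the objects $(A,a)$ with $A$ a Galois object are cofinal in the diagram $\Gamma_F$ of $F$ (i.e. every object $(X,x)$ of $\Gamma_F$ admits an arrow $(A,a)\to(X,x)$ from such an object). In fact, the following holds: given any non-empty connected object $X$, there exist a Galois object $A$ and an element $a\in FA$ such that for all $x\in FX$ there exists an arrow $f:(A,a)\to(X,x)$ in $\Gamma_F$, that is, an arrow $f:A\to X$ with $F(f)(a)=x$; moreover such an $f$ is unique and is a strict epimorphism.
   Context: All topoi are Grothendieck topoi over the category $\mathcal{S}$ of sets; $\gamma:\mathcal{E}\to\mathcal{S}$ is the structure morphism. A connected atomic topos is a connected ($\gamma^*$ full and faithful), locally connected ($\gamma^*$ has a left adjoint) and boolean topos. A Galois object is a non-empty connected object $A$ such that $A\to 1$ is an epimorphism and the canonical morphism $A\times\gamma^*Aut(A)\to A\times A$ is an isomorphism. A point $p:\mathcal{S}\to\mathcal{E}$ is proessential if its inverse image preserves cotensors of connected objects: for every connected object $X$ and every set $S$, the canonical map $p^*(\prod_S X)\to\prod_S p^*X=(p^*X)^S$ is a bijection. The diagram $\Gamma_F$ of a functor $F:\mathcal{C}\to\mathcal{S}$ is the category whose objects are pairs $(x,X)$, also written $(X,x)$, with $X\in\mathcal{C}$ and $x\in FX$, an arrow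 $(X,x)\to(Y,y)$ being an arrow $f:X\to Y$ of $\mathcal{C}$ with $F(f)(x)=y$. *)

theory Defs
  imports "HOL-Library.FuncSet" "HOL-Library.Equipollence"
begin

section \<open>Categories, functors, natural transformations\<close>

record ('o, 'm) category_data =
  Obj :: "'o set"
  Arr :: "'m set"
  Dom :: "'m \<Rightarrow> 'o"
  Cod :: "'m \<Rightarrow> 'o"
  Id :: "'o \<Rightarrow> 'm"
  Comp :: "'m \<Rightarrow> 'm \<Rightarrow> 'm"  \<comment> \<open>\<open>Comp C g f\<close> is \<open>g\<close> after \<open>f\<close>\<close>

definition hom :: "('o, 'm) category_data \<Rightarrow> 'o \<Rightarrow> 'o \<Rightarrow> 'm set" where
  "hom C X Y = {f \<in> Arr C. Dom C f = X \<and> Cod C f = Y}"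

locale category =
  fixes C :: "('o, 'm) category_data"
  assumes dom_obj: "f \<in> Arr C \<Longrightarrow> Dom C f \<in> Obj C"
    and cod_obj: "f \<in> Arr C \<Longrightarrow> Cod C f \<in> Obj C"
    and id_hom: "X \<in> Obj C \<Longrightarrow> Id C X \<in> hom C X X"
    and comp_hom: "f \<in> hom C X Y \<Longrightarrow> g \<in> hom C Y Z \<Longrightarrow> Comp C g f \<in> hom C X Z"
    and id_left: "f \<in> hom C X Y \<Longrightarrow> Comp C (Id C Y) f = f"
    and id_right: "f \<in> hom C X Y \<Longrightarrow> Comp C f (Id C X) = f"
    and assoc: "f \<in> hom C W X \<Longrightarrow> g \<in> hom C X Y \<Longrightarrow> h \<in> hom C Y Z \<Longrightarrow>
      Comp C h (Comp C g f) = Comp C (Comp C h g) f"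

definition opposite :: "('o, 'm) category_data \<Rightarrow> ('o, 'm) category_data" where
  "opposite C = \<lparr>Obj = Obj C, Arr = Arr C, Dom = Cod C, Cod = Dom C, Id = Id C,
    Comp = (\<lambda>g f. Comp C f g)\<rparr>"

definition full_subcategory ::
  "('o, 'm) category_data \<Rightarrow> ('o \<Rightarrow> bool) \<Rightarrow> ('o, 'm) category_data" where
  "full_subcategory C P = \<lparr>Obj = {X \<in> Obj C. P X},
    Arr = {f \<in> Arr C. P (Dom C f) \<and> P (Cod C f)},
    Dom = Dom C, Cod = Cod C, Id = Id C, Comp = Comp C\<rparr>"

text \<open>A functor is given by its total underlying maps, whose values outside the source category
  are irrelevant. Its restriction to a subcategory is therefore the same pair of maps.\<close>

record ('o, 'm, 'p, 'n) functor_data =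
  FO :: "'o \<Rightarrow> 'p"
  FA :: "'m \<Rightarrow> 'n"

locale is_functor = source: category C + target: category D
  for C :: "('o, 'm) category_data" and D :: "('p, 'n) category_data" +
  fixes F :: "('o, 'm, 'p, 'n) functor_data"
  assumes map_obj: "X \<in> Obj C \<Longrightarrow> FO F X \<in> Obj D"
    and map_hom: "f \<in> hom C X Y \<Longrightarrow> FA F f \<in> hom D (FO F X) (FO F Y)"
    and map_id: "X \<in> Obj C \<Longrightarrow> FA F (Id C X) = Id D (FO F X)"
    and map_comp: "f \<in> hom C X Y \<Longrightarrow> g \<in> hom C Y Z \<Longrightarrow>
      FA F (Comp C g f) = Comp D (FA F g) (FA F f)"

definition id_functor :: "('o, 'm, 'o, 'm) functor_data" where
  "id_functor = \<lparr>FO = (\<lambda>X. X), FA = (\<lambda>f. f)\<rparr>"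

definition comp_functor ::
  "('p, 'n, 'q, 'k) functor_data \<Rightarrow> ('o, 'm, 'p, 'n) functor_data \<Rightarrow>
    ('o, 'm, 'q, 'k) functor_data" where
  "comp_functor G F = \<lparr>FO = (\<lambda>X. FO G (FO F X)), FA = (\<lambda>f. FA G (FA F f))\<rparr>"

definition natural_transformation ::
  "('o, 'm) category_data \<Rightarrow> ('p, 'n) category_data \<Rightarrow> ('o, 'm, 'p, 'n) functor_data \<Rightarrow>
    ('o, 'm, 'p, 'n) functor_data \<Rightarrow> ('o \<Rightarrow> 'n) \<Rightarrow> bool" where
  "natural_transformation C D F G \<alpha> \<longleftrightarrow>
    is_functor C D F \<and> is_functor C D G \<and>
    (\<forall>X \<in> Obj C. \<alpha> X \<in> hom D (FO F X) (FO G X)) \<and>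
    (\<forall>f \<in> Arr C. Comp D (\<alpha> (Cod C f)) (FA F f) = Comp D (FA G f) (\<alpha> (Dom C f)))"

definition is_iso :: "('o, 'm) category_data \<Rightarrow> 'm \<Rightarrow> bool" where
  "is_iso C f \<longleftrightarrow> f \<in> Arr C \<and>
    (\<exists>g \<in> hom C (Cod C f) (Dom C f).
      Comp C g f = Id C (Dom C f) \<and> Comp C f g = Id C (Cod C f))"

definition automorphisms :: "('o, 'm) category_data \<Rightarrow> 'o \<Rightarrow> 'm set" where
  "automorphisms C X = {f \<in> hom C X X. is_iso C f}"

definition naturally_isomorphic ::
  "('o, 'm) category_data \<Rightarrow> ('p, 'n) category_data \<Rightarrow> ('o, 'm, 'p, 'n) functor_data \<Rightarrow>
    ('o, 'm, 'p, 'n) functor_data \<Rightarrow> bool" where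
  "naturally_isomorphic C D F G \<longleftrightarrow>
    (\<exists>\<alpha>. natural_transformation C D F G \<alpha> \<and> (\<forall>X \<in> Obj C. is_iso D (\<alpha> X)))"

definition equivalent_categories ::
  "('o, 'm) category_data \<Rightarrow> ('p, 'n) category_data \<Rightarrow> bool" where
  "equivalent_categories C D \<longleftrightarrow>
    (\<exists>F G. is_functor C D F \<and> is_functor D C G \<and>
      naturally_isomorphic C C (comp_functor G F) id_functor \<and>
      naturally_isomorphic D D (comp_functor F G) id_functor)"

definition full_and_faithful ::
  "('o, 'm) category_data \<Rightarrow> ('p, 'n) category_data \<Rightarrow> ('o, 'm, 'p, 'n) functor_data \<Rightarrow> bool" where
  "full_and_faithful C D F \<longleftrightarrow> is_functor C D F \<and>
    (\<forall>X \<in> Obj C. \<forall>Y \<in> Obj C. bij_betw (FA F) (hom C X Y) (hom D (FO F X) (FO F Y)))"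

text \<open>\<open>left_adjoint C D L R\<close>: the functor \<open>L : C \<rightarrow> D\<close> is left adjoint to \<open>R : D \<rightarrow> C\<close>.\<close>

definition left_adjoint ::
  "('o, 'm) category_data \<Rightarrow> ('p, 'n) category_data \<Rightarrow> ('o, 'm, 'p, 'n) functor_data \<Rightarrow>
    ('p, 'n, 'o, 'm) functor_data \<Rightarrow> bool" where
  "left_adjoint C D L R \<longleftrightarrow>
    is_functor C D L \<and> is_functor D C R \<and>
    (\<exists>\<eta> \<epsilon>. natural_transformation C C id_functor (comp_functor R L) \<eta> \<and>
      natural_transformation D D (comp_functor L R) id_functor \<epsilon> \<and>
      (\<forall>X \<in> Obj C. Comp D (\<epsilon> (FO L X)) (FA L (\<eta> X)) = Id D (FO L X)) \<and>
      (\<forall>Y \<in> Obj D. Comp C (FA R (\<epsilon> Y)) (\<eta> (FO R Y)) = Id C (FO R Y)))"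

section \<open>Limits, subobjects, epimorphisms\<close>

definition is_cone ::
  "('i, 'j) category_data \<Rightarrow> ('o, 'm) category_data \<Rightarrow> ('i, 'j, 'o, 'm) functor_data \<Rightarrow>
    'o \<Rightarrow> ('i \<Rightarrow> 'm) \<Rightarrow> bool" where
  "is_cone K C D L leg \<longleftrightarrow> L \<in> Obj C \<and>
    (\<forall>i \<in> Obj K. leg i \<in> hom C L (FO D i)) \<and>
    (\<forall>u \<in> Arr K. Comp C (FA D u) (leg (Dom K u)) = leg (Cod K u))"

definition is_limit ::
  "('i, 'j) category_data \<Rightarrow> ('o, 'm) category_data \<Rightarrow> ('i, 'j, 'o, 'm) functor_data \<Rightarrow>
    'o \<Rightarrow> ('i \<Rightarrow> 'm) \<Rightarrow> bool" where
  "is_limit K C D L leg \<longleftrightarrow> is_cone K C D L leg \<and>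
    (\<forall>M \<mu>. is_cone K C D M \<mu> \<longrightarrow>
      (\<exists>!h. h \<in> hom C M L \<and> (\<forall>i \<in> Obj K. Comp C (leg i) h = \<mu> i)))"

text \<open>Every finite category is isomorphic to one whose objects and arrows are natural numbers,
  so these shapes cover all finite limits.\<close>

definition preserves_finite_limits ::
  "('o, 'm) category_data \<Rightarrow> ('p, 'n) category_data \<Rightarrow> ('o, 'm, 'p, 'n) functor_data \<Rightarrow> bool" where
  "preserves_finite_limits C C' F \<longleftrightarrow>
    (\<forall>(K :: (nat, nat) category_data) D L leg.
      finite (Obj K) \<and> finite (Arr K) \<and> is_functor K C D \<and> is_limit K C D L leg \<longrightarrow>
      is_limit K C' (comp_functor F D) (FO F L) (\<lambda>i. FA F (leg i)))"

definition is_terminal :: "('o, 'm) category_data \<Rightarrow> 'o \<Rightarrow> bool" where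
  "is_terminal C T \<longleftrightarrow> T \<in> Obj C \<and> (\<forall>X \<in> Obj C. \<exists>!f. f \<in> hom C X T)"

definition is_initial :: "('o, 'm) category_data \<Rightarrow> 'o \<Rightarrow> bool" where
  "is_initial C Z \<longleftrightarrow> Z \<in> Obj C \<and> (\<forall>X \<in> Obj C. \<exists>!f. f \<in> hom C Z X)"

definition is_product ::
  "('o, 'm) category_data \<Rightarrow> 'i set \<Rightarrow> ('i \<Rightarrow> 'o) \<Rightarrow> 'o \<Rightarrow> ('i \<Rightarrow> 'm) \<Rightarrow> bool" where
  "is_product C I X P \<pi> \<longleftrightarrow> P \<in> Obj C \<and> (\<forall>i \<in> I. \<pi> i \<in> hom C P (X i)) \<and>
    (\<forall>T \<in> Obj C. \<forall>f. (\<forall>i \<in> I. f i \<in> hom C T (X i)) \<longrightarrow>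
      (\<exists>!h. h \<in> hom C T P \<and> (\<forall>i \<in> I. Comp C (\<pi> i) h = f i)))"

definition is_binary_product ::
  "('o, 'm) category_data \<Rightarrow> 'o \<Rightarrow> 'o \<Rightarrow> 'o \<Rightarrow> 'm \<Rightarrow> 'm \<Rightarrow> bool" where
  "is_binary_product C X Y P \<pi>\<^sub>1 \<pi>\<^sub>2 \<longleftrightarrow>
    P \<in> Obj C \<and> \<pi>\<^sub>1 \<in> hom C P X \<and> \<pi>\<^sub>2 \<in> hom C P Y \<and>
    (\<forall>T \<in> Obj C. \<forall>f \<in> hom C T X. \<forall>g \<in> hom C T Y.
      \<exists>!h. h \<in> hom C T P \<and> Comp C \<pi>\<^sub>1 h = f \<and> Comp C \<pi>\<^sub>2 h = g)"

definition is_binary_coproduct ::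
  "('o, 'm) category_data \<Rightarrow> 'o \<Rightarrow> 'o \<Rightarrow> 'o \<Rightarrow> 'm \<Rightarrow> 'm \<Rightarrow> bool" where
  "is_binary_coproduct C X Y Q \<iota>\<^sub>1 \<iota>\<^sub>2 \<longleftrightarrow> is_binary_product (opposite C) X Y Q \<iota>\<^sub>1 \<iota>\<^sub>2"

definition is_mono :: "('o, 'm) category_data \<Rightarrow> 'm \<Rightarrow> bool" where
  "is_mono C m \<longleftrightarrow> m \<in> Arr C \<and>
    (\<forall>T \<in> Obj C. \<forall>u \<in> hom C T (Dom C m). \<forall>v \<in> hom C T (Dom C m).
      Comp C m u = Comp C m v \<longrightarrow> u = v)"

definition is_epi :: "('o, 'm) category_data \<Rightarrow> 'm \<Rightarrow> bool" where
  "is_epi C e \<longleftrightarrow> is_mono (opposite C) e"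

definition is_strict_epi :: "('o, 'm) category_data \<Rightarrow> 'm \<Rightarrow> bool" where
  "is_strict_epi C f \<longleftrightarrow> f \<in> Arr C \<and>
    (\<forall>Z \<in> Obj C. \<forall>g \<in> hom C (Dom C f) Z.
      (\<forall>T \<in> Obj C. \<forall>u \<in> hom C T (Dom C f). \<forall>v \<in> hom C T (Dom C f).
        Comp C f u = Comp C f v \<longrightarrow> Comp C g u = Comp C g v) \<longrightarrow>
      (\<exists>!h. h \<in> hom C (Cod C f) Z \<and> Comp C h f = g))"

text \<open>Subobjects of \<open>X\<close> are represented by monomorphisms into \<open>X\<close>, with the usual preorder.\<close>

definition subobjects :: "('o, 'm) category_data \<Rightarrow> 'o \<Rightarrow> 'm set" where
  "subobjects C X = {m. is_mono C m \<and> Cod C m = X}"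

definition sub_le :: "('o, 'm) category_data \<Rightarrow> 'm \<Rightarrow> 'm \<Rightarrow> bool" where
  "sub_le C m n \<longleftrightarrow> (\<exists>k \<in> hom C (Dom C m) (Dom C n). Comp C n k = m)"

text \<open>Complements in the lattice of subobjects: the only lower bounds of \<open>m\<close> and \<open>n\<close> are least
  subobjects and the only upper bounds are greatest ones.\<close>

definition sub_complement :: "('o, 'm) category_data \<Rightarrow> 'o \<Rightarrow> 'm \<Rightarrow> 'm \<Rightarrow> bool" where
  "sub_complement C X m n \<longleftrightarrow>
    (\<forall>k \<in> subobjects C X. sub_le C k m \<and> sub_le C k n \<longrightarrow> (\<forall>l \<in> subobjects C X. sub_le C k l)) \<and>
    (\<forall>k \<in> subobjects C X. sub_le C m k \<and> sub_le C n k \<longrightarrow> (\<forall>l \<in> subobjects C X. sub_le C l k))"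

text \<open>In a topos every lattice of subobjects is a Heyting algebra, so it is a boolean algebra as
  soon as all its elements have complements.\<close>

definition boolean_category :: "('o, 'm) category_data \<Rightarrow> bool" where
  "boolean_category C \<longleftrightarrow> (\<forall>X \<in> Obj C. \<forall>m \<in> subobjects C X. \<exists>n \<in> subobjects C X.
    sub_complement C X m n)"

section \<open>The category of sets\<close>

text \<open>A Grothendieck universe is represented by a type of (strongly) inaccessible cardinality.
  A set of any type is small if its cardinality is below that of the type.\<close>

definition inaccessible :: "'u itself \<Rightarrow> bool" where
  "inaccessible _ \<longleftrightarrow>
    (UNIV :: nat set) \<prec> (UNIV :: 'u set) \<and>
    (\<forall>A :: 'u set. A \<prec> (UNIV :: 'u set) \<longrightarrow> Pow A \<prec> (UNIV :: 'u set)) \<and>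
    (\<forall>(A :: 'u set) (B :: 'u \<Rightarrow> 'u set). A \<prec> (UNIV :: 'u set) \<and>
      (\<forall>a \<in> A. B a \<prec> (UNIV :: 'u set)) \<longrightarrow> (\<Union>a \<in> A. B a) \<prec> (UNIV :: 'u set))"

text \<open>An arrow of the category of sets is a function together with its domain and codomain.\<close>

type_synonym 'u arrow = "'u set \<times> ('u \<Rightarrow> 'u) \<times> 'u set"

abbreviation app :: "'u arrow \<Rightarrow> 'u \<Rightarrow> 'u" where
  "app f \<equiv> fst (snd f)"

definition Sets :: "('u set, 'u arrow) category_data" where
  "Sets = \<lparr>Obj = {A. A \<prec> (UNIV :: 'u set)},
    Arr = {(A, f, B). A \<prec> (UNIV :: 'u set) \<and> B \<prec> (UNIV :: 'u set) \<and> f \<in> A \<rightarrow>\<^sub>E B},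
    Dom = fst,
    Cod = (\<lambda>f. snd (snd f)),
    Id = (\<lambda>A. (A, restrict (\<lambda>x. x) A, A)),
    Comp = (\<lambda>g f. (fst f, compose (fst f) (app g) (app f), snd (snd g)))\<rparr>"

definition inclusion :: "'u set \<Rightarrow> 'u set \<Rightarrow> 'u arrow" where
  "inclusion A B = (A, restrict (\<lambda>x. x) A, B)"

section \<open>Grothendieck topoi\<close>

definition small_category :: "('u, 'u) category_data \<Rightarrow> bool" where
  "small_category C \<longleftrightarrow> category C \<and> Obj C \<prec> (UNIV :: 'u set) \<and> Arr C \<prec> (UNIV :: 'u set)"

definition is_sieve :: "('o, 'm) category_data \<Rightarrow> 'o \<Rightarrow> 'm set \<Rightarrow> bool" where
  "is_sieve C U R \<longleftrightarrow> R \<subseteq> {f \<in> Arr C. Cod C f = U} \<and>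
    (\<forall>f \<in> R. \<forall>g \<in> Arr C. Cod C g = Dom C f \<longrightarrow> Comp C f g \<in> R)"

definition sieve_pullback :: "('o, 'm) category_data \<Rightarrow> 'm \<Rightarrow> 'm set \<Rightarrow> 'm set" where
  "sieve_pullback C h R = {g \<in> Arr C. Cod C g = Dom C h \<and> Comp C h g \<in> R}"

definition grothendieck_topology ::
  "('o, 'm) category_data \<Rightarrow> ('o \<Rightarrow> 'm set set) \<Rightarrow> bool" where
  "grothendieck_topology C J \<longleftrightarrow>
    (\<forall>U \<in> Obj C. \<forall>R \<in> J U. is_sieve C U R) \<and>
    (\<forall>U \<in> Obj C. {f \<in> Arr C. Cod C f = U} \<in> J U) \<and>
    (\<forall>h \<in> Arr C. \<forall>R \<in> J (Cod C h). sieve_pullback C h R \<in> J (Dom C h)) \<and>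
    (\<forall>U \<in> Obj C. \<forall>R \<in> J U. \<forall>S. is_sieve C U S \<and>
      (\<forall>f \<in> R. sieve_pullback C f S \<in> J (Dom C f)) \<longrightarrow> S \<in> J U)"

type_synonym 'u presheaf = "('u, 'u, 'u set, 'u arrow) functor_data"

definition matching_family ::
  "('u, 'u) category_data \<Rightarrow> 'u presheaf \<Rightarrow> 'u set \<Rightarrow> ('u \<Rightarrow> 'u) \<Rightarrow> bool" where
  "matching_family C P R x \<longleftrightarrow>
    (\<forall>f \<in> R. x f \<in> FO P (Dom C f)) \<and>
    (\<forall>f \<in> R. \<forall>g \<in> Arr C. Cod C g = Dom C f \<longrightarrow> app (FA P g) (x f) = x (Comp C f g))"

definition is_sheaf ::
  "('u, 'u) category_data \<Rightarrow> ('u \<Rightarrow> 'u set set) \<Rightarrow> 'u presheaf \<Rightarrow> bool" where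
  "is_sheaf C J P \<longleftrightarrow> is_functor (opposite C) Sets P \<and>
    (\<forall>U \<in> Obj C. \<forall>R \<in> J U. \<forall>x. matching_family C P R x \<longrightarrow>
      (\<exists>!t. t \<in> FO P U \<and> (\<forall>f \<in> R. app (FA P f) t = x f)))"

text \<open>An arrow of sheaves is a natural transformation together with its source and target. Its
  family of components is made extensional so that equality of arrows is equality of components.\<close>

definition Sheaves ::
  "('u, 'u) category_data \<Rightarrow> ('u \<Rightarrow> 'u set set) \<Rightarrow>
    ('u presheaf, 'u presheaf \<times> ('u \<Rightarrow> 'u arrow) \<times> 'u presheaf) category_data" where
  "Sheaves C J = \<lparr>Obj = {P. is_sheaf C J P},
    Arr = {(P, \<alpha>, Q). is_sheaf C J P \<and> is_sheaf C J Q \<and>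
      natural_transformation (opposite C) Sets P Q \<alpha> \<and> \<alpha> \<in> extensional (Obj C)},
    Dom = fst,
    Cod = (\<lambda>a. snd (snd a)),
    Id = (\<lambda>P. (P, \<lambda>U \<in> Obj C. Id Sets (FO P U), P)),
    Comp = (\<lambda>b a. (fst a,
      \<lambda>U \<in> Obj C. Comp Sets (fst (snd b) U) (fst (snd a) U), snd (snd b)))\<rparr>"

text \<open>Up to isomorphism, a small category has its objects and arrows in the universe.\<close>

definition grothendieck_topos :: "'u itself \<Rightarrow> ('o, 'm) category_data \<Rightarrow> bool" where
  "grothendieck_topos _ E \<longleftrightarrow>
    (\<exists>(C :: ('u, 'u) category_data) J.
      small_category C \<and> grothendieck_topology C J \<and> equivalent_categories E (Sheaves C J))"

record ('o, 'm, 'p, 'n) geometric_data =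
  inverse_image :: "('p, 'n, 'o, 'm) functor_data"
  direct_image :: "('o, 'm, 'p, 'n) functor_data"

definition geometric_morphism ::
  "('o, 'm) category_data \<Rightarrow> ('p, 'n) category_data \<Rightarrow> ('o, 'm, 'p, 'n) geometric_data \<Rightarrow> bool" where
  "geometric_morphism E E' f \<longleftrightarrow>
    left_adjoint E' E (inverse_image f) (direct_image f) \<and>
    preserves_finite_limits E' E (inverse_image f)"

section \<open>Connected atomic topoi, Galois objects, proessential points\<close>

definition connected_atomic_topos ::
  "('o, 'm) category_data \<Rightarrow> ('o, 'm, 'u set, 'u arrow) geometric_data \<Rightarrow> bool" where
  "connected_atomic_topos E \<gamma> \<longleftrightarrow>
    grothendieck_topos TYPE('u) E \<and>
    geometric_morphism E (Sets :: ('u set, 'u arrow) category_data) \<gamma> \<and>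
    full_and_faithful Sets E (inverse_image \<gamma>) \<and>
    (\<exists>L. left_adjoint E Sets L (inverse_image \<gamma>)) \<and>
    boolean_category E"

text \<open>By this convention an initial object is connected.\<close>

definition connected_object :: "('o, 'm) category_data \<Rightarrow> 'o \<Rightarrow> bool" where
  "connected_object E X \<longleftrightarrow> X \<in> Obj E \<and>
    (\<forall>A B i j. is_binary_coproduct E A B X i j \<longrightarrow> is_initial E A \<or> is_initial E B)"

definition nonempty_connected :: "('o, 'm) category_data \<Rightarrow> 'o \<Rightarrow> bool" where
  "nonempty_connected E X \<longleftrightarrow> connected_object E X \<and> \<not> is_initial E X"

text \<open>\<open>G\<close> is a set indexing the automorphisms of \<open>A\<close> by \<open>\<sigma>\<close>, \<open>(P, \<pi>\<^sub>1, \<pi>\<^sub>2)\<close> is a product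
  \<open>A \<times> \<gamma>\<^sup>*G\<close>, and \<open>\<rho> : A \<times> \<gamma>\<^sup>*G \<rightarrow> A\<close> is the action: its restriction along the section
  of \<open>\<pi>\<^sub>1\<close> given by \<open>A \<rightarrow> \<gamma>\<^sup>*{g} \<rightarrow> \<gamma>\<^sup>*G\<close> is the automorphism \<open>\<sigma> g\<close>, for every \<open>g\<close> in \<open>G\<close>. Since
  \<open>A \<times> \<gamma>\<^sup>*G\<close> is the coproduct of \<open>G\<close> copies of \<open>A\<close> with these sections as injections, this
  determines \<open>\<rho>\<close>.\<close>

definition is_aut_action ::
  "('o, 'm) category_data \<Rightarrow> ('o, 'm, 'u set, 'u arrow) geometric_data \<Rightarrow>
    'o \<Rightarrow> 'u set \<Rightarrow> ('u \<Rightarrow> 'm) \<Rightarrow> 'o \<Rightarrow> 'm \<Rightarrow> 'm \<Rightarrow> 'm \<Rightarrow> bool" where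
  "is_aut_action E \<gamma> A G \<sigma> P \<pi>\<^sub>1 \<pi>\<^sub>2 \<rho> \<longleftrightarrow>
    G \<in> Obj Sets \<and> bij_betw \<sigma> G (automorphisms E A) \<and>
    is_binary_product E A (FO (inverse_image \<gamma>) G) P \<pi>\<^sub>1 \<pi>\<^sub>2 \<and>
    \<rho> \<in> hom E P A \<and>
    (\<forall>g \<in> G. \<forall>s \<in> hom E A P. \<forall>k \<in> hom E A (FO (inverse_image \<gamma>) {g}).
      Comp E \<pi>\<^sub>1 s = Id E A \<and>
      Comp E \<pi>\<^sub>2 s = Comp E (FA (inverse_image \<gamma>) (inclusion {g} G)) k \<longrightarrow>
      Comp E \<rho> s = \<sigma> g)"

text \<open>The canonical morphism \<open>\<theta> : A \<times> \<gamma>\<^sup>*Aut(A) \<rightarrow> A \<times> A\<close> has components \<open>\<pi>\<^sub>1\<close> and \<open>\<rho>\<close>.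
  Everything bound by the existential quantifier exists and is unique up to isomorphism.\<close>

definition galois_object ::
  "('o, 'm) category_data \<Rightarrow> ('o, 'm, 'u set, 'u arrow) geometric_data \<Rightarrow> 'o \<Rightarrow> bool" where
  "galois_object E \<gamma> A \<longleftrightarrow> nonempty_connected E A \<and>
    (\<exists>T. is_terminal E T \<and> (\<exists>t \<in> hom E A T. is_epi E t)) \<and>
    (\<exists>G \<sigma> P \<pi>\<^sub>1 \<pi>\<^sub>2 \<rho> Q q\<^sub>1 q\<^sub>2 \<theta>.
      is_aut_action E \<gamma> A G \<sigma> P \<pi>\<^sub>1 \<pi>\<^sub>2 \<rho> \<and>
      is_binary_product E A A Q q\<^sub>1 q\<^sub>2 \<and>
      \<theta> \<in> hom E P Q \<and> Comp E q\<^sub>1 \<theta> = \<pi>\<^sub>1 \<and> Comp E q\<^sub>2 \<theta> = \<rho> \<and>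
      is_iso E \<theta>)"

definition is_point ::
  "('o, 'm) category_data \<Rightarrow> ('u set, 'u arrow, 'o, 'm) geometric_data \<Rightarrow> bool" where
  "is_point E p \<longleftrightarrow> geometric_morphism Sets E p"

definition proessential ::
  "('o, 'm) category_data \<Rightarrow> ('u set, 'u arrow, 'o, 'm) geometric_data \<Rightarrow> bool" where
  "proessential E p \<longleftrightarrow>
    (\<forall>X S P \<pi>. connected_object E X \<and> S \<in> Obj (Sets :: ('u set, 'u arrow) category_data) \<and>
      is_product E S (\<lambda>_. X) P \<pi> \<longrightarrow>
      bij_betw (\<lambda>y. \<lambda>s \<in> S. app (FA (inverse_image p) (\<pi> s)) y)
        (FO (inverse_image p) P) (S \<rightarrow>\<^sub>E FO (inverse_image p) X))"

definition diagram ::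
  "('o, 'm) category_data \<Rightarrow> ('o, 'm, 'u set, 'u arrow) functor_data \<Rightarrow>
    ('o \<times> 'u, ('o \<times> 'u) \<times> 'm \<times> ('o \<times> 'u)) category_data" where
  "diagram C F = \<lparr>Obj = {(X, x). X \<in> Obj C \<and> x \<in> FO F X},
    Arr = {((X, x), f, (Y, y)). x \<in> FO F X \<and> y \<in> FO F Y \<and> f \<in> hom C X Y \<and> app (FA F f) x = y},
    Dom = fst,
    Cod = (\<lambda>a. snd (snd a)),
    Id = (\<lambda>z. (z, Id C (fst z), z)),
    Comp = (\<lambda>b a. (fst a, Comp C (fst (snd b)) (fst (snd a)), snd (snd b)))\<rparr>"

end

theory Submission
  imports Defs
begin

text \<open>Write \<open>p\<^sup>*\<close> for the inverse image of the point. Since \<open>p\<^sup>*\<close> has a right adjoint, for every subset \<open>T\<close>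
  of \<open>p\<^sup>*X\<close> there is a largest subobject of \<open>X\<close> that \<open>p\<^sup>*\<close> sends into \<open>T\<close>. Connectedness of the topos
  shows that only the initial object has an empty fibre, whence by booleanness \<open>p\<^sup>*\<close> reflects
  isomorphisms; together these facts allow an arrow \<open>X \<rightarrow> Z\<close> to be defined by a function
  \<open>p\<^sup>*X \<rightarrow> p\<^sup>*Z\<close> that is locally given by arrows.

  Let \<open>X\<close> be connected and let \<open>P\<close> be the power of \<open>X\<close> by the set \<open>p\<^sup>*X\<close>. As the point is
  proessential, the identity function is an element of \<open>p\<^sup>*P\<close>. Let \<open>A\<close> be its connected component in
  \<open>P\<close> and \<open>a\<close> the corresponding element of \<open>p\<^sup>*A\<close>. The projections restrict to arrows \<open>(A, a) \<rightarrow> (X, x)\<close>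
  for all \<open>x\<close>, hence every \<open>b\<close> in \<open>p\<^sup>*A\<close> is the image of \<open>a\<close> under an endomorphism of \<open>A\<close>.
  All endomorphisms are epimorphisms determined by their value at \<open>a\<close>, so they have right inverses
  and are automorphisms. So \<open>Aut(A)\<close> acts simply transitively on \<open>p\<^sup>*A\<close> and \<open>A\<close> is Galois.\<close>

section \<open>Categories and equivalences\<close>

text \<open>The topos is given only up to equivalence with a category of sheaves, so what is
  imported from sheaves is kept to three facts that survive an equivalence: small limits, gluing of
  compatible arrows over a subobject, and a strict initial object. Everything else is argued on
  fibres. Images and graphs of functions have no separate construction: the largest subobject whose
  fibre lies below a given subset replaces them. An arrow is obtained by cutting out its graph in a
  product, once that graph is seen to project bijectively. The endomorphism carrying
  \<open>a\<close> to \<open>b\<close> exists for the following reason. Let \<open>z x\<close> be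
  the coordinate of \<open>b\<close> at \<open>x\<close>. Reindexing the projections along
  \<open>z\<close> gives an arrow \<open>A\<close> -> \<open>P\<close> whose value at
  \<open>a\<close> has coordinate \<open>z x\<close> at \<open>x\<close>, because the coordinate of
  \<open>a\<close> at every index is the index itself. So this value is \<open>b\<close>, and since
  no proper subobject of \<open>A\<close> contains \<open>a\<close>, the arrow sends the whole of
  \<open>A\<close> into \<open>A\<close>.\<close>

lemma homD:
  assumes "f \<in> hom C X Y"
  shows "f \<in> Arr C" "Dom C f = X" "Cod C f = Y"
  using assms by (auto simp: hom_def)

lemma Arr_hom: "f \<in> Arr C \<Longrightarrow> f \<in> hom C (Dom C f) (Cod C f)"
  by (simp add: hom_def)

lemma hom_opposite [simp]: "hom (opposite C) X Y = hom C Y X"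
  by (auto simp: hom_def opposite_def)

lemma opposite_simps [simp]:
  "Obj (opposite C) = Obj C" "Arr (opposite C) = Arr C" "Dom (opposite C) = Cod C"
  "Cod (opposite C) = Dom C" "Id (opposite C) = Id C" "Comp (opposite C) g f = Comp C f g"
  by (simp_all add: opposite_def)

lemma is_binary_coproduct_iff:
  "is_binary_coproduct C A B X i j \<longleftrightarrow> X \<in> Obj C \<and> i \<in> hom C A X \<and> j \<in> hom C B X \<and>
    (\<forall>T \<in> Obj C. \<forall>f \<in> hom C A T. \<forall>g \<in> hom C B T.
      \<exists>!h. h \<in> hom C X T \<and> Comp C h i = f \<and> Comp C h j = g)"
  by (simp add: is_binary_coproduct_def is_binary_product_def)

context category
begin

abbreviation comp (infixl "\<cdot>" 70) where "g \<cdot> f \<equiv> Comp C g f"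

lemma hom_obj:
  assumes "f \<in> hom C X Y"
  shows "X \<in> Obj C" "Y \<in> Obj C"
  using dom_obj[of f] cod_obj[of f] homD[OF assms] by simp_all

lemma monoI:
  assumes "m \<in> hom C X Y"
    and "\<And>T u v. u \<in> hom C T X \<Longrightarrow> v \<in> hom C T X \<Longrightarrow> m \<cdot> u = m \<cdot> v \<Longrightarrow> u = v"
  shows "is_mono C m"
  using assms(2) homD[OF assms(1)] unfolding is_mono_def by simp

lemma monoD:
  assumes "is_mono C m" "m \<in> hom C X Y" "u \<in> hom C T X" "v \<in> hom C T X" "m \<cdot> u = m \<cdot> v"
  shows "u = v"
  using assms(1,3-5) hom_obj(1)[OF assms(3)] homD(2)[OF assms(2)] unfolding is_mono_def by simp

lemma isoI:
  assumes "f \<in> hom C X Y" "g \<in> hom C Y X" "g \<cdot> f = Id C X" "f \<cdot> g = Id C Y"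
  shows "is_iso C f"
  using assms(2-4) homD[OF assms(1)] unfolding is_iso_def by metis

lemma isoE:
  assumes "is_iso C f" "f \<in> hom C X Y"
  obtains g where "g \<in> hom C Y X" "g \<cdot> f = Id C X" "f \<cdot> g = Id C Y"
  using assms(1) homD[OF assms(2)] unfolding is_iso_def by metis

lemma split_mono:
  assumes "m \<in> hom C X Y" "r \<in> hom C Y X" "r \<cdot> m = Id C X"
  shows "is_mono C m"
proof (rule monoI[OF assms(1)])
  fix T u v assume "u \<in> hom C T X" "v \<in> hom C T X" "m \<cdot> u = m \<cdot> v"
  then show "u = v"
    using assoc[OF _ assms(1,2)] assms(3) id_left by metis
qed

lemma iso_of_split_mono:
  assumes m: "m \<in> hom C X Y" "is_mono C m" and s: "s \<in> hom C Y X" "m \<cdot> s = Id C Y"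
  shows "is_iso C m"
proof (rule isoI[OF m(1) s(1) _ s(2)])
  have X: "X \<in> Obj C" and Y: "Y \<in> Obj C" using hom_obj m(1) by auto
  have "m \<cdot> (s \<cdot> m) = m \<cdot> Id C X"
    using assoc[OF m(1) s(1) m(1)] s(2) id_left[OF m(1)] id_right[OF m(1)] by simp
  then show "s \<cdot> m = Id C X"
    using monoD[OF m(2,1)] comp_hom[OF m(1) s(1)] id_hom[OF X] by blast
qed

lemma mono_comp:
  assumes "m \<in> hom C X Y" "n \<in> hom C Y Z" "is_mono C m" "is_mono C n"
  shows "is_mono C (n \<cdot> m)"
proof (rule monoI[OF comp_hom[OF assms(1,2)]])
  fix T u v assume u: "u \<in> hom C T X" "v \<in> hom C T X" "n \<cdot> m \<cdot> u = n \<cdot> m \<cdot> v"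
  then have "n \<cdot> (m \<cdot> u) = n \<cdot> (m \<cdot> v)"
    using assoc[OF _ assms(1,2)] by simp
  then have "m \<cdot> u = m \<cdot> v"
    using monoD[OF assms(4,2)] comp_hom[OF _ assms(1)] u by blast
  then show "u = v"
    using monoD[OF assms(3,1)] u by blast
qed

end

section \<open>Pullbacks, limits of graphs and effective unions\<close>

definition is_pullback ::
  "('o, 'm) category_data \<Rightarrow> 'm \<Rightarrow> 'm \<Rightarrow> 'o \<Rightarrow> 'm \<Rightarrow> 'm \<Rightarrow> bool" where
  "is_pullback C f g P p q \<longleftrightarrow>
    p \<in> hom C P (Dom C f) \<and> q \<in> hom C P (Dom C g) \<and> Comp C f p = Comp C g q \<and>
    (\<forall>T. \<forall>a \<in> hom C T (Dom C f). \<forall>b \<in> hom C T (Dom C g). Comp C f a = Comp C g b \<longrightarrow>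
      (\<exists>!h. h \<in> hom C T P \<and> Comp C p h = a \<and> Comp C q h = b))"

text \<open>Limits of diagrams given by a family of objects and a set of arrows between them, which
  need not be closed under composition.\<close>

definition is_graph_cone ::
  "('o, 'm) category_data \<Rightarrow> 'i set \<Rightarrow> ('i \<Rightarrow> 'o) \<Rightarrow> ('i \<times> 'm \<times> 'i) set \<Rightarrow> 'o \<Rightarrow> ('i \<Rightarrow> 'm) \<Rightarrow> bool"
  where
  "is_graph_cone C I X R T \<mu> \<longleftrightarrow> T \<in> Obj C \<and> (\<forall>i \<in> I. \<mu> i \<in> hom C T (X i)) \<and>
    (\<forall>(i, f, j) \<in> R. Comp C f (\<mu> i) = \<mu> j)"

definition is_graph_limit ::
  "('o, 'm) category_data \<Rightarrow> 'i set \<Rightarrow> ('i \<Rightarrow> 'o) \<Rightarrow> ('i \<times> 'm \<times> 'i) set \<Rightarrow> 'o \<Rightarrow> ('i \<Rightarrow> 'm) \<Rightarrow> bool"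
  where
  "is_graph_limit C I X R L leg \<longleftrightarrow> is_graph_cone C I X R L leg \<and>
    (\<forall>T \<mu>. is_graph_cone C I X R T \<mu> \<longrightarrow>
      (\<exists>!h. h \<in> hom C T L \<and> (\<forall>i \<in> I. Comp C (leg i) h = \<mu> i)))"

definition is_graph :: "('o, 'm) category_data \<Rightarrow> 'i set \<Rightarrow> ('i \<Rightarrow> 'o) \<Rightarrow> ('i \<times> 'm \<times> 'i) set \<Rightarrow> bool"
  where
  "is_graph C I X R \<longleftrightarrow> X \<in> I \<rightarrow> Obj C \<and>
    (\<forall>(i, f, j) \<in> R. i \<in> I \<and> j \<in> I \<and> f \<in> hom C (X i) (X j))"

text \<open>The index set is a parameter so that one construction serves three times: the empty set
  gives a terminal object, three nodes with two edges give pullbacks, and the fibre of an object,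
  taken without edges, gives the power of the object by its fibre.\<close>

definition has_graph_limits :: "('o, 'm) category_data \<Rightarrow> 'i set \<Rightarrow> bool" where
  "has_graph_limits C I \<longleftrightarrow>
    (\<forall>X R. is_graph C I X R \<longrightarrow> (\<exists>L leg. is_graph_limit C I X R L leg))"

text \<open>The part of the effectiveness of unions that is used, phrased without the lattice of
  subobjects so that it is easily transported along an equivalence. A pair \<open>(m, u)\<close> in \<open>\<Phi>\<close>
  prescribes the value \<open>u\<close> along \<open>m\<close>.\<close>

definition compatible_family ::
  "('o, 'm) category_data \<Rightarrow> 'o \<Rightarrow> 'o \<Rightarrow> ('m \<times> 'm) set \<Rightarrow> bool" where
  "compatible_family C X Z \<Phi> \<longleftrightarrow>
    (\<forall>(m, u) \<in> \<Phi>. m \<in> hom C (Dom C m) X \<and> u \<in> hom C (Dom C m) Z) \<and>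
    (\<forall>(m, u) \<in> \<Phi>. \<forall>(m', u') \<in> \<Phi>. \<forall>T. \<forall>a \<in> hom C T (Dom C m). \<forall>b \<in> hom C T (Dom C m').
      Comp C m a = Comp C m' b \<longrightarrow> Comp C u a = Comp C u' b)"

lemma compatible_familyD:
  assumes "compatible_family C X Z \<Phi>" "(m, u) \<in> \<Phi>"
  shows "m \<in> hom C (Dom C m) X" "u \<in> hom C (Dom C m) Z"
    and "(m', u') \<in> \<Phi> \<Longrightarrow> a \<in> hom C T (Dom C m) \<Longrightarrow> b \<in> hom C T (Dom C m') \<Longrightarrow>
      Comp C m a = Comp C m' b \<Longrightarrow> Comp C u a = Comp C u' b"
  using assms unfolding compatible_family_def by fast+

text \<open>\<open>K\<close> need not be the union of the members of \<Phi>, only some subobject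
  through which they all factor compatibly with the prescribed values. This is enough for
  complements: a subobject containing both halves has a section.\<close>

definition extends_to_subobject ::
  "('o, 'm) category_data \<Rightarrow> 'o \<Rightarrow> 'o \<Rightarrow> ('m \<times> 'm) set \<Rightarrow> bool" where
  "extends_to_subobject C X Z \<Phi> \<longleftrightarrow>
    (\<exists>K k w. k \<in> hom C K X \<and> is_mono C k \<and> w \<in> hom C K Z \<and>
      (\<forall>(m, u) \<in> \<Phi>. \<exists>h \<in> hom C (Dom C m) K. Comp C k h = m \<and> Comp C w h = u))"

definition has_effective_unions :: "('o, 'm) category_data \<Rightarrow> bool" where
  "has_effective_unions C \<longleftrightarrow>
    (\<forall>X \<in> Obj C. \<forall>Z \<in> Obj C. \<forall>\<Phi>. compatible_family C X Z \<Phi> \<longrightarrow> extends_to_subobject C X Z \<Phi>)"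

text \<open>In a category the identity makes \<open>Z\<close> itself initial, so initiality and
  strictness are asked for together. Mentioning only the existence of arrows into one object makes
  the property easy to carry back along an equivalence.\<close>

definition has_strict_initial :: "('o, 'm) category_data \<Rightarrow> bool" where
  "has_strict_initial C \<longleftrightarrow>
    (\<exists>Z \<in> Obj C. \<forall>X \<in> Obj C. hom C X Z \<noteq> {} \<longrightarrow> is_initial C X)"

section \<open>Transport of exactness properties along an equivalence\<close>

locale weak_equivalence = is_functor C D F
  for C :: "('o, 'm) category_data" and D :: "('p, 'n) category_data"
    and F :: "('o, 'm, 'p, 'n) functor_data" +
  assumes faithful: "f \<in> hom C X Y \<Longrightarrow> g \<in> hom C X Y \<Longrightarrow> FA F f = FA F g \<Longrightarrow> f = g"
    and full: "X \<in> Obj C \<Longrightarrow> Y \<in> Obj C \<Longrightarrow> h \<in> hom D (FO F X) (FO F Y) \<Longrightarrow>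
      \<exists>f \<in> hom C X Y. FA F f = h"
    and ess_surj: "W \<in> Obj D \<Longrightarrow> \<exists>X \<in> Obj C. \<exists>i \<in> hom D (FO F X) W. \<exists>j \<in> hom D W (FO F X).
      Comp D j i = Id D (FO F X) \<and> Comp D i j = Id D W"
begin

abbreviation comp_D (infixl "\<star>" 70) where "g \<star> f \<equiv> Comp D g f"

text \<open>Essential surjectivity moves the apex of the limit of the image graph to an object
  \<open>FO F L\<close>. Its legs then lift by fullness, while faithfulness brings back the cone
  equations and the uniqueness of comparison arrows.\<close>

lemma reflects_graph_limits:
  fixes I :: "'i set"
  assumes "has_graph_limits D I"
  shows "has_graph_limits C I"
  unfolding has_graph_limits_def
proof (intro allI impI)
  fix X :: "'i \<Rightarrow> 'o" and R assume gr: "is_graph C I X R"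
  define R' where "R' = {(i, FA F f, j) |i f j. (i, f, j) \<in> R}"
  have R: "i \<in> I" "j \<in> I" "f \<in> hom C (X i) (X j)" if "(i, f, j) \<in> R" for i f j
    using gr that by (auto simp: is_graph_def)
  have X: "X i \<in> Obj C" if "i \<in> I" for i
    using gr that by (auto simp: is_graph_def)
  have "is_graph D I (\<lambda>i. FO F (X i)) R'"
    unfolding is_graph_def R'_def using map_obj[OF X] map_hom[OF R(3)] R(1,2) by fast
  then obtain L' leg' where L': "is_graph_limit D I (\<lambda>i. FO F (X i)) R' L' leg'"
    using assms unfolding has_graph_limits_def by blast
  then have L'_obj: "L' \<in> Obj D" and leg': "\<And>i. i \<in> I \<Longrightarrow> leg' i \<in> hom D L' (FO F (X i))"
    and "\<forall>(i, f, j) \<in> R'. f \<star> leg' i = leg' j"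
    unfolding is_graph_limit_def is_graph_cone_def by blast+
  then have R': "FA F f \<star> leg' i = leg' j" if "(i, f, j) \<in> R" for i f j
    using that unfolding R'_def by blast
  obtain L i0 j0 where L: "L \<in> Obj C" and i0: "i0 \<in> hom D (FO F L) L'"
    and j0: "j0 \<in> hom D L' (FO F L)"
    and ji: "j0 \<star> i0 = Id D (FO F L)" and ij: "i0 \<star> j0 = Id D L'"
    using ess_surj[OF L'_obj] by blast
  have "\<exists>f \<in> hom C L (X i). FA F f = leg' i \<star> i0" if "i \<in> I" for i
    using full[OF L X[OF that]] target.comp_hom[OF i0 leg'[OF that]] by blast
  then obtain leg where leg: "\<And>i. i \<in> I \<Longrightarrow> leg i \<in> hom C L (X i)"
    and F_leg: "\<And>i. i \<in> I \<Longrightarrow> FA F (leg i) = leg' i \<star> i0"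
    by metis
  have cone: "is_graph_cone C I X R L leg"
  proof -
    have "Comp C f (leg i) = leg j" if r: "(i, f, j) \<in> R" for i f j
    proof (rule faithful)
      show "Comp C f (leg i) \<in> hom C L (X j)" "leg j \<in> hom C L (X j)"
        using source.comp_hom[OF leg[OF R(1)[OF r]] R(3)[OF r]] leg[OF R(2)[OF r]] by auto
      have "FA F (Comp C f (leg i)) = FA F f \<star> (leg' i \<star> i0)"
        using map_comp[OF leg[OF R(1)[OF r]] R(3)[OF r]] F_leg[OF R(1)[OF r]] by simp
      also have "\<dots> = leg' j \<star> i0"
        using target.assoc[OF i0 leg'[OF R(1)[OF r]] map_hom[OF R(3)[OF r]]] R'[OF r] by simp
      finally show "FA F (Comp C f (leg i)) = FA F (leg j)"
        using F_leg[OF R(2)[OF r]] by simp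
    qed
    then show ?thesis unfolding is_graph_cone_def using L leg by blast
  qed
  have "\<exists>!h. h \<in> hom C T L \<and> (\<forall>i \<in> I. Comp C (leg i) h = \<mu> i)"
    if c: "is_graph_cone C I X R T \<mu>" for T \<mu>
  proof -
    have T: "T \<in> Obj C" and \<mu>: "\<And>i. i \<in> I \<Longrightarrow> \<mu> i \<in> hom C T (X i)"
      and \<mu>R: "\<And>i f j. (i, f, j) \<in> R \<Longrightarrow> Comp C f (\<mu> i) = \<mu> j"
      using c by (auto simp: is_graph_cone_def)
    have "FA F f \<star> FA F (\<mu> i) = FA F (\<mu> j)" if r: "(i, f, j) \<in> R" for i f j
      using map_comp[OF \<mu>[OF R(1)[OF r]] R(3)[OF r]] \<mu>R[OF r] by simp
    then have "is_graph_cone D I (\<lambda>i. FO F (X i)) R' (FO F T) (\<lambda>i. FA F (\<mu> i))"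
      unfolding is_graph_cone_def R'_def using map_obj[OF T] map_hom[OF \<mu>] by fast
    then have ex1: "\<exists>!h. h \<in> hom D (FO F T) L' \<and> (\<forall>i \<in> I. leg' i \<star> h = FA F (\<mu> i))"
      using L' by (auto simp: is_graph_limit_def)
    then obtain h' where h': "h' \<in> hom D (FO F T) L'" "\<And>i. i \<in> I \<Longrightarrow> leg' i \<star> h' = FA F (\<mu> i)"
      by blast
    obtain h where h: "h \<in> hom C T L" "FA F h = j0 \<star> h'"
      using full[OF T L target.comp_hom[OF h'(1) j0]] by blast
    have key: "FA F (Comp C (leg i) h) = leg' i \<star> (i0 \<star> FA F h)"
      if "i \<in> I" "h \<in> hom C T L" for i h
      using map_comp[OF that(2) leg[OF that(1)]] F_leg[OF that(1)]
        target.assoc[OF map_hom[OF that(2)] i0 leg'[OF that(1)]] by simp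
    have i0h: "i0 \<star> FA F h = h'"
      using target.assoc[OF h'(1) j0 i0] h(2) ij target.id_left[OF h'(1)] by simp
    show ?thesis
    proof (rule ex1I[of _ h])
      have "Comp C (leg i) h = \<mu> i" if i: "i \<in> I" for i
        using faithful[OF source.comp_hom[OF h(1) leg[OF i]] \<mu>[OF i]] key[OF i h(1)] i0h h'(2)[OF i]
        by simp
      then show "h \<in> hom C T L \<and> (\<forall>i \<in> I. Comp C (leg i) h = \<mu> i)" using h(1) by blast
    next
      fix g assume g: "g \<in> hom C T L \<and> (\<forall>i \<in> I. Comp C (leg i) g = \<mu> i)"
      then have g1: "g \<in> hom C T L" by blast
      have "leg' i \<star> (i0 \<star> FA F g) = FA F (\<mu> i)" if i: "i \<in> I" for i
        using key[OF i g1] g i by simp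
      then have "i0 \<star> FA F g = h'"
        using ex1 h' target.comp_hom[OF map_hom[OF g1] i0] by blast
      then have "j0 \<star> (i0 \<star> FA F g) = j0 \<star> (i0 \<star> FA F h)" using i0h by simp
      then have "FA F g = FA F h"
        using target.assoc[OF map_hom[OF g1] i0 j0] target.assoc[OF map_hom[OF h(1)] i0 j0] ji
          target.id_left[OF map_hom[OF g1]] target.id_left[OF map_hom[OF h(1)]] by simp
      then show "g = h" using faithful[OF g1 h(1)] by blast
    qed
  qed
  then show "\<exists>L leg. is_graph_limit C I X R L leg"
    unfolding is_graph_limit_def using cone by blast
qed

text \<open>Compatibility of the image family has to hold for all test objects of \<open>D\<close>,
  not only for those in the image of \<open>F\<close>; a test object is therefore replaced by an
  isomorphic \<open>FO F T0\<close>, where fullness turns the test arrows into arrows of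
  \<open>C\<close>. Likewise the subobject \<open>K'\<close> found in \<open>D\<close> is replaced
  by an isomorphic \<open>FO F K\<close>.\<close>

lemma reflects_effective_unions:
  assumes "has_effective_unions D"
  shows "has_effective_unions C"
  unfolding has_effective_unions_def
proof (intro ballI allI impI)
  fix X Z \<Phi> assume X: "X \<in> Obj C" and Z: "Z \<in> Obj C" and \<Phi>: "compatible_family C X Z \<Phi>"
  define \<Psi> where "\<Psi> = {(FA F m, FA F u) |m u. (m, u) \<in> \<Phi>}"
  note m = compatible_familyD(1,2)[OF \<Phi>] and compat = compatible_familyD(3)[OF \<Phi>]
  have FDom: "Dom D (FA F m) = FO F (Dom C m)" if "(m, u) \<in> \<Phi>" for m u
    using homD(2)[OF map_hom[OF m(1)[OF that]]] .
  have compat': "FA F u \<star> a' = FA F u' \<star> b'"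
    if mu: "(m, u) \<in> \<Phi>" "(m', u') \<in> \<Phi>"
      and a': "a' \<in> hom D T (FO F (Dom C m))" and b': "b' \<in> hom D T (FO F (Dom C m'))"
      and eq: "FA F m \<star> a' = FA F m' \<star> b'" for m u m' u' T a' b'
  proof -
    obtain T0 i j where T0: "T0 \<in> Obj C" and i: "i \<in> hom D (FO F T0) T"
      and j: "j \<in> hom D T (FO F T0)" and ij: "i \<star> j = Id D T"
      using ess_surj[OF target.hom_obj(1)[OF a']] by blast
    obtain a where a: "a \<in> hom C T0 (Dom C m)" "FA F a = a' \<star> i"
      using full[OF T0 _ target.comp_hom[OF i a']] source.hom_obj(1)[OF m(1)[OF mu(1)]] by blast
    obtain b where b: "b \<in> hom C T0 (Dom C m')" "FA F b = b' \<star> i"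
      using full[OF T0 _ target.comp_hom[OF i b']] source.hom_obj(1)[OF m(1)[OF mu(2)]] by blast
    have "FA F (Comp C m a) = FA F (Comp C m' b)"
      using map_comp[OF a(1) m(1)[OF mu(1)]] map_comp[OF b(1) m(1)[OF mu(2)]] a(2) b(2) eq
        target.assoc[OF i a' map_hom[OF m(1)[OF mu(1)]]]
        target.assoc[OF i b' map_hom[OF m(1)[OF mu(2)]]] by simp
    then have "Comp C m a = Comp C m' b"
      using faithful source.comp_hom[OF a(1) m(1)[OF mu(1)]]
        source.comp_hom[OF b(1) m(1)[OF mu(2)]] by blast
    then have "Comp C u a = Comp C u' b" using compat[OF mu a(1) b(1)] by blast
    then have eq2: "FA F u \<star> (a' \<star> i) = FA F u' \<star> (b' \<star> i)"
      using map_comp[OF a(1) m(2)[OF mu(1)]] map_comp[OF b(1) m(2)[OF mu(2)]] a(2) b(2) by simp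
    \<comment> \<open>Since \<open>i\<close> has the right inverse \<open>j\<close>, the equation
      precomposed with \<open>i\<close> gives back the original one.\<close>
    have canc: "FA F u \<star> a' = (FA F u \<star> (a' \<star> i)) \<star> j"
      if "(m, u) \<in> \<Phi>" "a' \<in> hom D T (FO F (Dom C m))" for m u a'
    proof -
      note Fu = map_hom[OF m(2)[OF that(1)]]
      have "(FA F u \<star> (a' \<star> i)) \<star> j = FA F u \<star> (a' \<star> (i \<star> j))"
        using target.assoc[OF j target.comp_hom[OF i that(2)] Fu] target.assoc[OF j i that(2)]
        by simp
      then show ?thesis using ij target.id_right[OF that(2)] by simp
    qed
    show ?thesis using canc[OF mu(1) a'] canc[OF mu(2) b'] eq2 by simp
  qed
  have "compatible_family D (FO F X) (FO F Z) \<Psi>"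
    unfolding compatible_family_def
  proof (intro conjI)
    show "\<forall>(m, u) \<in> \<Psi>. m \<in> hom D (Dom D m) (FO F X) \<and> u \<in> hom D (Dom D m) (FO F Z)"
    proof (safe, goal_cases)
      case (1 m1 u1)
      then obtain m u where mu: "(m, u) \<in> \<Phi>" "m1 = FA F m" unfolding \<Psi>_def by blast
      then show ?case using map_hom[OF m(1)[OF mu(1)]] FDom[OF mu(1)] by simp
    next
      case (2 m1 u1)
      then obtain m u where mu: "(m, u) \<in> \<Phi>" "m1 = FA F m" "u1 = FA F u" unfolding \<Psi>_def by blast
      then show ?case using map_hom[OF m(2)[OF mu(1)]] FDom[OF mu(1)] by simp
    qed
    show "\<forall>(m, u) \<in> \<Psi>. \<forall>(m', u') \<in> \<Psi>. \<forall>T. \<forall>a \<in> hom D T (Dom D m). \<forall>b \<in> hom D T (Dom D m').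
        m \<star> a = m' \<star> b \<longrightarrow> u \<star> a = u' \<star> b"
    proof (safe, goal_cases)
      case (1 m1 u1 m2 u2 T a b)
      then obtain m u m' u' where mu: "(m, u) \<in> \<Phi>" "(m', u') \<in> \<Phi>"
        and eq: "m1 = FA F m" "u1 = FA F u" "m2 = FA F m'" "u2 = FA F u'"
        unfolding \<Psi>_def by blast
      show ?case using 1(3-5) compat'[OF mu] unfolding eq FDom[OF mu(1)] FDom[OF mu(2)] by blast
    qed
  qed
  then have "extends_to_subobject D (FO F X) (FO F Z) \<Psi>"
    using assms map_obj[OF X] map_obj[OF Z] unfolding has_effective_unions_def by blast
  then obtain K' k' w' where k': "k' \<in> hom D K' (FO F X)" "is_mono D k'"
    and w': "w' \<in> hom D K' (FO F Z)"
    and fac': "\<forall>(m, u) \<in> \<Psi>. \<exists>h \<in> hom D (Dom D m) K'. k' \<star> h = m \<and> w' \<star> h = u"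
    unfolding extends_to_subobject_def by blast
  have fac: "\<exists>h \<in> hom D (FO F (Dom C m)) K'. k' \<star> h = FA F m \<and> w' \<star> h = FA F u"
    if mu: "(m, u) \<in> \<Phi>" for m u
  proof -
    have "(FA F m, FA F u) \<in> \<Psi>" using mu unfolding \<Psi>_def by blast
    then show ?thesis using fac' FDom[OF mu] by fastforce
  qed
  obtain K i j where K: "K \<in> Obj C" and i: "i \<in> hom D (FO F K) K'" and j: "j \<in> hom D K' (FO F K)"
    and ji: "j \<star> i = Id D (FO F K)" and ij: "i \<star> j = Id D K'"
    using ess_surj[OF target.hom_obj(1)[OF k'(1)]] by blast
  obtain k where k: "k \<in> hom C K X" "FA F k = k' \<star> i"
    using full[OF K X target.comp_hom[OF i k'(1)]] by blast
  obtain w where w: "w \<in> hom C K Z" "FA F w = w' \<star> i"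
    using full[OF K Z target.comp_hom[OF i w']] by blast
  have "is_mono C k"
  proof (rule source.monoI[OF k(1)])
    fix T u v assume u: "u \<in> hom C T K" and v: "v \<in> hom C T K" and eq: "Comp C k u = Comp C k v"
    have "is_mono D (k' \<star> i)"
      using target.mono_comp[OF i k'(1) target.split_mono[OF i j ji] k'(2)] .
    moreover have "k' \<star> i \<star> FA F u = k' \<star> i \<star> FA F v"
      using eq map_comp[OF u k(1)] map_comp[OF v k(1)] k(2) by simp
    ultimately have "FA F u = FA F v"
      using target.monoD[OF _ target.comp_hom[OF i k'(1)] map_hom[OF u] map_hom[OF v]] by blast
    then show "u = v" using faithful[OF u v] by blast
  qed
  moreover have "\<exists>h \<in> hom C (Dom C m) K. Comp C k h = m \<and> Comp C w h = u" if mu: "(m, u) \<in> \<Phi>" for m u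
  proof -
    obtain h' where h': "h' \<in> hom D (FO F (Dom C m)) K'" "k' \<star> h' = FA F m" "w' \<star> h' = FA F u"
      using fac[OF mu] by blast
    obtain h where h: "h \<in> hom C (Dom C m) K" "FA F h = j \<star> h'"
      using full[OF source.hom_obj(1)[OF m(1)[OF mu]] K target.comp_hom[OF h'(1) j]] by blast
    have ijh: "i \<star> (j \<star> h') = h'"
      using target.assoc[OF h'(1) j i] ij target.id_left[OF h'(1)] by simp
    have "FA F (Comp C k h) = FA F m"
      using map_comp[OF h(1) k(1)] h(2) k(2) target.assoc[OF map_hom[OF h(1)] i k'(1)] ijh h'(2)
      by simp
    moreover have "FA F (Comp C w h) = FA F u"
      using map_comp[OF h(1) w(1)] h(2) w(2) target.assoc[OF map_hom[OF h(1)] i w'] ijh h'(3)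
      by simp
    ultimately show ?thesis
      using faithful source.comp_hom[OF h(1) k(1)] source.comp_hom[OF h(1) w(1)] m[OF mu] h(1)
      by blast
  qed
  ultimately show "extends_to_subobject C X Z \<Phi>"
    unfolding extends_to_subobject_def using k(1) w(1) by blast
qed

lemma reflects_strict_initial:
  assumes "has_strict_initial D"
  shows "has_strict_initial C"
proof -
  obtain Z' where Z': "Z' \<in> Obj D" and ini: "\<And>X. X \<in> Obj D \<Longrightarrow> hom D X Z' \<noteq> {} \<Longrightarrow> is_initial D X"
    using assms by (auto simp: has_strict_initial_def)
  obtain Z i where Z: "Z \<in> Obj C" and i: "i \<in> hom D (FO F Z) Z'"
    using ess_surj[OF Z'] by blast
  have "is_initial C X" if X: "X \<in> Obj C" and ne: "hom C X Z \<noteq> {}" for X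
  proof -
    have "hom D (FO F X) Z' \<noteq> {}"
      using ne target.comp_hom[OF map_hom i] by blast
    then have I: "is_initial D (FO F X)" using ini[OF map_obj[OF X]] by blast
    have "\<exists>!f. f \<in> hom C X Y" if Y: "Y \<in> Obj C" for Y
    proof -
      have ex1: "\<exists>!f. f \<in> hom D (FO F X) (FO F Y)"
        using I map_obj[OF Y] by (auto simp: is_initial_def)
      then obtain f where "f \<in> hom C X Y" using full[OF X Y] by blast
      then show ?thesis using ex1 faithful map_hom by metis
    qed
    then show ?thesis using X by (auto simp: is_initial_def)
  qed
  then show ?thesis using Z by (auto simp: has_strict_initial_def)
qed

end

text \<open>Naturality equates \<open>f\<close> after \<open>\<alpha> X\<close> with
  \<open>\<alpha> Y\<close> after the image of \<open>f\<close> under both functors, and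
  \<open>\<alpha> X\<close> is invertible; so \<open>FA F f\<close> determines \<open>f\<close>.
  With the roles exchanged the same lemma makes \<open>G\<close> faithful, which is what fullness of
  \<open>F\<close> rests on.\<close>

lemma faithful_of_natural_iso_id:
  assumes "is_functor C D F" "is_functor D C G"
    and iso: "naturally_isomorphic C C (comp_functor G F) id_functor"
    and f: "f \<in> hom C X Y" and g: "g \<in> hom C X Y" and eq: "FA F f = FA F g"
  shows "f = g"
proof -
  interpret F: is_functor C D F by fact
  interpret G: is_functor D C G by fact
  obtain \<alpha> where nat: "natural_transformation C C (comp_functor G F) id_functor \<alpha>"
    and isos: "\<forall>X \<in> Obj C. is_iso C (\<alpha> X)"
    using iso by (auto simp: naturally_isomorphic_def)
  have X: "X \<in> Obj C" using F.source.hom_obj(1)[OF f] .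
  have \<alpha>: "\<alpha> X \<in> hom C (FO G (FO F X)) X"
    using nat X by (simp add: natural_transformation_def comp_functor_def id_functor_def)
  have n: "Comp C (\<alpha> Y) (FA G (FA F f)) = Comp C f (\<alpha> X)" if "f \<in> hom C X Y" for f
    using nat homD[OF that]
    by (auto simp: natural_transformation_def comp_functor_def id_functor_def)
  have fg: "Comp C f (\<alpha> X) = Comp C g (\<alpha> X)" using n[OF f] n[OF g] eq by simp
  obtain b where b: "b \<in> hom C X (FO G (FO F X))" "Comp C (\<alpha> X) b = Id C X"
    using F.source.isoE[of "\<alpha> X"] isos X \<alpha> by metis
  have "f = Comp C (Comp C f (\<alpha> X)) b" "g = Comp C (Comp C g (\<alpha> X)) b"
    using F.source.assoc[OF b(1) \<alpha> f] F.source.assoc[OF b(1) \<alpha> g] b(2)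
      F.source.id_right[OF f] F.source.id_right[OF g] by auto
  then show ?thesis using fg by simp
qed

lemma weak_equivalence_of_equivalent:
  assumes "equivalent_categories C D"
  obtains F where "weak_equivalence C D F"
proof -
  obtain F G where F: "is_functor C D F" and G: "is_functor D C G"
    and GF: "naturally_isomorphic C C (comp_functor G F) id_functor"
    and FG: "naturally_isomorphic D D (comp_functor F G) id_functor"
    using assms by (auto simp: equivalent_categories_def)
  interpret F: is_functor C D F by fact
  interpret G: is_functor D C G by fact
  obtain \<alpha> where nat: "natural_transformation C C (comp_functor G F) id_functor \<alpha>"
    and isos: "\<forall>X \<in> Obj C. is_iso C (\<alpha> X)"
    using GF by (auto simp: naturally_isomorphic_def)
  have \<alpha>: "\<alpha> X \<in> hom C (FO G (FO F X)) X" if "X \<in> Obj C" for X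
    using nat that by (simp add: natural_transformation_def comp_functor_def id_functor_def)
  have n: "Comp C (\<alpha> Y) (FA G (FA F f)) = Comp C f (\<alpha> X)" if "f \<in> hom C X Y" for f X Y
    using nat homD[OF that]
    by (auto simp: natural_transformation_def comp_functor_def id_functor_def)
  obtain \<beta> where natb: "natural_transformation D D (comp_functor F G) id_functor \<beta>"
    and isosb: "\<forall>X \<in> Obj D. is_iso D (\<beta> X)"
    using FG by (auto simp: naturally_isomorphic_def)
  have \<beta>: "\<beta> X \<in> hom D (FO F (FO G X)) X" if "X \<in> Obj D" for X
    using natb that by (simp add: natural_transformation_def comp_functor_def id_functor_def)
  have "weak_equivalence C D F"
  proof unfold_locales
    show "f = g" if "f \<in> hom C X Y" "g \<in> hom C X Y" "FA F f = FA F g" for f g X Y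
      using faithful_of_natural_iso_id[OF F G GF that] .
    show "\<exists>f \<in> hom C X Y. FA F f = h"
      if X: "X \<in> Obj C" and Y: "Y \<in> Obj C" and h: "h \<in> hom D (FO F X) (FO F Y)" for X Y h
    proof -
      obtain a where a: "a \<in> hom C X (FO G (FO F X))" "Comp C a (\<alpha> X) = Id C (FO G (FO F X))"
        using F.source.isoE[of "\<alpha> X"] isos X \<alpha>[OF X] by metis
      obtain a' where a': "a' \<in> hom C Y (FO G (FO F Y))" "Comp C a' (\<alpha> Y) = Id C (FO G (FO F Y))"
        using F.source.isoE[of "\<alpha> Y"] isos Y \<alpha>[OF Y] by metis
      note Gh = G.map_hom[OF h]
      \<comment> \<open>The only candidate: \<open>FA G h\<close> conjugated by the natural
        isomorphism. Naturality shows that \<open>G\<close> takes the same value on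
        \<open>FA F f\<close> and on \<open>h\<close>, and faithfulness of \<open>G\<close>
        concludes.\<close>
      define f where "f = Comp C (\<alpha> Y) (Comp C (FA G h) a)"
      have f: "f \<in> hom C X Y"
        unfolding f_def using F.source.comp_hom a(1) Gh \<alpha>[OF Y] by blast
      note GFf = G.map_hom[OF F.map_hom[OF f]]
      have "Comp C f (\<alpha> X) = Comp C (\<alpha> Y) (Comp C (Comp C (FA G h) a) (\<alpha> X))"
        unfolding f_def using F.source.assoc[OF \<alpha>[OF X] F.source.comp_hom[OF a(1) Gh] \<alpha>[OF Y]] by simp
      also have "\<dots> = Comp C (\<alpha> Y) (FA G h)"
        using F.source.assoc[OF \<alpha>[OF X] a(1) Gh] a(2) F.source.id_right[OF Gh] by simp
      finally have "Comp C (\<alpha> Y) (FA G (FA F f)) = Comp C (\<alpha> Y) (FA G h)"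
        using n[OF f] by simp
      then have "Comp C (Comp C a' (\<alpha> Y)) (FA G (FA F f)) = Comp C (Comp C a' (\<alpha> Y)) (FA G h)"
        using F.source.assoc[OF GFf \<alpha>[OF Y] a'(1)] F.source.assoc[OF Gh \<alpha>[OF Y] a'(1)] by simp
      then have "FA G (FA F f) = FA G h"
        using a'(2) F.source.id_left[OF GFf] F.source.id_left[OF Gh] by simp
      then have "FA F f = h"
        using faithful_of_natural_iso_id[OF G F FG F.map_hom[OF f] h] by blast
      then show ?thesis using f by blast
    qed
    show "\<exists>X \<in> Obj C. \<exists>i \<in> hom D (FO F X) Y. \<exists>j \<in> hom D Y (FO F X).
        Comp D j i = Id D (FO F X) \<and> Comp D i j = Id D Y" if Y: "Y \<in> Obj D" for Y
    proof -
      obtain b where "b \<in> hom D Y (FO F (FO G Y))" "Comp D b (\<beta> Y) = Id D (FO F (FO G Y))"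
        "Comp D (\<beta> Y) b = Id D Y"
        using F.target.isoE[of "\<beta> Y"] isosb Y \<beta>[OF Y] by metis
      then show ?thesis using G.map_obj[OF Y] \<beta>[OF Y] by blast
    qed
  qed
  then show thesis using that by blast
qed

section \<open>Sheaves\<close>

lemma category_opposite:
  assumes "category C"
  shows "category (opposite C)"
proof -
  interpret category C by fact
  show ?thesis
  proof unfold_locales
    fix f g h W X Y Z
    show "Dom (opposite C) f \<in> Obj (opposite C)" "Cod (opposite C) f \<in> Obj (opposite C)"
      if "f \<in> Arr (opposite C)"
      using that by (simp_all add: dom_obj cod_obj)
    show "Id (opposite C) X \<in> hom (opposite C) X X" if "X \<in> Obj (opposite C)"
      using that by (simp add: id_hom)
    show "Comp (opposite C) g f \<in> hom (opposite C) X Z"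
      if "f \<in> hom (opposite C) X Y" "g \<in> hom (opposite C) Y Z"
      using that comp_hom[of g Z Y f X] by simp
    show "Comp (opposite C) (Id (opposite C) Y) f = f" "Comp (opposite C) f (Id (opposite C) X) = f"
      if "f \<in> hom (opposite C) X Y"
      using that id_right[of f Y X] id_left[of f Y X] by simp_all
    show "Comp (opposite C) h (Comp (opposite C) g f) = Comp (opposite C) (Comp (opposite C) h g) f"
      if "f \<in> hom (opposite C) W X" "g \<in> hom (opposite C) X Y" "h \<in> hom (opposite C) Y Z"
      using assoc[of h Z Y g X f W] that by simp
  qed
qed

section \<open>The category of sets\<close>

lemma Obj_Sets [simp]: "A \<in> Obj (Sets :: ('u set, 'u arrow) category_data) \<longleftrightarrow> A \<prec> (UNIV :: 'u set)"
  by (simp add: Sets_def)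

lemma hom_Sets_iff: "f \<in> hom (Sets :: ('u set, 'u arrow) category_data) A B \<longleftrightarrow>
    A \<prec> (UNIV :: 'u set) \<and> B \<prec> (UNIV :: 'u set) \<and> (\<exists>\<phi> \<in> A \<rightarrow>\<^sub>E B. f = (A, \<phi>, B))"
  by (auto simp: hom_def Sets_def)

lemma hom_SetsI:
  assumes "A \<prec> (UNIV :: 'u set)" "B \<prec> (UNIV :: 'u set)" "\<phi> \<in> A \<rightarrow> B"
  shows "(A, restrict \<phi> A, B) \<in> hom (Sets :: ('u set, 'u arrow) category_data) A B"
  using assms unfolding hom_Sets_iff by auto

lemma app_in: "f \<in> hom Sets A B \<Longrightarrow> x \<in> A \<Longrightarrow> app f x \<in> B"
  by (auto simp: hom_Sets_iff)

lemma arrow_eqI: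
  assumes "f \<in> hom Sets A B" "g \<in> hom Sets A B" "\<And>x. x \<in> A \<Longrightarrow> app f x = app g x"
  shows "f = g"
proof -
  obtain \<phi> \<psi> where "f = (A, \<phi>, B)" "\<phi> \<in> A \<rightarrow>\<^sub>E B" "g = (A, \<psi>, B)" "\<psi> \<in> A \<rightarrow>\<^sub>E B"
    using assms(1,2) unfolding hom_Sets_iff by blast
  then show ?thesis using assms(3) PiE_ext[of \<phi> A "\<lambda>_. B" \<psi>] by simp
qed

lemma app_comp: "f \<in> hom Sets A B \<Longrightarrow> x \<in> A \<Longrightarrow> app (Comp Sets g f) x = app g (app f x)"
  using homD(2)[of f Sets A B] by (simp add: Sets_def compose_def)

lemma app_id: "x \<in> A \<Longrightarrow> app (Id Sets A) x = x"
  by (simp add: Sets_def)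

lemma category_Sets: "category (Sets :: ('u set, 'u arrow) category_data)"
proof -
  have id: "Id Sets X \<in> hom Sets X X" if "X \<prec> (UNIV :: 'u set)" for X :: "'u set"
    using that by (auto simp: hom_def Sets_def)
  have comp: "Comp Sets g f \<in> hom Sets X Z"
    if f: "f \<in> hom Sets X Y" and g: "g \<in> hom Sets Y Z" for f g and X Y Z :: "'u set"
  proof -
    have "fst f = X" "snd (snd g) = Z" "X \<prec> (UNIV :: 'u set)" "Z \<prec> (UNIV :: 'u set)"
      using f g by (auto simp: hom_Sets_iff)
    then show ?thesis
      using hom_SetsI[of X Z "\<lambda>x. app g (app f x)"] app_in[OF g app_in[OF f]]
      by (simp add: Sets_def compose_def)
  qed
  show ?thesis
  proof unfold_locales
    fix f :: "'u arrow" and W X Y Z g h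
    show "Comp Sets (Id Sets Y) f = f" if f: "f \<in> hom Sets X Y"
    proof (rule arrow_eqI)
      show "Comp Sets (Id Sets Y) f \<in> hom Sets X Y"
        using comp[OF f id] f by (simp add: hom_Sets_iff)
    qed (use f app_in[OF f] in \<open>auto simp: app_comp app_id\<close>)
    show "Comp Sets f (Id Sets X) = f" if f: "f \<in> hom Sets X Y"
    proof (rule arrow_eqI)
      have "Id Sets X \<in> hom Sets X X" using id f by (simp add: hom_Sets_iff)
      then show "Comp Sets f (Id Sets X) \<in> hom Sets X Y"
        and "x \<in> X \<Longrightarrow> app (Comp Sets f (Id Sets X)) x = app f x" for x
        using comp f by (auto simp: app_comp app_id)
    qed (use f in auto)
    show "Comp Sets h (Comp Sets g f) = Comp Sets (Comp Sets h g) f"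
      if f: "f \<in> hom Sets W X" and g: "g \<in> hom Sets X Y" and h: "h \<in> hom Sets Y Z"
    proof (rule arrow_eqI)
      show "Comp Sets h (Comp Sets g f) \<in> hom Sets W Z" "Comp Sets (Comp Sets h g) f \<in> hom Sets W Z"
        using comp f g h by blast+
      show "app (Comp Sets h (Comp Sets g f)) x = app (Comp Sets (Comp Sets h g) f) x" if "x \<in> W" for x
        using that app_in[OF f] by (simp add: app_comp[OF f] app_comp[OF g] app_comp[OF comp[OF f g]])
    qed
    show "Dom Sets f \<in> Obj Sets" "Cod Sets f \<in> Obj Sets" if "f \<in> Arr Sets"
      using that by (auto simp: Sets_def)
    show "Comp Sets g f \<in> hom Sets X Z" if "f \<in> hom Sets X Y" "g \<in> hom Sets Y Z"
      using comp[OF that] .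
    show "Id Sets X \<in> hom Sets X X" if "X \<in> Obj Sets"
      using id that by simp
  qed
qed

section \<open>Small sets in an inaccessible universe\<close>

lemma lesspoll_subset: "A \<subseteq> B \<Longrightarrow> B \<prec> C \<Longrightarrow> A \<prec> C"
  by (rule lesspoll_trans1[OF subset_imp_lepoll])

lemma small_image: "A \<prec> C \<Longrightarrow> f ` A \<prec> C"
  by (rule lesspoll_trans1[OF image_lepoll])

lemma exists_inj_on_UNIV:
  assumes "A \<lesssim> (UNIV :: 'b set)"
  shows "\<exists>f :: 'a \<Rightarrow> 'b. inj_on f A"
  using assms unfolding lepoll_def by blast

context
  assumes inaccessible: "inaccessible TYPE('u)"
begin

lemma small_nat: "(UNIV :: nat set) \<prec> (UNIV :: 'u set)"
  using inaccessible by (simp add: inaccessible_def)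

lemma infinite_UNIV: "infinite (UNIV :: 'u set)"
  using small_nat by (simp add: infinite_le_lepoll lesspoll_imp_lepoll)

lemma small_finite: "finite A \<Longrightarrow> A \<prec> (UNIV :: 'u set)"
  using finite_lesspoll_infinite infinite_UNIV by blast

text \<open>In \<open>inaccessible\<close> unions are indexed by subsets of the universe. An index
  set of any other type is first injected into \<open>'u\<close> by \<open>g\<close>, and the family
  is reindexed along the inverse.\<close>

lemma small_Union:
  fixes A :: "'i set" and B :: "'i \<Rightarrow> 'u set"
  assumes A: "A \<prec> (UNIV :: 'u set)" and B: "\<And>a. a \<in> A \<Longrightarrow> B a \<prec> (UNIV :: 'u set)"
  shows "(\<Union>a \<in> A. B a) \<prec> (UNIV :: 'u set)"
proof -
  obtain g :: "'i \<Rightarrow> 'u" where g: "inj_on g A"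
    using exists_inj_on_UNIV[OF lesspoll_imp_lepoll[OF A]] by blast
  have "(\<Union>c \<in> g ` A. B (inv_into A g c)) \<prec> (UNIV :: 'u set)"
  proof -
    have "g ` A \<prec> (UNIV :: 'u set)" using small_image[OF A] .
    moreover have "\<forall>c \<in> g ` A. B (inv_into A g c) \<prec> (UNIV :: 'u set)"
      using B g by (metis imageE inv_into_f_f)
    ultimately show ?thesis
      using inaccessible unfolding inaccessible_def
      by (elim conjE allE[of _ "g ` A"] allE[of _ "\<lambda>c. B (inv_into A g c)"]) simp
  qed
  moreover have "(\<Union>c \<in> g ` A. B (inv_into A g c)) = (\<Union>a \<in> A. B a)" using g by auto
  ultimately show ?thesis by simp
qed

text \<open>A function is determined by its graph, and all graphs lie in the power set of one small
  set \<open>D\<close> of coded pairs. The coding of pairs uses that an infinite set is in bijection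
  with its square, and the strong limit property bounds \<open>Pow D\<close>.\<close>

lemma small_PiE:
  fixes I :: "'i set" and X :: "'i \<Rightarrow> 'u set"
  assumes I: "I \<prec> (UNIV :: 'u set)" and X: "\<And>i. i \<in> I \<Longrightarrow> X i \<prec> (UNIV :: 'u set)"
  shows "(\<Pi>\<^sub>E i \<in> I. X i) \<prec> (UNIV :: 'u set)"
proof -
  obtain g :: "'i \<Rightarrow> 'u" where g: "inj_on g I"
    using exists_inj_on_UNIV[OF lesspoll_imp_lepoll[OF I]] by blast
  have "(UNIV :: ('u \<times> 'u) set) \<approx> (UNIV :: 'u set)"
    unfolding eqpoll_iff_card_of_ordIso using card_of_Times_same_infinite[OF infinite_UNIV] by simp
  then obtain e :: "'u \<times> 'u \<Rightarrow> 'u" where "bij e"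
    unfolding eqpoll_def by blast
  then have e: "inj e" by (simp add: bij_betw_def)
  define D where "D = (\<Union>i \<in> I. (\<lambda>x. e (g i, x)) ` X i)"
  have "D \<prec> (UNIV :: 'u set)"
    unfolding D_def using I X by (intro small_Union small_image)
  then have D: "Pow D \<prec> (UNIV :: 'u set)"
    using inaccessible unfolding inaccessible_def by simp
  have "(\<Pi>\<^sub>E i \<in> I. X i) \<lesssim> Pow D"
    unfolding lepoll_def
  proof (intro exI conjI)
    let ?gr = "\<lambda>t. (\<lambda>i. e (g i, t i)) ` I"
    show "inj_on ?gr (\<Pi>\<^sub>E i \<in> I. X i)"
    proof (rule inj_onI)
      fix s t assume st: "s \<in> (\<Pi>\<^sub>E i \<in> I. X i)" "t \<in> (\<Pi>\<^sub>E i \<in> I. X i)" and eq: "?gr s = ?gr t"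
      have "s i = t i" if i: "i \<in> I" for i
      proof -
        have "e (g i, s i) \<in> ?gr t" using eq i by blast
        then obtain j where j: "j \<in> I" "e (g i, s i) = e (g j, t j)" by blast
        then have "g i = g j" "s i = t j" using injD[OF e j(2)] by simp_all
        then show ?thesis using g i j(1) by (auto dest: inj_onD)
      qed
      then show "s = t" using PiE_ext[OF st] by blast
    qed
    show "?gr ` (\<Pi>\<^sub>E i \<in> I. X i) \<subseteq> Pow D" unfolding D_def by auto
  qed
  then show ?thesis using lesspoll_trans1 D by blast
qed

end

section \<open>Presheaves, coverings and gluing\<close>

definition cmp :: "'u presheaf \<times> ('u \<Rightarrow> 'u arrow) \<times> 'u presheaf \<Rightarrow> 'u \<Rightarrow> 'u \<Rightarrow> 'u" where
  "cmp a W = app (fst (snd a) W)"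

abbreviation res :: "'u presheaf \<Rightarrow> 'u \<Rightarrow> 'u \<Rightarrow> 'u" where
  "res P f \<equiv> app (FA P f)"

locale site = category B for B :: "('u, 'u) category_data" +
  fixes J :: "'u \<Rightarrow> 'u set set"
  assumes topology: "grothendieck_topology B J"
begin

abbreviation comp_B (infixl "\<cdot>" 70) where "g \<cdot> f \<equiv> Comp B g f"

definition mk_presheaf :: "('u \<Rightarrow> 'u set) \<Rightarrow> ('u \<Rightarrow> 'u \<Rightarrow> 'u) \<Rightarrow> 'u presheaf" where
  "mk_presheaf S \<rho> =
    \<lparr>FO = S, FA = (\<lambda>f. (S (Cod B f), restrict (\<rho> f) (S (Cod B f)), S (Dom B f)))\<rparr>"

lemma FO_mk_presheaf [simp]: "FO (mk_presheaf S \<rho>) = S"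
  by (simp add: mk_presheaf_def)

lemma res_mk_presheaf:
  "f \<in> hom B V W \<Longrightarrow> x \<in> S W \<Longrightarrow> res (mk_presheaf S \<rho>) f x = \<rho> f x"
  by (auto simp: mk_presheaf_def hom_def)

lemma functor_mk_presheaf:
  assumes small: "\<And>W. W \<in> Obj B \<Longrightarrow> S W \<prec> (UNIV :: 'u set)"
    and \<rho>_in: "\<And>f V W x. f \<in> hom B V W \<Longrightarrow> x \<in> S W \<Longrightarrow> \<rho> f x \<in> S V"
    and \<rho>_id: "\<And>W x. W \<in> Obj B \<Longrightarrow> x \<in> S W \<Longrightarrow> \<rho> (Id B W) x = x"
    and \<rho>_comp: "\<And>f g U V W x. f \<in> hom B V W \<Longrightarrow> g \<in> hom B U V \<Longrightarrow> x \<in> S W \<Longrightarrow>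
      \<rho> (f \<cdot> g) x = \<rho> g (\<rho> f x)"
  shows "is_functor (opposite B) Sets (mk_presheaf S \<rho>)"
proof -
  interpret op: category "opposite B" using category_opposite category_axioms .
  interpret Sets: category "Sets :: ('u set, 'u arrow) category_data" by (rule category_Sets)
  let ?P = "mk_presheaf S \<rho>"
  have hom: "FA ?P f \<in> hom Sets (S W) (S V)" if f: "f \<in> hom B V W" for f V W
  proof -
    have "(S W, restrict (\<rho> f) (S W), S V) \<in> hom Sets (S W) (S V)"
      using \<rho>_in[OF f] small hom_obj[OF f] by (intro hom_SetsI) auto
    then show ?thesis using homD[OF f] by (simp add: mk_presheaf_def)
  qed
  show ?thesis
  proof unfold_locales
    show "FA ?P (Id (opposite B) X) = Id Sets (FO ?P X)" if "X \<in> Obj (opposite B)" for X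
    proof (rule arrow_eqI)
      have X: "X \<in> Obj B" using that by simp
      show "FA ?P (Id (opposite B) X) \<in> hom Sets (S X) (S X)" using hom[OF id_hom[OF X]] by simp
      show "Id Sets (FO ?P X) \<in> hom Sets (S X) (S X)" using Sets.id_hom[of "S X"] small X by simp
      show "app (FA ?P (Id (opposite B) X)) x = app (Id Sets (FO ?P X)) x" if "x \<in> S X" for x
        using res_mk_presheaf[where ?S=S, OF id_hom[OF X] that] \<rho>_id X that by (simp add: app_id)
    qed
    show "FA ?P (Comp (opposite B) g f) = Comp Sets (FA ?P g) (FA ?P f)"
      if "f \<in> hom (opposite B) X Y" "g \<in> hom (opposite B) Y Z" for f g X Y Z
    proof (rule arrow_eqI)
      have f: "f \<in> hom B Y X" and g: "g \<in> hom B Z Y" using that by auto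
      note gf = comp_hom[OF g f]
      show "FA ?P (Comp (opposite B) g f) \<in> hom Sets (S X) (S Z)" using hom[OF gf] by simp
      show "Comp Sets (FA ?P g) (FA ?P f) \<in> hom Sets (S X) (S Z)"
        using Sets.comp_hom[OF hom[OF f] hom[OF g]] .
      show "app (FA ?P (Comp (opposite B) g f)) x = app (Comp Sets (FA ?P g) (FA ?P f)) x"
        if "x \<in> S X" for x
        using that \<rho>_in[OF f] by (simp add: app_comp[OF hom[OF f]] \<rho>_comp[OF f g]
          res_mk_presheaf[where ?S=S, OF gf] res_mk_presheaf[where ?S=S, OF f] res_mk_presheaf[where ?S=S, OF g])
    qed
  qed (use small hom in auto)
qed

context
  fixes P :: "'u presheaf"
  assumes P: "is_functor (opposite B) Sets P"
begin

interpretation P: is_functor "opposite B" Sets P by (rule P)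

lemma res_hom: "f \<in> hom B V W \<Longrightarrow> FA P f \<in> hom Sets (FO P W) (FO P V)"
  using P.map_hom[of f W V] by simp

lemma res_in: "f \<in> hom B V W \<Longrightarrow> x \<in> FO P W \<Longrightarrow> res P f x \<in> FO P V"
  using app_in[OF res_hom] .

lemma res_id: "W \<in> Obj B \<Longrightarrow> x \<in> FO P W \<Longrightarrow> res P (Id B W) x = x"
  using P.map_id[of W] by (simp add: app_id)

lemma res_comp: "f \<in> hom B V W \<Longrightarrow> g \<in> hom B U V \<Longrightarrow> x \<in> FO P W \<Longrightarrow>
    res P (f \<cdot> g) x = res P g (res P f x)"
  using P.map_comp[of f W V g U] by (simp add: app_comp[OF res_hom])

lemma small_FO: "W \<in> Obj B \<Longrightarrow> FO P W \<prec> (UNIV :: 'u set)"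
  using P.map_obj[of W] by simp

end

lemma sheaf_functor: "is_sheaf B J P \<Longrightarrow> is_functor (opposite B) Sets P"
  by (simp add: is_sheaf_def)

lemma cover_sieve: "U \<in> Obj B \<Longrightarrow> R \<in> J U \<Longrightarrow> is_sieve B U R"
  using topology by (simp add: grothendieck_topology_def)

lemma cover_hom:
  assumes "U \<in> Obj B" "R \<in> J U" "f \<in> R"
  shows "f \<in> hom B (Dom B f) U"
  using cover_sieve[OF assms(1,2)] assms(3) unfolding is_sieve_def hom_def by auto

lemma cover_closed:
  assumes "U \<in> Obj B" "R \<in> J U" "f \<in> R" "g \<in> hom B V (Dom B f)"
  shows "f \<cdot> g \<in> R"
  using cover_sieve[OF assms(1,2)] assms(3) homD[OF assms(4)] unfolding is_sieve_def by simp

lemma cover_pullback: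
  assumes "h \<in> hom B V U" "R \<in> J U"
  shows "sieve_pullback B h R \<in> J V"
  using topology homD[OF assms(1)] assms(2) unfolding grothendieck_topology_def by auto

lemma cover_pullbackD:
  assumes "h \<in> hom B V U" "g \<in> sieve_pullback B h R"
  shows "g \<in> hom B (Dom B g) V" "h \<cdot> g \<in> R"
  using assms by (auto simp: sieve_pullback_def hom_def)

text \<open>Transitivity of the topology is applied to the empty sieve, all of whose pullbacks are
  empty. This is what allows sections of the initial sheaf to be glued.\<close>

lemma empty_cover:
  assumes U: "U \<in> Obj B" "R \<in> J U" and R: "\<And>f. f \<in> R \<Longrightarrow> {} \<in> J (Dom B f)"
  shows "{} \<in> J U"
proof -
  have "is_sieve B U {}" by (simp add: is_sieve_def)
  moreover have "\<forall>f \<in> R. sieve_pullback B f {} \<in> J (Dom B f)"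
    using R by (simp add: sieve_pullback_def)
  moreover have "\<forall>S. is_sieve B U S \<and> (\<forall>f \<in> R. sieve_pullback B f S \<in> J (Dom B f)) \<longrightarrow> S \<in> J U"
    using topology U unfolding grothendieck_topology_def by meson
  ultimately show ?thesis by blast
qed

lemma matching_familyD:
  assumes "matching_family B P R x" "U \<in> Obj B" "R \<in> J U" "f \<in> R"
  shows "x f \<in> FO P (Dom B f)"
    and "g \<in> hom B V (Dom B f) \<Longrightarrow> res P g (x f) = x (f \<cdot> g)"
  using assms unfolding matching_family_def hom_def by auto

lemma matching_familyI:
  assumes "\<And>f. f \<in> R \<Longrightarrow> x f \<in> FO P (Dom B f)"
    and "\<And>f g V. f \<in> R \<Longrightarrow> g \<in> hom B V (Dom B f) \<Longrightarrow> res P g (x f) = x (f \<cdot> g)"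
  shows "matching_family B P R x"
  using assms unfolding matching_family_def hom_def by blast

lemma sheaf_glue:
  assumes "is_sheaf B J P" "U \<in> Obj B" "R \<in> J U" "matching_family B P R x"
  shows "\<exists>t \<in> FO P U. \<forall>f \<in> R. res P f t = x f"
  using assms unfolding is_sheaf_def by blast

lemma sheaf_separated:
  assumes P: "is_sheaf B J P" and U: "U \<in> Obj B" "R \<in> J U" and t: "t \<in> FO P U" "t' \<in> FO P U"
    and eq: "\<And>f. f \<in> R \<Longrightarrow> res P f t = res P f t'"
  shows "t = t'"
proof -
  note F = sheaf_functor[OF P]
  have "matching_family B P R (\<lambda>f. res P f t)"
    using res_in[OF F cover_hom[OF U] t(1)] res_comp[OF F cover_hom[OF U] _ t(1)]
    by (intro matching_familyI) auto
  then have "\<exists>!s. s \<in> FO P U \<and> (\<forall>f \<in> R. res P f s = res P f t)"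
    using P U unfolding is_sheaf_def by blast
  then show ?thesis using t eq by metis
qed

lemma sheafI:
  assumes "is_functor (opposite B) Sets P"
    and glue: "\<And>U R x. U \<in> Obj B \<Longrightarrow> R \<in> J U \<Longrightarrow> matching_family B P R x \<Longrightarrow>
      \<exists>t \<in> FO P U. \<forall>f \<in> R. res P f t = x f"
    and sep: "\<And>U R t t'. U \<in> Obj B \<Longrightarrow> R \<in> J U \<Longrightarrow> t \<in> FO P U \<Longrightarrow> t' \<in> FO P U \<Longrightarrow>
      (\<And>f. f \<in> R \<Longrightarrow> res P f t = res P f t') \<Longrightarrow> t = t'"
  shows "is_sheaf B J P"
  unfolding is_sheaf_def
proof (intro conjI ballI allI impI)
  fix U R x assume a: "U \<in> Obj B" "R \<in> J U" "matching_family B P R x"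
  obtain t where t: "t \<in> FO P U" "\<forall>f \<in> R. res P f t = x f" using glue[OF a] by blast
  show "\<exists>!t. t \<in> FO P U \<and> (\<forall>f \<in> R. res P f t = x f)"
  proof (rule ex1I[of _ t])
    show "t \<in> FO P U \<and> (\<forall>f \<in> R. res P f t = x f)" using t by blast
    show "s = t" if "s \<in> FO P U \<and> (\<forall>f \<in> R. res P f s = x f)" for s
      using sep[OF a(1,2)] that t by simp
  qed
qed (rule assms(1))

section \<open>The category of sheaves\<close>

abbreviation "Sh \<equiv> Sheaves B J"

lemma Obj_Sh [simp]: "P \<in> Obj Sh \<longleftrightarrow> is_sheaf B J P"
  by (simp add: Sheaves_def)

lemma hom_Sh_iff: "a \<in> hom Sh P Q \<longleftrightarrow>
    is_sheaf B J P \<and> is_sheaf B J Q \<and> (\<exists>\<alpha>. a = (P, \<alpha>, Q) \<and> \<alpha> \<in> extensional (Obj B) \<and>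
      (\<forall>W \<in> Obj B. \<alpha> W \<in> hom Sets (FO P W) (FO Q W)) \<and>
      (\<forall>V W. \<forall>f \<in> hom B V W. \<forall>x \<in> FO P W. app (\<alpha> V) (res P f x) = res Q f (app (\<alpha> W) x)))"
  (is "_ \<longleftrightarrow> _ \<and> _ \<and> (\<exists>\<alpha>. _ \<and> _ \<and> ?comp \<alpha> \<and> ?nat \<alpha>)")
proof -
  interpret Sets: category "Sets :: ('u set, 'u arrow) category_data" by (rule category_Sets)
  have "natural_transformation (opposite B) Sets P Q \<alpha> \<longleftrightarrow> ?comp \<alpha> \<and> ?nat \<alpha>"
    if P: "is_sheaf B J P" and Q: "is_sheaf B J Q" for \<alpha>
  proof -
    note F = sheaf_functor[OF P] and G = sheaf_functor[OF Q]
    have "(Comp Sets (\<alpha> V) (FA P f) = Comp Sets (FA Q f) (\<alpha> W)) \<longleftrightarrow>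
        (\<forall>x \<in> FO P W. app (\<alpha> V) (res P f x) = res Q f (app (\<alpha> W) x))"
      if \<alpha>: "?comp \<alpha>" and f: "f \<in> hom B V W" for f V W
    proof
      have \<alpha>V: "\<alpha> V \<in> hom Sets (FO P V) (FO Q V)" and \<alpha>W: "\<alpha> W \<in> hom Sets (FO P W) (FO Q W)"
        using \<alpha> hom_obj[OF f] by auto
      show "\<forall>x \<in> FO P W. app (\<alpha> V) (res P f x) = res Q f (app (\<alpha> W) x)"
        if "Comp Sets (\<alpha> V) (FA P f) = Comp Sets (FA Q f) (\<alpha> W)"
        using that by (metis app_comp[OF res_hom[OF F f]] app_comp[OF \<alpha>W])
      show "Comp Sets (\<alpha> V) (FA P f) = Comp Sets (FA Q f) (\<alpha> W)"
        if "\<forall>x \<in> FO P W. app (\<alpha> V) (res P f x) = res Q f (app (\<alpha> W) x)"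
        using that
        by (intro arrow_eqI[OF Sets.comp_hom[OF res_hom[OF F f] \<alpha>V] Sets.comp_hom[OF \<alpha>W res_hom[OF G f]]])
          (simp add: app_comp[OF res_hom[OF F f]] app_comp[OF \<alpha>W])
    qed
    then have "(\<forall>f \<in> Arr B. Comp Sets (\<alpha> (Dom B f)) (FA P f) = Comp Sets (FA Q f) (\<alpha> (Cod B f))) \<longleftrightarrow> ?nat \<alpha>"
      if "?comp \<alpha>" using that Arr_hom[of _ B] homD[of _ B] by (smt (verit, best))
    then show ?thesis
      unfolding natural_transformation_def using F G by auto
  qed
  then show ?thesis by (auto simp: hom_def Sheaves_def)
qed

lemma hom_ShD:
  assumes "a \<in> hom Sh P Q"
  shows sheaf_dom: "is_sheaf B J P" and sheaf_cod: "is_sheaf B J Q"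
    and cmp_in: "W \<in> Obj B \<Longrightarrow> x \<in> FO P W \<Longrightarrow> cmp a W x \<in> FO Q W"
    and cmp_res: "f \<in> hom B V W \<Longrightarrow> x \<in> FO P W \<Longrightarrow> cmp a V (res P f x) = res Q f (cmp a W x)"
proof -
  obtain \<alpha> where a: "a = (P, \<alpha>, Q)"
    and \<alpha>: "W \<in> Obj B \<Longrightarrow> \<alpha> W \<in> hom Sets (FO P W) (FO Q W)"
      "f \<in> hom B V W \<Longrightarrow> x \<in> FO P W \<Longrightarrow> app (\<alpha> V) (res P f x) = res Q f (app (\<alpha> W) x)"
    for V W f x
    using assms unfolding hom_Sh_iff by blast
  show "is_sheaf B J P" "is_sheaf B J Q" using assms unfolding hom_Sh_iff by auto
  show "W \<in> Obj B \<Longrightarrow> x \<in> FO P W \<Longrightarrow> cmp a W x \<in> FO Q W"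
    using app_in[OF \<alpha>(1)] by (simp add: cmp_def a)
  show "f \<in> hom B V W \<Longrightarrow> x \<in> FO P W \<Longrightarrow> cmp a V (res P f x) = res Q f (cmp a W x)"
    using \<alpha>(2) by (simp add: cmp_def a)
qed

lemma Sh_arrow_eqI:
  assumes "a \<in> hom Sh P Q" "b \<in> hom Sh P Q"
    and "\<And>W x. W \<in> Obj B \<Longrightarrow> x \<in> FO P W \<Longrightarrow> cmp a W x = cmp b W x"
  shows "a = b"
proof -
  obtain \<alpha> \<beta> where ab: "a = (P, \<alpha>, Q)" "b = (P, \<beta>, Q)"
    and e: "\<alpha> \<in> extensional (Obj B)" "\<beta> \<in> extensional (Obj B)"
    and h: "\<forall>W \<in> Obj B. \<alpha> W \<in> hom Sets (FO P W) (FO Q W)"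
      "\<forall>W \<in> Obj B. \<beta> W \<in> hom Sets (FO P W) (FO Q W)"
    using assms(1,2) unfolding hom_Sh_iff by blast
  have "\<alpha> W = \<beta> W" if "W \<in> Obj B" for W
    using arrow_eqI[of "\<alpha> W" "FO P W" "FO Q W" "\<beta> W"] assms(3)[OF that] h that by (simp add: ab cmp_def)
  then have "\<alpha> = \<beta>" using extensionalityI[OF e] by blast
  then show ?thesis using ab by simp
qed

definition mk_arrow :: "'u presheaf \<Rightarrow> 'u presheaf \<Rightarrow> ('u \<Rightarrow> 'u \<Rightarrow> 'u) \<Rightarrow>
    'u presheaf \<times> ('u \<Rightarrow> 'u arrow) \<times> 'u presheaf" where
  "mk_arrow P Q t = (P, \<lambda>W \<in> Obj B. (FO P W, restrict (t W) (FO P W), FO Q W), Q)"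

lemma cmp_mk_arrow: "W \<in> Obj B \<Longrightarrow> x \<in> FO P W \<Longrightarrow> cmp (mk_arrow P Q t) W x = t W x"
  by (simp add: cmp_def mk_arrow_def)

lemma mk_arrow_hom:
  assumes P: "is_sheaf B J P" and Q: "is_sheaf B J Q"
    and t_in: "\<And>W x. W \<in> Obj B \<Longrightarrow> x \<in> FO P W \<Longrightarrow> t W x \<in> FO Q W"
    and t_res: "\<And>f V W x. f \<in> hom B V W \<Longrightarrow> x \<in> FO P W \<Longrightarrow> t V (res P f x) = res Q f (t W x)"
  shows "mk_arrow P Q t \<in> hom Sh P Q"
proof -
  let ?\<alpha> = "\<lambda>W \<in> Obj B. (FO P W, restrict (t W) (FO P W), FO Q W)"
  have "?\<alpha> W \<in> hom Sets (FO P W) (FO Q W)" if "W \<in> Obj B" for W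
    using hom_SetsI[of "FO P W" "FO Q W" "t W"] that t_in small_FO sheaf_functor P Q by auto
  moreover have "app (?\<alpha> V) (res P f x) = res Q f (app (?\<alpha> W) x)"
    if "f \<in> hom B V W" "x \<in> FO P W" for f V W x
    using that t_res[OF that] hom_obj[OF that(1)] res_in[OF sheaf_functor[OF P] that] by simp
  ultimately show ?thesis unfolding hom_Sh_iff mk_arrow_def using P Q by auto
qed

lemma Comp_Sh_hom:
  assumes a: "a \<in> hom Sh P Q" and b: "b \<in> hom Sh Q R"
  shows "Comp Sh b a \<in> hom Sh P R"
    and cmp_Comp: "W \<in> Obj B \<Longrightarrow> x \<in> FO P W \<Longrightarrow> cmp (Comp Sh b a) W x = cmp b W (cmp a W x)"
proof -
  interpret Sets: category "Sets :: ('u set, 'u arrow) category_data" by (rule category_Sets)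
  obtain \<alpha> \<beta> where ab: "a = (P, \<alpha>, Q)" "b = (Q, \<beta>, R)"
    and \<alpha>: "\<forall>W \<in> Obj B. \<alpha> W \<in> hom Sets (FO P W) (FO Q W)"
    and \<beta>: "\<forall>W \<in> Obj B. \<beta> W \<in> hom Sets (FO Q W) (FO R W)"
    using a b unfolding hom_Sh_iff by blast
  let ?\<gamma> = "\<lambda>W \<in> Obj B. Comp Sets (\<beta> W) (\<alpha> W)"
  have c: "Comp Sh b a = (P, ?\<gamma>, R)" by (simp add: Sheaves_def ab)
  show cmp: "cmp (Comp Sh b a) W x = cmp b W (cmp a W x)" if "W \<in> Obj B" "x \<in> FO P W" for W x
    using that \<alpha> app_comp[of "\<alpha> W" "FO P W" "FO Q W" x] by (simp add: cmp_def c) (simp add: ab)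
  have "?\<gamma> W \<in> hom Sets (FO P W) (FO R W)" if "W \<in> Obj B" for W
    using Sets.comp_hom[OF \<alpha>[rule_format, OF that] \<beta>[rule_format, OF that]] that by simp
  moreover have "app (?\<gamma> V) (res P f x) = res R f (app (?\<gamma> W) x)"
    if f: "f \<in> hom B V W" and x: "x \<in> FO P W" for f V W x
  proof -
    note VW = hom_obj[OF f]
    have "app (?\<gamma> V) (res P f x) = cmp b V (cmp a V (res P f x))"
      using cmp[OF VW(1) res_in[OF sheaf_functor[OF sheaf_dom[OF a]] f x]] unfolding c cmp_def by simp
    also have "\<dots> = res R f (cmp b W (cmp a W x))"
      using cmp_res[OF a f x] cmp_res[OF b f cmp_in[OF a VW(2) x]] by simp
    also have "\<dots> = res R f (app (?\<gamma> W) x)"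
      using cmp[OF VW(2) x] unfolding c cmp_def by simp
    finally show ?thesis .
  qed
  ultimately show "Comp Sh b a \<in> hom Sh P R"
    unfolding c hom_Sh_iff using sheaf_dom[OF a] sheaf_cod[OF b] by auto
qed

lemma Id_Sh: "Id Sh P = mk_arrow P P (\<lambda>W x. x)"
  by (simp add: Sheaves_def mk_arrow_def Sets_def)

sublocale Sh: category Sh
proof unfold_locales
  have id: "Id Sh P \<in> hom Sh P P" if "is_sheaf B J P" for P
    unfolding Id_Sh using that by (intro mk_arrow_hom) auto
  show "Id Sh X \<in> hom Sh X X" if "X \<in> Obj Sh" for X using id that by simp
  show "Dom Sh f \<in> Obj Sh" "Cod Sh f \<in> Obj Sh" if "f \<in> Arr Sh" for f
    using that by (auto simp: Sheaves_def)
  fix f g h W X Y Z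
  show "Comp Sh g f \<in> hom Sh X Z" if "f \<in> hom Sh X Y" "g \<in> hom Sh Y Z"
    using Comp_Sh_hom(1)[OF that] .
  show "Comp Sh (Id Sh Y) f = f" if f: "f \<in> hom Sh X Y"
  proof -
    note i = id[OF sheaf_cod[OF f]]
    show ?thesis
      by (rule Sh_arrow_eqI[OF Comp_Sh_hom(1)[OF f i] f])
        (simp add: cmp_Comp[OF f i], simp add: Id_Sh cmp_mk_arrow cmp_in[OF f])
  qed
  show "Comp Sh f (Id Sh X) = f" if f: "f \<in> hom Sh X Y"
  proof -
    note i = id[OF sheaf_dom[OF f]]
    show ?thesis
      by (rule Sh_arrow_eqI[OF Comp_Sh_hom(1)[OF i f] f])
        (simp add: cmp_Comp[OF i f], simp add: Id_Sh cmp_mk_arrow)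
  qed
  show "Comp Sh h (Comp Sh g f) = Comp Sh (Comp Sh h g) f"
    if f: "f \<in> hom Sh W X" and g: "g \<in> hom Sh X Y" and h: "h \<in> hom Sh Y Z"
  proof (rule Sh_arrow_eqI)
    note gf = Comp_Sh_hom(1)[OF f g] and hg = Comp_Sh_hom(1)[OF g h]
    show "Comp Sh h (Comp Sh g f) \<in> hom Sh W Z" "Comp Sh (Comp Sh h g) f \<in> hom Sh W Z"
      using Comp_Sh_hom(1)[OF gf h] Comp_Sh_hom(1)[OF f hg] .
    show "cmp (Comp Sh h (Comp Sh g f)) V x = cmp (Comp Sh (Comp Sh h g) f) V x"
      if "V \<in> Obj B" "x \<in> FO W V" for V x
      using cmp_Comp[OF gf h that] cmp_Comp[OF f g that] cmp_Comp[OF f hg that]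
        cmp_Comp[OF g h that(1) cmp_in[OF f that]] by simp
  qed
qed

section \<open>Limits, effective unions and the strict initial object in sheaves\<close>

text \<open>Limits of sheaves are computed pointwise: sections over \<open>W\<close> are compatible
  families of sections, and gluing and separation are inherited componentwise. The last clause, that
  every compatible family of sections comes from a section of \<open>L\<close>, is recorded besides
  the universal property because it makes it possible to pass from test arrows to individual
  sections.\<close>

lemma Sh_graph_limit:
  fixes I :: "'i set"
  assumes inacc: "inaccessible TYPE('u)" and I: "I \<prec> (UNIV :: 'u set)" and gr: "is_graph Sh I X R"
  shows "\<exists>L leg. is_graph_limit Sh I X R L leg \<and>
    (\<forall>W \<in> Obj B. \<forall>t. (\<forall>i \<in> I. t i \<in> FO (X i) W) \<and> (\<forall>(i, f, j) \<in> R. cmp f W (t i) = t j) \<longrightarrow>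
      (\<exists>e \<in> FO L W. \<forall>i \<in> I. cmp (leg i) W e = t i))"
proof -
  have X: "is_sheaf B J (X i)" if "i \<in> I" for i
    using gr that by (auto simp: is_graph_def)
  have R: "i \<in> I" "j \<in> I" "f \<in> hom Sh (X i) (X j)" if "(i, f, j) \<in> R" for i f j
    using gr that by (auto simp: is_graph_def)
  note F = sheaf_functor[OF X]
  define S where "S W = {t \<in> (\<Pi>\<^sub>E i \<in> I. FO (X i) W). \<forall>(i, f, j) \<in> R. cmp f W (t i) = t j}" for W
  have S_in: "t i \<in> FO (X i) W" if "t \<in> S W" "i \<in> I" for t W i
    using that by (simp add: S_def PiE_iff)
  have S_R: "cmp f W (t i) = t j" if "t \<in> S W" "(i, f, j) \<in> R" for t W i f j
    using that unfolding S_def by auto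
  have S_eq: "s = t" if "s \<in> S W" "t \<in> S W" "\<And>i. i \<in> I \<Longrightarrow> s i = t i" for s t W
    using that PiE_ext[of s I _ t] unfolding S_def by blast
  have SI: "restrict t I \<in> S W"
    if "\<And>i. i \<in> I \<Longrightarrow> t i \<in> FO (X i) W" "\<And>i f j. (i, f, j) \<in> R \<Longrightarrow> cmp f W (t i) = t j" for t W
    using that R(1,2) unfolding S_def by (auto simp: restrict_PiE_iff)
  have S_small: "S W \<prec> (UNIV :: 'u set)" if "W \<in> Obj B" for W
  proof -
    have "(\<Pi>\<^sub>E i \<in> I. FO (X i) W) \<prec> (UNIV :: 'u set)"
      using small_FO[OF F that] by (intro small_PiE[OF inacc I])
    then show ?thesis by (rule lesspoll_subset[rotated]) (auto simp: S_def)
  qed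
  \<comment> \<open>A presheaf takes values in subsets of \<open>'u\<close>, whereas a family of
    sections is a function. Each small set \<open>S W\<close> is therefore copied into the universe
    by a chosen injection, and \<open>dec\<close> reads the family back.\<close>
  define enc where "enc W = (SOME e :: ('i \<Rightarrow> 'u) \<Rightarrow> 'u. inj_on e (S W))" for W
  have inj: "inj_on (enc W) (S W)" if "W \<in> Obj B" for W
    unfolding enc_def using exists_inj_on_UNIV[OF lesspoll_imp_lepoll[OF S_small[OF that]]]
    by (rule someI_ex)
  define dec where "dec W = inv_into (S W) (enc W)" for W
  define S' where "S' W = enc W ` S W" for W
  have enc_in: "enc W t \<in> S' W" if "t \<in> S W" for t W
    using that by (simp add: S'_def)
  have dec_in: "dec W e \<in> S W" if "e \<in> S' W" for e W
    using that by (simp add: S'_def dec_def inv_into_into)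
  have enc_dec: "enc W (dec W e) = e" if "e \<in> S' W" for e W
    using that by (simp add: S'_def dec_def f_inv_into_f)
  have dec_enc: "dec W (enc W t) = t" if "W \<in> Obj B" "t \<in> S W" for t W
    using that inj by (simp add: dec_def)
  have eqI: "e = e'" if "e \<in> S' W" "e' \<in> S' W" "\<And>i. i \<in> I \<Longrightarrow> dec W e i = dec W e' i" for e e' W
    using S_eq[OF dec_in[OF that(1)] dec_in[OF that(2)] that(3)] enc_dec that(1,2) by metis
  define \<rho> where "\<rho> f e = enc (Dom B f) (\<lambda>i \<in> I. res (X i) f (dec (Cod B f) e i))" for f e
  have rs: "(\<lambda>i \<in> I. res (X i) f (dec W e i)) \<in> S V" if f: "f \<in> hom B V W" and e: "e \<in> S' W" for f V W e
  proof (rule SI)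
    note t = dec_in[OF e]
    show "res (X i) f (dec W e i) \<in> FO (X i) V" if "i \<in> I" for i
      using res_in[OF F[OF that] f S_in[OF t that]] .
    show "cmp a V (res (X i) f (dec W e i)) = res (X j) f (dec W e j)" if a: "(i, a, j) \<in> R" for i a j
      using cmp_res[OF R(3)[OF a] f S_in[OF t R(1)[OF a]]] S_R[OF t a] by simp
  qed
  have \<rho>_in: "\<rho> f e \<in> S' V" if f: "f \<in> hom B V W" and e: "e \<in> S' W" for f V W e
    using enc_in[OF rs[OF f e]] homD[OF f] by (simp add: \<rho>_def)
  have dec_\<rho>: "dec V (\<rho> f e) i = res (X i) f (dec W e i)"
    if f: "f \<in> hom B V W" and e: "e \<in> S' W" and i: "i \<in> I" for f V W e i
    using dec_enc[OF hom_obj(1)[OF f] rs[OF f e]] homD[OF f] i by (simp add: \<rho>_def)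
  define L where "L = mk_presheaf S' \<rho>"
  have FO_L [simp]: "FO L = S'" by (simp add: L_def)
  have L_functor: "is_functor (opposite B) Sets L"
    unfolding L_def
  proof (rule functor_mk_presheaf)
    show "S' W \<prec> (UNIV :: 'u set)" if "W \<in> Obj B" for W
      unfolding S'_def using small_image[OF S_small[OF that]] .
    show "\<rho> f e \<in> S' V" if "f \<in> hom B V W" "e \<in> S' W" for f V W e
      using \<rho>_in[OF that] .
    show "\<rho> (Id B W) e = e" if W: "W \<in> Obj B" and e: "e \<in> S' W" for W e
      by (rule eqI[OF \<rho>_in[OF id_hom[OF W] e] e])
        (simp add: dec_\<rho>[OF id_hom[OF W] e] res_id[OF F W S_in[OF dec_in[OF e]]])
    show "\<rho> (f \<cdot> g) e = \<rho> g (\<rho> f e)"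
      if f: "f \<in> hom B V W" and g: "g \<in> hom B U V" and e: "e \<in> S' W" for f g U V W e
      by (rule eqI[OF \<rho>_in[OF comp_hom[OF g f] e] \<rho>_in[OF g \<rho>_in[OF f e]]])
        (simp add: dec_\<rho>[OF comp_hom[OF g f] e] dec_\<rho>[OF g \<rho>_in[OF f e]] dec_\<rho>[OF f e]
          res_comp[OF F f g S_in[OF dec_in[OF e]]])
  qed
  have dec_res: "dec V (res L f e) i = res (X i) f (dec W e i)"
    if "f \<in> hom B V W" "e \<in> S' W" "i \<in> I" for f V W e i
    using dec_\<rho>[OF that] res_mk_presheaf[OF that(1), of e S' \<rho>] that(2) by (simp add: L_def)
  have L: "is_sheaf B J L"
  proof (rule sheafI[OF L_functor])
    fix U C x assume U: "U \<in> Obj B" "C \<in> J U" and x: "matching_family B L C x"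
    have x_in: "x f \<in> S' (Dom B f)" if "f \<in> C" for f
      using matching_familyD(1)[OF x U that] by simp
    have "\<exists>s. s \<in> FO (X i) U \<and> (\<forall>f \<in> C. res (X i) f s = dec (Dom B f) (x f) i)" if i: "i \<in> I" for i
    proof -
      have "matching_family B (X i) C (\<lambda>f. dec (Dom B f) (x f) i)"
      proof (rule matching_familyI)
        fix f g V assume f: "f \<in> C" and g: "g \<in> hom B V (Dom B f)"
        have "Dom B (f \<cdot> g) = V" using homD(2)[OF comp_hom[OF g cover_hom[OF U f]]] .
        then show "res (X i) g (dec (Dom B f) (x f) i) = dec (Dom B (f \<cdot> g)) (x (f \<cdot> g)) i"
          using dec_res[OF g x_in[OF f] i] matching_familyD(2)[OF x U f g] by simp
      next
        show "dec (Dom B f) (x f) i \<in> FO (X i) (Dom B f)" if "f \<in> C" for f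
          using S_in[OF dec_in[OF x_in[OF that]] i] .
      qed
      from sheaf_glue[OF X[OF i] U this] show ?thesis by blast
    qed
    then have "\<forall>i \<in> I. \<exists>s. s \<in> FO (X i) U \<and> (\<forall>f \<in> C. res (X i) f s = dec (Dom B f) (x f) i)"
      by (rule ballI)
    from bchoice[OF this] obtain s where s: "\<And>i. i \<in> I \<Longrightarrow> s i \<in> FO (X i) U"
      and res_s: "\<And>i f. i \<in> I \<Longrightarrow> f \<in> C \<Longrightarrow> res (X i) f (s i) = dec (Dom B f) (x f) i"
      by auto
    \<comment> \<open>The edges of the graph are respected by the glued family because they are
      respected after restriction to the cover, and a sheaf is separated.\<close>
    have s_in: "restrict s I \<in> S U"
    proof (rule SI[OF s])
      fix i a j assume a: "(i, a, j) \<in> R"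
      note r = R[OF a]
      show "cmp a U (s i) = s j"
      proof (rule sheaf_separated[OF X[OF r(2)] U cmp_in[OF r(3) U(1) s[OF r(1)]] s[OF r(2)]])
        fix f assume f: "f \<in> C"
        show "res (X j) f (cmp a U (s i)) = res (X j) f (s j)"
          using cmp_res[OF r(3) cover_hom[OF U f] s[OF r(1)]] res_s[OF r(1) f] res_s[OF r(2) f]
            S_R[OF dec_in[OF x_in[OF f]] a] by simp
      qed
    qed auto
    let ?e = "enc U (restrict s I)"
    note e = enc_in[OF s_in]
    have "res L f ?e = x f" if f: "f \<in> C" for f
    proof (rule eqI[OF _ x_in[OF f]])
      note fh = cover_hom[OF U f]
      show "res L f ?e \<in> S' (Dom B f)" using res_in[OF L_functor fh] e by simp
      show "dec (Dom B f) (res L f ?e) i = dec (Dom B f) (x f) i" if "i \<in> I" for i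
        using dec_res[OF fh e that] dec_enc[OF U(1) s_in] res_s[OF that f] that by simp
    qed
    then show "\<exists>t \<in> FO L U. \<forall>f \<in> C. res L f t = x f" using e by auto
  next
    fix U C e e' assume U: "U \<in> Obj B" "C \<in> J U" and "e \<in> FO L U" "e' \<in> FO L U"
      and eq: "\<And>f. f \<in> C \<Longrightarrow> res L f e = res L f e'"
    then have e: "e \<in> S' U" and e': "e' \<in> S' U" by auto
    show "e = e'"
    proof (rule eqI[OF e e'])
      fix i assume i: "i \<in> I"
      show "dec U e i = dec U e' i"
      proof (rule sheaf_separated[OF X[OF i] U S_in[OF dec_in[OF e] i] S_in[OF dec_in[OF e'] i]])
        fix f assume f: "f \<in> C"
        show "res (X i) f (dec U e i) = res (X i) f (dec U e' i)"
          using dec_res[OF cover_hom[OF U f] e i] dec_res[OF cover_hom[OF U f] e' i] eq[OF f] by simp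
      qed
    qed
  qed
  define leg where "leg i = mk_arrow L (X i) (\<lambda>W e. dec W e i)" for i
  have leg: "leg i \<in> hom Sh L (X i)" if "i \<in> I" for i
    unfolding leg_def by (rule mk_arrow_hom[OF L X[OF that]])
      (use S_in[OF dec_in _] dec_res that in auto)
  have cmp_leg: "cmp (leg i) W e = dec W e i" if "W \<in> Obj B" "e \<in> S' W" for i W e
    unfolding leg_def using cmp_mk_arrow[OF that(1)] that(2) by simp
  have "is_graph_limit Sh I X R L leg"
    unfolding is_graph_limit_def
  proof (intro conjI allI impI)
    have "Comp Sh a (leg i) = leg j" if a: "(i, a, j) \<in> R" for i a j
    proof (rule Sh_arrow_eqI[OF Comp_Sh_hom(1)[OF leg R(3)[OF a]] leg])
      fix W e assume W: "W \<in> Obj B" and e: "e \<in> FO L W"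
      show "cmp (Comp Sh a (leg i)) W e = cmp (leg j) W e"
        using cmp_Comp[OF leg[OF R(1)[OF a]] R(3)[OF a] W e] cmp_leg[OF W] e S_R[OF dec_in a] by simp
    qed (use R[OF a] in auto)
    then show "is_graph_cone Sh I X R L leg"
      unfolding is_graph_cone_def using L leg by auto
  next
    fix T \<mu> assume "is_graph_cone Sh I X R T \<mu>"
    then have T: "is_sheaf B J T" and \<mu>: "\<And>i. i \<in> I \<Longrightarrow> \<mu> i \<in> hom Sh T (X i)"
      and \<mu>R: "\<And>i f j. (i, f, j) \<in> R \<Longrightarrow> Comp Sh f (\<mu> i) = \<mu> j"
      by (auto simp: is_graph_cone_def)
    let ?t = "\<lambda>W y. \<lambda>i \<in> I. cmp (\<mu> i) W y"
    have t: "?t W y \<in> S W" if W: "W \<in> Obj B" and y: "y \<in> FO T W" for W y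
    proof (rule SI)
      show "cmp (\<mu> i) W y \<in> FO (X i) W" if "i \<in> I" for i using cmp_in[OF \<mu>[OF that] W y] .
      show "cmp a W (cmp (\<mu> i) W y) = cmp (\<mu> j) W y" if a: "(i, a, j) \<in> R" for i a j
        using cmp_Comp[OF \<mu>[OF R(1)[OF a]] R(3)[OF a] W y] \<mu>R[OF a] by simp
    qed
    define h where "h = mk_arrow T L (\<lambda>W y. enc W (?t W y))"
    have dec_t: "dec W (enc W (?t W y)) i = cmp (\<mu> i) W y"
      if "W \<in> Obj B" "y \<in> FO T W" "i \<in> I" for W y i
      using dec_enc[OF that(1) t[OF that(1,2)]] that(3) by simp
    have h: "h \<in> hom Sh T L"
      unfolding h_def
    proof (rule mk_arrow_hom[OF T L])
      show "enc W (?t W y) \<in> FO L W" if "W \<in> Obj B" "y \<in> FO T W" for W y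
        using enc_in[OF t[OF that]] by simp
      fix f V W y assume f: "f \<in> hom B V W" and y: "y \<in> FO T W"
      note V = hom_obj(1)[OF f] and W = hom_obj(2)[OF f]
      note y' = res_in[OF sheaf_functor[OF T] f y]
      show "enc V (?t V (res T f y)) = res L f (enc W (?t W y))"
      proof (rule eqI)
        show "enc V (?t V (res T f y)) \<in> S' V" using enc_in[OF t[OF V y']] .
        show "res L f (enc W (?t W y)) \<in> S' V"
          using res_in[OF L_functor f, of "enc W (?t W y)"] enc_in[OF t[OF W y]] by simp
        show "dec V (enc V (?t V (res T f y))) i = dec V (res L f (enc W (?t W y))) i" if i: "i \<in> I" for i
          using dec_t[OF V y' i] dec_res[OF f enc_in[OF t[OF W y]] i] dec_t[OF W y i]
            cmp_res[OF \<mu>[OF i] f y] by simp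
      qed
    qed
    have cmp_h: "cmp h W y = enc W (?t W y)" if "W \<in> Obj B" "y \<in> FO T W" for W y
      unfolding h_def using cmp_mk_arrow[OF that] .
    show "\<exists>!h. h \<in> hom Sh T L \<and> (\<forall>i \<in> I. Comp Sh (leg i) h = \<mu> i)"
    proof (rule ex1I[of _ h])
      have "Comp Sh (leg i) h = \<mu> i" if i: "i \<in> I" for i
      proof (rule Sh_arrow_eqI[OF Comp_Sh_hom(1)[OF h leg[OF i]] \<mu>[OF i]])
        fix W y assume W: "W \<in> Obj B" and y: "y \<in> FO T W"
        show "cmp (Comp Sh (leg i) h) W y = cmp (\<mu> i) W y"
          using cmp_Comp[OF h leg[OF i] W y] cmp_h[OF W y] cmp_leg[OF W enc_in[OF t[OF W y]]]
            dec_t[OF W y i] by simp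
      qed
      then show "h \<in> hom Sh T L \<and> (\<forall>i \<in> I. Comp Sh (leg i) h = \<mu> i)" using h by blast
    next
      fix g assume g: "g \<in> hom Sh T L \<and> (\<forall>i \<in> I. Comp Sh (leg i) g = \<mu> i)"
      then have gh: "g \<in> hom Sh T L" by blast
      show "g = h"
      proof (rule Sh_arrow_eqI[OF gh h])
        fix W y assume W: "W \<in> Obj B" and y: "y \<in> FO T W"
        have gy: "cmp g W y \<in> S' W" using cmp_in[OF gh W y] by simp
        show "cmp g W y = cmp h W y"
        proof (rule eqI[OF gy])
          show "cmp h W y \<in> S' W" using cmp_in[OF h W y] by simp
          fix i assume i: "i \<in> I"
          have "dec W (cmp g W y) i = cmp (\<mu> i) W y"
            using cmp_Comp[OF gh leg[OF i] W y] cmp_leg[OF W gy] g i by simp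
          then show "dec W (cmp g W y) i = dec W (cmp h W y) i"
            using cmp_h[OF W y] dec_t[OF W y i] by simp
        qed
      qed
    qed
  qed
  moreover have "\<exists>e \<in> FO L W. \<forall>i \<in> I. cmp (leg i) W e = t i"
    if W: "W \<in> Obj B" and t: "\<And>i. i \<in> I \<Longrightarrow> t i \<in> FO (X i) W"
      "\<And>i f j. (i, f, j) \<in> R \<Longrightarrow> cmp f W (t i) = t j" for W t
  proof -
    have "restrict t I \<in> S W" using SI t by blast
    then have "enc W (restrict t I) \<in> FO L W" "\<forall>i \<in> I. cmp (leg i) W (enc W (restrict t I)) = t i"
      using enc_in cmp_leg[OF W] dec_enc[OF W] by auto
    then show ?thesis by blast
  qed
  ultimately show ?thesis by fast
qed

text \<open>Compatibility is stated for arrows from test sheaves, but here two single sections are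
  compared. The pullback of \<open>m\<close> and \<open>m'\<close> serves as test sheaf: the pair of
  \<open>y\<close> and \<open>y'\<close> is one of its sections.\<close>

lemma Sh_compatible_pointwise:
  assumes inacc: "inaccessible TYPE('u)" and \<Phi>: "compatible_family Sh X Z \<Phi>"
    and mu: "(m, u) \<in> \<Phi>" "(m', u') \<in> \<Phi>"
    and W: "W \<in> Obj B" and y: "y \<in> FO (Dom Sh m) W" "y' \<in> FO (Dom Sh m') W"
    and eq: "cmp m W y = cmp m' W y'"
  shows "cmp u W y = cmp u' W y'"
proof -
  have m: "m \<in> hom Sh (Dom Sh m) X" "u \<in> hom Sh (Dom Sh m) Z"
    "m' \<in> hom Sh (Dom Sh m') X" "u' \<in> hom Sh (Dom Sh m') Z"
    using compatible_familyD(1,2)[OF \<Phi> mu(1)] compatible_familyD(1,2)[OF \<Phi> mu(2)] by auto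
  define Y where "Y = (\<lambda>i :: nat. if i = 0 then Dom Sh m else if i = 1 then Dom Sh m' else X)"
  define R where "R = {(0 :: nat, m, 2 :: nat), (1, m', 2)}"
  have gr: "is_graph Sh {0, 1, 2} Y R"
    unfolding is_graph_def using m sheaf_dom[OF m(1)] sheaf_dom[OF m(3)] sheaf_cod[OF m(1)]
    by (simp add: Y_def R_def)
  have small: "{0, 1, 2 :: nat} \<prec> (UNIV :: 'u set)" by (rule small_finite[OF inacc]) simp
  obtain L leg where L: "is_graph_limit Sh {0, 1, 2} Y R L leg"
    and el: "\<forall>W \<in> Obj B. \<forall>t. (\<forall>i \<in> {0, 1, 2}. t i \<in> FO (Y i) W) \<and>
      (\<forall>(i, f, j) \<in> R. cmp f W (t i) = t j) \<longrightarrow>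
      (\<exists>e \<in> FO L W. \<forall>i \<in> {0, 1, 2}. cmp (leg i) W e = t i)"
    using Sh_graph_limit[OF inacc small gr] by blast
  have leg: "leg 0 \<in> hom Sh L (Dom Sh m)" "leg 1 \<in> hom Sh L (Dom Sh m')"
    and sq: "Comp Sh m (leg 0) = Comp Sh m' (leg 1)"
    using L unfolding is_graph_limit_def is_graph_cone_def Y_def R_def by auto
  have ueq: "Comp Sh u (leg 0) = Comp Sh u' (leg 1)"
    using compatible_familyD(3)[OF \<Phi> mu leg sq] .
  let ?t = "\<lambda>i :: nat. if i = 0 then y else if i = 1 then y' else cmp m W y"
  have "\<exists>e \<in> FO L W. \<forall>i \<in> {0, 1, 2}. cmp (leg i) W e = ?t i"
    by (rule el[rule_format, OF W]) (use y eq cmp_in[OF m(1) W y(1)] in \<open>simp add: Y_def R_def\<close>)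
  then obtain e where e: "e \<in> FO L W" "cmp (leg 0) W e = y" "cmp (leg 1) W e = y'"
    by auto
  show ?thesis
    using cmp_Comp[OF leg(1) m(2) W e(1)] cmp_Comp[OF leg(2) m(4) W e(1)] e(2,3) ueq by simp
qed

text \<open>Instead of sheafifying the union of the images, \<open>K\<close> consists of the
  sections at which, stably under restriction, the value allowed by \<Phi> is unique. Unique
  existence is a local condition, so \<open>K\<close> is closed under gluing; by compatibility it
  contains every image.\<close>

lemma Sh_effective_unions:
  assumes inacc: "inaccessible TYPE('u)"
  shows "has_effective_unions Sh"
  unfolding has_effective_unions_def
proof (intro ballI allI impI)
  fix X Z \<Phi> assume "X \<in> Obj Sh" "Z \<in> Obj Sh" and \<Phi>: "compatible_family Sh X Z \<Phi>"
  then have X: "is_sheaf B J X" and Z: "is_sheaf B J Z" by auto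
  note FX = sheaf_functor[OF X] and FZ = sheaf_functor[OF Z]
  note m = compatible_familyD(1,2)[OF \<Phi>]
  note pw = Sh_compatible_pointwise[OF inacc \<Phi>]
  \<comment> \<open>The candidates for the value of the extension at \<open>x\<close>. A section
    none of whose restrictions lies in an image is not constrained at all and may have many
    candidates; this is why uniqueness is demanded in \<open>S\<close>.\<close>
  define good where "good W x z \<longleftrightarrow> z \<in> FO Z W \<and> (\<forall>V. \<forall>g \<in> hom B V W. \<forall>(m, u) \<in> \<Phi>.
      \<forall>y \<in> FO (Dom Sh m) V. cmp m V y = res X g x \<longrightarrow> cmp u V y = res Z g z)" for W x z
  have goodD: "cmp u V y = res Z g z"
    if "good W x z" "g \<in> hom B V W" "(m, u) \<in> \<Phi>" "y \<in> FO (Dom Sh m) V" "cmp m V y = res X g x"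
    for W x z V g m u y
    using that unfolding good_def by fast
  have good_in: "z \<in> FO Z W" if "good W x z" for W x z
    using that unfolding good_def by blast
  have goodI: "good W x z"
    if "z \<in> FO Z W" "\<And>V g m u y. g \<in> hom B V W \<Longrightarrow> (m, u) \<in> \<Phi> \<Longrightarrow> y \<in> FO (Dom Sh m) V \<Longrightarrow>
      cmp m V y = res X g x \<Longrightarrow> cmp u V y = res Z g z" for W x z
    using that unfolding good_def by blast
  have good_res: "good V (res X f x) (res Z f z)"
    if f: "f \<in> hom B V W" and x: "x \<in> FO X W" and z: "good W x z" for f V W x z
  proof (rule goodI)
    show "res Z f z \<in> FO Z V" using res_in[OF FZ f good_in[OF z]] .
    fix U g m u y assume g: "g \<in> hom B U V" and mu: "(m, u) \<in> \<Phi>" and y: "y \<in> FO (Dom Sh m) U"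
      and eq: "cmp m U y = res X g (res X f x)"
    show "cmp u U y = res Z g (res Z f z)"
      using goodD[OF z comp_hom[OF g f] mu y] eq res_comp[OF FX f g x] res_comp[OF FZ f g good_in[OF z]]
      by simp
  qed
  \<comment> \<open>Uniqueness is required over every restriction of \<open>x\<close>, because
    uniqueness over \<open>W\<close> alone need not pass to a restriction.\<close>
  define S where "S W = {x \<in> FO X W. \<forall>V. \<forall>f \<in> hom B V W. \<exists>!z. good V (res X f x) z}" for W
  have S_in: "x \<in> FO X W" if "x \<in> S W" for x W
    using that by (simp add: S_def)
  have S_ex1: "\<exists>!z. good V (res X f x) z" if "x \<in> S W" "f \<in> hom B V W" for x V W f
    using that unfolding S_def by blast
  have S_ex1': "\<exists>!z. good W x z" if "x \<in> S W" "W \<in> Obj B" for x W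
    using S_ex1[OF that(1) id_hom[OF that(2)]] res_id[OF FX that(2) S_in[OF that(1)]] by simp
  have S_res: "res X f x \<in> S V" if f: "f \<in> hom B V W" and x: "x \<in> S W" for f V W x
  proof -
    have "\<exists>!z. good U (res X g (res X f x)) z" if g: "g \<in> hom B U V" for U g
      using S_ex1[OF x comp_hom[OF g f]] res_comp[OF FX f g S_in[OF x]] by simp
    then show ?thesis using res_in[OF FX f S_in[OF x]] by (simp add: S_def)
  qed
  define K where "K = mk_presheaf S (res X)"
  have FO_K [simp]: "FO K = S" by (simp add: K_def)
  have res_K: "res K f x = res X f x" if "f \<in> hom B V W" "x \<in> S W" for f V W x
    unfolding K_def using res_mk_presheaf[where ?S=S, OF that] .
  have K_functor: "is_functor (opposite B) Sets K"
    unfolding K_def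
  proof (rule functor_mk_presheaf)
    show "S W \<prec> (UNIV :: 'u set)" if "W \<in> Obj B" for W
      using lesspoll_subset[OF _ small_FO[OF FX that]] S_in by blast
    show "res X (f \<cdot> g) x = res X g (res X f x)"
      if "f \<in> hom B V W" "g \<in> hom B U V" "x \<in> S W" for f g U V W x
      using res_comp[OF FX that(1,2) S_in[OF that(3)]] .
    show "res X (Id B W) x = x" if "W \<in> Obj B" "x \<in> S W" for W x
      using res_id[OF FX that(1) S_in[OF that(2)]] .
  qed (use S_res in blast)
  have K: "is_sheaf B J K"
  proof (rule sheafI[OF K_functor])
    fix U C x assume U: "U \<in> Obj B" "C \<in> J U" and x: "matching_family B K C x"
    have x_in: "x f \<in> S (Dom B f)" if "f \<in> C" for f
      using matching_familyD(1)[OF x U that] by simp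
    have "matching_family B X C x"
      using S_in[OF x_in] matching_familyD(2)[OF x U] res_K[OF _ x_in]
      by (intro matching_familyI) auto
    from sheaf_glue[OF X U this] obtain t
      where t: "t \<in> FO X U" and res_t: "\<And>f. f \<in> C \<Longrightarrow> res X f t = x f"
      by blast
    have "\<exists>!z. good V (res X f t) z" if f: "f \<in> hom B V U" for V f
    proof -
      \<comment> \<open>The unique good values on the pulled-back cover match, because restriction
        preserves goodness; they glue to \<open>z\<close>. Goodness and uniqueness of
        \<open>z\<close> are then both checked on covers, using that \<open>Z\<close> is
        separated.\<close>
      let ?D = "sieve_pullback B f C" and ?s = "res X f t"
      note V = hom_obj(1)[OF f] cover_pullback[OF f U(2)]
      have s: "?s \<in> FO X V" using res_in[OF FX f t] .
      have D: "g \<in> hom B (Dom B g) V" "res X g ?s \<in> S (Dom B g)" if g: "g \<in> ?D" for g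
      proof -
        note gg = cover_pullbackD[OF f g]
        show "g \<in> hom B (Dom B g) V" by (rule gg(1))
        have "res X g ?s = x (f \<cdot> g)" using res_comp[OF FX f gg(1) t] res_t[OF gg(2)] by simp
        then show "res X g ?s \<in> S (Dom B g)"
          using x_in[OF gg(2)] homD(2)[OF comp_hom[OF gg(1) f]] by simp
      qed
      define \<zeta> where "\<zeta> g = (THE z. good (Dom B g) (res X g ?s) z)" for g
      have \<zeta>: "good (Dom B g) (res X g ?s) (\<zeta> g)" if "g \<in> ?D" for g
        unfolding \<zeta>_def using theI'[OF S_ex1'[OF D(2)[OF that] hom_obj(1)[OF D(1)[OF that]]]] .
      have \<zeta>_eq: "z = \<zeta> g" if "g \<in> ?D" "good (Dom B g) (res X g ?s) z" for g z
        using S_ex1'[OF D(2)[OF that(1)] hom_obj(1)[OF D(1)[OF that(1)]]] that(2) \<zeta>[OF that(1)] by blast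
      have "matching_family B Z ?D \<zeta>"
      proof (rule matching_familyI)
        show "\<zeta> g \<in> FO Z (Dom B g)" if "g \<in> ?D" for g using good_in[OF \<zeta>[OF that]] .
        fix g h W assume g: "g \<in> ?D" and h: "h \<in> hom B W (Dom B g)"
        note gh = cover_closed[OF V g h]
        have W: "Dom B (g \<cdot> h) = W" using homD(2)[OF comp_hom[OF h D(1)[OF g]]] .
        show "res Z h (\<zeta> g) = \<zeta> (g \<cdot> h)"
          using \<zeta>_eq[OF gh] good_res[OF h S_in[OF D(2)[OF g]] \<zeta>[OF g]] res_comp[OF FX D(1)[OF g] h s]
          by (simp add: W)
      qed
      from sheaf_glue[OF Z V this] obtain z
        where z: "z \<in> FO Z V" and res_z: "\<And>g. g \<in> ?D \<Longrightarrow> res Z g z = \<zeta> g"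
        by blast
      have "good V ?s z"
      proof (rule goodI[OF z])
        fix W h m u y assume h: "h \<in> hom B W V" and mu: "(m, u) \<in> \<Phi>" and y: "y \<in> FO (Dom Sh m) W"
          and eq: "cmp m W y = res X h ?s"
        note W = hom_obj(1)[OF h] cover_pullback[OF h V(2)]
        show "cmp u W y = res Z h z"
        proof (rule sheaf_separated[OF Z W cmp_in[OF m(2)[OF mu] W(1) y] res_in[OF FZ h z]])
          fix g assume g: "g \<in> sieve_pullback B h ?D"
          note gh = cover_pullbackD[OF h g]
          note y' = res_in[OF sheaf_functor[OF sheaf_dom[OF m(1)[OF mu]]] gh(1) y]
          have dom: "Dom B (h \<cdot> g) = Dom B g" using homD(2)[OF comp_hom[OF gh(1) h]] .
          note G = hom_obj(1)[OF gh(1)]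
          let ?s' = "res X (h \<cdot> g) ?s"
          have s': "?s' \<in> FO X (Dom B g)" using res_in[OF FX comp_hom[OF gh(1) h] s] .
          have "cmp m (Dom B g) (res (Dom Sh m) g y) = ?s'"
            using cmp_res[OF m(1)[OF mu] gh(1) y] eq res_comp[OF FX h gh(1) s] by simp
          then have "cmp u (Dom B g) (res (Dom Sh m) g y) = res Z (Id B (Dom B g)) (\<zeta> (h \<cdot> g))"
            using goodD[OF \<zeta>[OF gh(2)] _ mu y'] id_hom[OF G] res_id[OF FX G s'] by (simp add: dom)
          also have "\<dots> = \<zeta> (h \<cdot> g)"
            using res_id[OF FZ G] good_in[OF \<zeta>[OF gh(2)]] by (simp add: dom)
          also have "\<dots> = res Z g (res Z h z)"
            using res_z[OF gh(2)] res_comp[OF FZ h gh(1) z] by simp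
          finally show "res Z g (cmp u W y) = res Z g (res Z h z)"
            using cmp_res[OF m(2)[OF mu] gh(1) y] by simp
        qed
      qed
      moreover have "z' = z" if z': "good V ?s z'" for z'
      proof (rule sheaf_separated[OF Z V good_in[OF z'] z])
        fix g assume g: "g \<in> ?D"
        show "res Z g z' = res Z g z"
          using \<zeta>_eq[OF g good_res[OF D(1)[OF g] s z']] res_z[OF g] by simp
      qed
      ultimately show ?thesis by blast
    qed
    then have tS: "t \<in> S U" using t by (simp add: S_def)
    then have "\<forall>f \<in> C. res K f t = x f" using res_K[OF cover_hom[OF U] tS] res_t by simp
    then show "\<exists>t \<in> FO K U. \<forall>f \<in> C. res K f t = x f" using tS by auto
  next
    fix U C t t' assume U: "U \<in> Obj B" "C \<in> J U" and "t \<in> FO K U" "t' \<in> FO K U"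
      and eq: "\<And>f. f \<in> C \<Longrightarrow> res K f t = res K f t'"
    then have t: "t \<in> S U" "t' \<in> S U" by auto
    show "t = t'"
      using sheaf_separated[OF X U S_in[OF t(1)] S_in[OF t(2)]] eq
        res_K[OF cover_hom[OF U] t(1)] res_K[OF cover_hom[OF U] t(2)] by simp
  qed
  define k where "k = mk_arrow K X (\<lambda>W x. x)"
  have k: "k \<in> hom Sh K X"
    unfolding k_def by (rule mk_arrow_hom[OF K X]) (use S_in res_K in auto)
  have cmp_k: "cmp k W x = x" if "W \<in> Obj B" "x \<in> S W" for W x
    unfolding k_def using that cmp_mk_arrow[of W x K] by simp
  have "is_mono Sh k"
  proof (rule Sh.monoI[OF k])
    fix T a b assume a: "a \<in> hom Sh T K" and b: "b \<in> hom Sh T K" and eq: "Comp Sh k a = Comp Sh k b"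
    show "a = b"
    proof (rule Sh_arrow_eqI[OF a b])
      fix W x assume W: "W \<in> Obj B" and x: "x \<in> FO T W"
      show "cmp a W x = cmp b W x"
        using cmp_Comp[OF a k W x] cmp_Comp[OF b k W x] eq cmp_k[OF W] cmp_in[OF a W x] cmp_in[OF b W x]
        by simp
    qed
  qed
  moreover define w where "w = mk_arrow K Z (\<lambda>W x. THE z. good W x z)"
  have THE_good: "good W x (THE z. good W x z)" if "W \<in> Obj B" "x \<in> S W" for W x
    using theI'[OF S_ex1'[OF that(2,1)]] .
  have w: "w \<in> hom Sh K Z"
    unfolding w_def
  proof (rule mk_arrow_hom[OF K Z])
    show "(THE z. good W x z) \<in> FO Z W" if "W \<in> Obj B" "x \<in> FO K W" for W x
      using good_in[OF THE_good[OF that(1)]] that(2) by simp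
    fix f V W x assume f: "f \<in> hom B V W" and "x \<in> FO K W"
    then have x: "x \<in> S W" by simp
    note V = hom_obj(1)[OF f] and W = hom_obj(2)[OF f]
    show "(THE z. good V (res K f x) z) = res Z f (THE z. good W x z)"
      unfolding res_K[OF f x]
      using good_res[OF f S_in[OF x] THE_good[OF W x]] S_ex1'[OF S_res[OF f x] V] by (rule the1_equality[rotated])
  qed
  moreover have "\<exists>h \<in> hom Sh (Dom Sh m) K. Comp Sh k h = m \<and> Comp Sh w h = u" if mu: "(m, u) \<in> \<Phi>" for m u
  proof -
    let ?M = "Dom Sh m"
    note mh = m(1)[OF mu] and uh = m(2)[OF mu]
    note M = sheaf_dom[OF mh]
    have good_m: "good V (cmp m V y) (cmp u V y)" if V: "V \<in> Obj B" and y: "y \<in> FO ?M V" for V y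
    proof (rule goodI)
      show "cmp u V y \<in> FO Z V" using cmp_in[OF uh V y] .
      fix W g m' u' y' assume g: "g \<in> hom B W V" and mu': "(m', u') \<in> \<Phi>" and y': "y' \<in> FO (Dom Sh m') W"
        and eq: "cmp m' W y' = res X g (cmp m V y)"
      note gy = res_in[OF sheaf_functor[OF M] g y]
      have "cmp u' W y' = cmp u W (res ?M g y)"
        using pw[OF mu' mu hom_obj(1)[OF g] y' gy] eq cmp_res[OF mh g y] by simp
      then show "cmp u' W y' = res Z g (cmp u V y)" using cmp_res[OF uh g y] by simp
    qed
    \<comment> \<open>The pair \<open>(m, u)\<close> itself, tested at the identity, leaves no
      choice of value.\<close>
    have good_u: "z = cmp u V y" if V: "V \<in> Obj B" and y: "y \<in> FO ?M V" and z: "good V (cmp m V y) z" for V y z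
      using goodD[OF z id_hom[OF V] mu y] res_id[OF FX V cmp_in[OF mh V y]] res_id[OF FZ V good_in[OF z]]
      by simp
    have mS: "cmp m W y \<in> S W" if W: "W \<in> Obj B" and y: "y \<in> FO ?M W" for W y
    proof -
      have "\<exists>!z. good V (res X f (cmp m W y)) z" if f: "f \<in> hom B V W" for V f
      proof -
        note V = hom_obj(1)[OF f] and y' = res_in[OF sheaf_functor[OF M] f y]
        show ?thesis
          using good_m[OF V y'] good_u[OF V y'] cmp_res[OF mh f y] by (intro ex1I) auto
      qed
      then show ?thesis using cmp_in[OF mh W y] by (simp add: S_def)
    qed
    define h where "h = mk_arrow ?M K (cmp m)"
    have h: "h \<in> hom Sh ?M K"
      unfolding h_def
    proof (rule mk_arrow_hom[OF M K])
      show "cmp m W y \<in> FO K W" if "W \<in> Obj B" "y \<in> FO ?M W" for W y using mS[OF that] by simp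
      fix f V W y assume f: "f \<in> hom B V W" and y: "y \<in> FO ?M W"
      show "cmp m V (res ?M f y) = res K f (cmp m W y)"
        using cmp_res[OF mh f y] res_K[OF f mS[OF hom_obj(2)[OF f] y]] by simp
    qed
    have cmp_h: "cmp h W y = cmp m W y" if "W \<in> Obj B" "y \<in> FO ?M W" for W y
      unfolding h_def using cmp_mk_arrow[OF that] .
    have "Comp Sh k h = m"
    proof (rule Sh_arrow_eqI[OF Comp_Sh_hom(1)[OF h k] mh])
      fix W y assume W: "W \<in> Obj B" and y: "y \<in> FO ?M W"
      show "cmp (Comp Sh k h) W y = cmp m W y"
        using cmp_Comp[OF h k W y] cmp_h[OF W y] cmp_k[OF W mS[OF W y]] by simp
    qed
    moreover have "Comp Sh w h = u"
    proof (rule Sh_arrow_eqI[OF Comp_Sh_hom(1)[OF h w] uh])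
      fix W y assume W: "W \<in> Obj B" and y: "y \<in> FO ?M W"
      have "cmp w W (cmp m W y) = (THE z. good W (cmp m W y) z)"
        unfolding w_def using cmp_mk_arrow[OF W, of "cmp m W y" K] mS[OF W y] by simp
      then show "cmp (Comp Sh w h) W y = cmp u W y"
        using cmp_Comp[OF h w W y] cmp_h[OF W y] good_u[OF W y THE_good[OF W mS[OF W y]]] by simp
    qed
    ultimately show ?thesis using h by blast
  qed
  ultimately show "extends_to_subobject Sh X Z \<Phi>"
    unfolding extends_to_subobject_def using k by blast
qed

text \<open>Over an object covered by the empty sieve every sheaf has exactly one section, since the
  empty family matches there and glues uniquely. So the smallest sheaf has one section over such
  objects and none elsewhere. A sheaf mapping to it has sections only over such objects, where its
  arrows to any sheaf are forced.\<close>

lemma Sh_strict_initial: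
  assumes inacc: "inaccessible TYPE('u)"
  shows "has_strict_initial Sh"
proof -
  define S where "S W = (if {} \<in> J W then {undefined :: 'u} else {})" for W
  have S_iff: "x \<in> S W \<longleftrightarrow> {} \<in> J W \<and> x = undefined" for x W
    by (auto simp: S_def)
  have empty_res: "{} \<in> J V" if f: "f \<in> hom B V W" and "{} \<in> J W" for f V W
    using cover_pullback[OF that] by (simp add: sieve_pullback_def)
  define Z where "Z = mk_presheaf S (\<lambda>_ _. undefined)"
  have FO_Z [simp]: "FO Z = S" by (simp add: Z_def)
  have Z_functor: "is_functor (opposite B) Sets Z"
    unfolding Z_def
  proof (rule functor_mk_presheaf)
    fix W assume W: "W \<in> Obj B"
    have "finite (S W)" by (simp add: S_def)
    then show "S W \<prec> (UNIV :: 'u set)" using small_finite[OF inacc] by blast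
  qed (use empty_res in \<open>auto simp: S_iff\<close>)
  have Z: "is_sheaf B J Z"
  proof (rule sheafI[OF Z_functor])
    fix U C x assume U: "U \<in> Obj B" "C \<in> J U" and x: "matching_family B Z C x"
    have x_in: "{} \<in> J (Dom B f)" "x f = undefined" if "f \<in> C" for f
      using matching_familyD(1)[OF x U that] by (simp_all add: S_iff)
    have t: "undefined \<in> S U" using empty_cover[OF U x_in(1)] by (simp add: S_iff)
    have "res Z f undefined = x f" if f: "f \<in> C" for f
      using res_in[OF Z_functor cover_hom[OF U f]] t x_in(2)[OF f] by (simp add: S_iff)
    then show "\<exists>t \<in> FO Z U. \<forall>f \<in> C. res Z f t = x f" using t by auto
  qed (simp add: S_iff)
  have "is_initial Sh X" if X: "is_sheaf B J X" and ne: "hom Sh X Z \<noteq> {}" for X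
  proof -
    obtain a where a: "a \<in> hom Sh X Z" using ne by blast
    have empty: "{} \<in> J W" if "W \<in> Obj B" "x \<in> FO X W" for W x
      using cmp_in[OF a that] by (simp add: S_iff)
    have "\<exists>!f. f \<in> hom Sh X Y" if Y: "is_sheaf B J Y" for Y
    proof -
      have ex1: "\<exists>!y. y \<in> FO Y W" if "W \<in> Obj B" "{} \<in> J W" for W
      proof -
        have "matching_family B Y {} (\<lambda>_. undefined)" by (rule matching_familyI) auto
        then show ?thesis using Y that unfolding is_sheaf_def by fastforce
      qed
      let ?h = "mk_arrow X Y (\<lambda>W x. THE y. y \<in> FO Y W)"
      have the: "(THE y. y \<in> FO Y W) \<in> FO Y W" if "W \<in> Obj B" "x \<in> FO X W" for W x
        using theI'[OF ex1[OF that(1) empty[OF that]]] .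
      have "?h \<in> hom Sh X Y"
      proof (rule mk_arrow_hom[OF X Y the])
        fix f V W x assume f: "f \<in> hom B V W" and x: "x \<in> FO X W"
        note V = hom_obj(1)[OF f] and W = hom_obj(2)[OF f] and x' = res_in[OF sheaf_functor[OF X] f x]
        show "(THE y. y \<in> FO Y V) = res Y f (THE y. y \<in> FO Y W)"
          using res_in[OF sheaf_functor[OF Y] f the[OF W x]] ex1[OF V empty[OF V x']]
          by (rule the1_equality[rotated])
      qed
      moreover have "g = g'" if g: "g \<in> hom Sh X Y" and g': "g' \<in> hom Sh X Y" for g g'
      proof (rule Sh_arrow_eqI[OF g g'])
        fix W x assume W: "W \<in> Obj B" and x: "x \<in> FO X W"
        show "cmp g W x = cmp g' W x"
          using ex1[OF W empty[OF W x]] cmp_in[OF g W x] cmp_in[OF g' W x] by blast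
      qed
      ultimately show ?thesis by blast
    qed
    then show ?thesis using X by (simp add: is_initial_def)
  qed
  then show ?thesis
    unfolding has_strict_initial_def using Z by (intro bexI[of _ Z] ballI impI) simp_all
qed

end

section \<open>Boolean categories with a point\<close>

lemma (in category) pullback_mono:
  assumes pb: "is_pullback C f g P p q" and f: "f \<in> hom C X Z" and g: "g \<in> hom C Y Z"
    and mono: "is_mono C g"
  shows "is_mono C p"
proof -
  have p: "p \<in> hom C P X" and q: "q \<in> hom C P Y" and sq: "f \<cdot> p = g \<cdot> q"
    and uniq: "\<And>T a b. a \<in> hom C T X \<Longrightarrow> b \<in> hom C T Y \<Longrightarrow> f \<cdot> a = g \<cdot> b \<Longrightarrow>
      \<exists>!h. h \<in> hom C T P \<and> p \<cdot> h = a \<and> q \<cdot> h = b"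
    using pb homD(2)[OF f] homD(2)[OF g] unfolding is_pullback_def by auto
  show ?thesis
  proof (rule monoI[OF p])
    fix T u v assume u: "u \<in> hom C T P" and v: "v \<in> hom C T P" and eq: "p \<cdot> u = p \<cdot> v"
    have gq: "g \<cdot> (q \<cdot> h) = f \<cdot> (p \<cdot> h)" if "h \<in> hom C T P" for h
      using assoc[OF that q g] assoc[OF that p f] sq by simp
    have "q \<cdot> u = q \<cdot> v"
      using monoD[OF mono g comp_hom[OF u q] comp_hom[OF v q]] gq[OF u] gq[OF v] eq by simp
    then show "u = v"
      using uniq[OF comp_hom[OF u p] comp_hom[OF u q]] gq[OF u] u v eq by metis
  qed
qed

text \<open>\<open>el\<close> and \<open>act\<close> are the inverse image of the point, \<open>sub_of\<close> is what is used of its right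
  adjoint, and \<open>two_points\<close> expresses by \<open>D = \<gamma>\<^sup>*2\<close> that the topos is connected.\<close>

locale pointed_boolean_category = category E for E :: "('o, 'm) category_data" +
  fixes el :: "'o \<Rightarrow> 'u set" and act :: "'m \<Rightarrow> 'u \<Rightarrow> 'u"
  assumes pullbacks: "f \<in> hom E X Z \<Longrightarrow> g \<in> hom E Y Z \<Longrightarrow> \<exists>P p q. is_pullback E f g P p q"
    and terminal: "\<exists>T. is_terminal E T"
    and unions: "has_effective_unions E"
    and strict_initial: "has_strict_initial E"
    and boolean: "boolean_category E"
    and act_in: "f \<in> hom E X Y \<Longrightarrow> x \<in> el X \<Longrightarrow> act f x \<in> el Y"
    and act_id: "X \<in> Obj E \<Longrightarrow> x \<in> el X \<Longrightarrow> act (Id E X) x = x"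
    and act_comp: "f \<in> hom E X Y \<Longrightarrow> g \<in> hom E Y Z \<Longrightarrow> x \<in> el X \<Longrightarrow>
      act (Comp E g f) x = act g (act f x)"
    and el_terminal: "is_terminal E T \<Longrightarrow> \<exists>!x. x \<in> el T"
    and el_pullback: "is_pullback E f g P p q \<Longrightarrow> f \<in> hom E X Z \<Longrightarrow> g \<in> hom E Y Z \<Longrightarrow>
      x \<in> el X \<Longrightarrow> y \<in> el Y \<Longrightarrow> act f x = act g y \<Longrightarrow> \<exists>!e. e \<in> el P \<and> act p e = x \<and> act q e = y"
    and sub_of: "X \<in> Obj E \<Longrightarrow> T' \<subseteq> el X \<Longrightarrow>
      \<exists>K k. k \<in> hom E K X \<and> is_mono E k \<and> act k ` el K \<subseteq> T' \<and>
        (\<forall>Y. \<forall>f \<in> hom E Y X. act f ` el Y \<subseteq> T' \<longrightarrow> (\<exists>h \<in> hom E Y K. Comp E k h = f))"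
    and two_points: "\<exists>T D s t. is_terminal E T \<and> s \<in> hom E T D \<and> t \<in> hom E T D \<and>
      hom E T D \<subseteq> {s, t} \<and> (\<forall>x \<in> el T. act s x \<noteq> act t x) \<and>
      (\<forall>Y. \<forall>f \<in> hom E Y T. Comp E s f = Comp E t f \<longrightarrow> (\<exists>Z. is_initial E Z \<and> hom E Y Z \<noteq> {}))"
begin

section \<open>Fibres of monomorphisms, complements and finite limits\<close>

abbreviation comp_E (infixl "\<cdot>" 70) where "g \<cdot> f \<equiv> Comp E g f"

lemma pullback_ex:
  assumes f: "f \<in> hom E X Z" and g: "g \<in> hom E Y Z"
  shows "\<exists>P p q. is_pullback E f g P p q \<and> p \<in> hom E P X \<and> q \<in> hom E P Y \<and> f \<cdot> p = g \<cdot> q \<and>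
    (\<forall>T. \<forall>a \<in> hom E T X. \<forall>b \<in> hom E T Y. f \<cdot> a = g \<cdot> b \<longrightarrow>
      (\<exists>!h. h \<in> hom E T P \<and> p \<cdot> h = a \<and> q \<cdot> h = b)) \<and>
    (\<forall>x \<in> el X. \<forall>y \<in> el Y. act f x = act g y \<longrightarrow> (\<exists>!e. e \<in> el P \<and> act p e = x \<and> act q e = y))"
proof -
  obtain P p q where pb: "is_pullback E f g P p q" using pullbacks[OF f g] by blast
  then have "p \<in> hom E P X \<and> q \<in> hom E P Y \<and> f \<cdot> p = g \<cdot> q \<and>
      (\<forall>T. \<forall>a \<in> hom E T X. \<forall>b \<in> hom E T Y. f \<cdot> a = g \<cdot> b \<longrightarrow>
        (\<exists>!h. h \<in> hom E T P \<and> p \<cdot> h = a \<and> q \<cdot> h = b))"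
    using homD(2)[OF f] homD(2)[OF g] unfolding is_pullback_def by simp
  moreover have "\<forall>x \<in> el X. \<forall>y \<in> el Y. act f x = act g y \<longrightarrow>
      (\<exists>!e. e \<in> el P \<and> act p e = x \<and> act q e = y)"
    using el_pullback[OF pb f g] by simp
  ultimately show ?thesis using pb by (intro exI conjI) simp_all
qed

text \<open>The two projections of the kernel pair of a monomorphism coincide, and the fibre of the
  kernel pair contains every pair of elements identified by \<open>m\<close>.\<close>

lemma mono_inj:
  assumes m: "m \<in> hom E X Y" "is_mono E m"
  shows "inj_on (act m) (el X)"
proof (rule inj_onI)
  fix x y assume x: "x \<in> el X" and y: "y \<in> el X" and eq: "act m x = act m y"
  obtain P p q where p: "p \<in> hom E P X" and q: "q \<in> hom E P X" and sq: "m \<cdot> p = m \<cdot> q"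
    and e: "\<exists>!e. e \<in> el P \<and> act p e = x \<and> act q e = y"
    using pullback_ex[OF m(1) m(1)] x y eq by meson
  have "p = q" using monoD[OF m(2,1) p q sq] .
  then show "x = y" using e by blast
qed

lemma initial_map: "is_initial E Z \<Longrightarrow> X \<in> Obj E \<Longrightarrow> \<exists>f. f \<in> hom E Z X"
  unfolding is_initial_def by blast

lemma initial_uniq: "is_initial E Z \<Longrightarrow> f \<in> hom E Z X \<Longrightarrow> g \<in> hom E Z X \<Longrightarrow> f = g"
  using hom_obj(2) unfolding is_initial_def by blast

lemma terminal_map: "is_terminal E T \<Longrightarrow> X \<in> Obj E \<Longrightarrow> \<exists>f. f \<in> hom E X T"
  unfolding is_terminal_def by blast

lemma terminal_uniq: "is_terminal E T \<Longrightarrow> f \<in> hom E X T \<Longrightarrow> g \<in> hom E X T \<Longrightarrow> f = g"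
  using hom_obj(1) unfolding is_terminal_def by blast

lemma initial_strict:
  assumes Z: "is_initial E Z" and f: "f \<in> hom E X Z"
  shows "is_initial E X"
proof -
  obtain Z' where Z': "Z' \<in> Obj E" "\<And>X. X \<in> Obj E \<Longrightarrow> hom E X Z' \<noteq> {} \<Longrightarrow> is_initial E X"
    using strict_initial unfolding has_strict_initial_def by blast
  obtain g where "g \<in> hom E Z Z'" using initial_map[OF Z Z'(1)] by blast
  then show ?thesis using Z'(2)[OF hom_obj(1)[OF f]] comp_hom[OF f] by blast
qed

text \<open>The largest subobject sent below the empty set has an empty fibre, and an initial object
  maps to it.\<close>

lemma el_initial:
  assumes "is_initial E Z"
  shows "el Z = {}"
proof -
  have Z: "Z \<in> Obj E" using assms by (simp add: is_initial_def)
  obtain K k where k: "k \<in> hom E K Z" "act k ` el K \<subseteq> {}"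
    using sub_of[OF Z empty_subsetI] by blast
  obtain f where "f \<in> hom E Z K" using initial_map[OF assms hom_obj(1)[OF k(1)]] by blast
  then show ?thesis using act_in k(2) by blast
qed

lemma sub_leI: "k \<in> hom E K X \<Longrightarrow> l \<in> hom E L X \<Longrightarrow> h \<in> hom E K L \<Longrightarrow> l \<cdot> h = k \<Longrightarrow> sub_le E k l"
  using homD(2)[of k E K X] homD(2)[of l E L X] by (auto simp: sub_le_def)

lemma sub_leD:
  assumes "sub_le E k l" "k \<in> hom E K X" "l \<in> hom E L X"
  shows "\<exists>h \<in> hom E K L. l \<cdot> h = k"
  using assms homD(2)[of k E K X] homD(2)[of l E L X] by (auto simp: sub_le_def)

lemma subobjectsI: "k \<in> hom E K X \<Longrightarrow> is_mono E k \<Longrightarrow> k \<in> subobjects E X"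
  by (simp add: subobjects_def hom_def)

lemma complement_ex:
  assumes m: "m \<in> hom E M X" "is_mono E m"
  shows "\<exists>N n. n \<in> hom E N X \<and> is_mono E n \<and> sub_complement E X m n"
proof -
  obtain n where n: "n \<in> subobjects E X" and c: "sub_complement E X m n"
    using boolean hom_obj(2)[OF m(1)] subobjectsI[OF m] unfolding boolean_category_def by blast
  have "n \<in> hom E (Dom E n) X" "is_mono E n"
    using n unfolding subobjects_def is_mono_def hom_def by auto
  then show ?thesis using c by blast
qed

lemma complement_upper:
  assumes c: "sub_complement E X m n" and m: "m \<in> hom E M X" and n: "n \<in> hom E N X"
    and k: "k \<in> hom E K X" "is_mono E k"
    and a: "a \<in> hom E M K" "k \<cdot> a = m" and b: "b \<in> hom E N K" "k \<cdot> b = n"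
  shows "\<exists>h \<in> hom E X K. k \<cdot> h = Id E X"
proof -
  note id = id_hom[OF hom_obj(2)[OF m]]
  have "Id E X \<in> subobjects E X"
    using subobjectsI[OF id split_mono[OF id id]] id_left[OF id] by blast
  then have "sub_le E (Id E X) k"
    using c subobjectsI[OF k] sub_leI[OF m k(1) a] sub_leI[OF n k(1) b]
    unfolding sub_complement_def by blast
  then show ?thesis using sub_leD[OF _ id k(1)] by blast
qed

text \<open>The pullback is the meet of \<open>m\<close> and \<open>n\<close>. Complementation makes
  it least among the subobjects of \<open>X\<close>, which by itself does not say that it is
  initial; its later uses compare it with a subobject chosen for the purpose. The last clause
  transfers a common element of the two fibres to it.\<close>

lemma meet_least:
  assumes c: "sub_complement E X m n"
    and m: "m \<in> hom E M X" "is_mono E m" and n: "n \<in> hom E N X" "is_mono E n"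
  shows "\<exists>W w. w \<in> hom E W X \<and> is_mono E w \<and>
    (\<forall>T. \<forall>a \<in> hom E T M. \<forall>b \<in> hom E T N. m \<cdot> a = n \<cdot> b \<longrightarrow> (\<exists>h \<in> hom E T W. w \<cdot> h = m \<cdot> a)) \<and>
    (\<forall>L. \<forall>l \<in> hom E L X. is_mono E l \<longrightarrow> (\<exists>h \<in> hom E W L. l \<cdot> h = w)) \<and>
    (act m ` el M \<inter> act n ` el N \<noteq> {} \<longrightarrow> el W \<noteq> {})"
proof -
  obtain W p q where pb: "is_pullback E m n W p q" and p: "p \<in> hom E W M" and q: "q \<in> hom E W N"
    and sq: "m \<cdot> p = n \<cdot> q"
    and fac: "\<forall>T. \<forall>a \<in> hom E T M. \<forall>b \<in> hom E T N. m \<cdot> a = n \<cdot> b \<longrightarrow>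
      (\<exists>!h. h \<in> hom E T W \<and> p \<cdot> h = a \<and> q \<cdot> h = b)"
    and e: "\<forall>x \<in> el M. \<forall>y \<in> el N. act m x = act n y \<longrightarrow> (\<exists>!e. e \<in> el W \<and> act p e = x \<and> act q e = y)"
    using pullback_ex[OF m(1) n(1)] by (elim exE conjE)
  note w = comp_hom[OF p m(1)]
  have mono: "is_mono E (m \<cdot> p)"
    using mono_comp[OF p m(1) pullback_mono[OF pb m(1) n] m(2)] .
  show ?thesis
  proof (intro exI conjI allI ballI impI)
    show "m \<cdot> p \<in> hom E W X" "is_mono E (m \<cdot> p)" using w mono .
    show "\<exists>h \<in> hom E T W. m \<cdot> p \<cdot> h = m \<cdot> a"
      if ab: "a \<in> hom E T M" "b \<in> hom E T N" "m \<cdot> a = n \<cdot> b" for T a b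
    proof -
      obtain h where h: "h \<in> hom E T W" "p \<cdot> h = a" using fac ab by blast
      then show ?thesis using assoc[OF h(1) p m(1)] by auto
    qed
    show "\<exists>h \<in> hom E W L. l \<cdot> h = m \<cdot> p" if l: "l \<in> hom E L X" "is_mono E l" for L l
    proof -
      have "sub_le E (m \<cdot> p) l"
        using c subobjectsI[OF w mono] subobjectsI[OF l] sub_leI[OF w m(1) p refl]
          sub_leI[OF w n(1) q sq[symmetric]] unfolding sub_complement_def by blast
      then show ?thesis using sub_leD[OF _ w l(1)] by blast
    qed
    show "el W \<noteq> {}" if ne: "act m ` el M \<inter> act n ` el N \<noteq> {}"
    proof -
      obtain x y where "x \<in> el M" "y \<in> el N" "act m x = act n y" using ne by force
      then show ?thesis using e by blast
    qed
  qed
qed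

text \<open>A common element would give an element of the meet, which is contained in a subobject
  with empty fibre. For the covering, the largest subobject with fibre inside the union contains
  both \<open>m\<close> and \<open>n\<close>, so it is all of \<open>X\<close>.\<close>

lemma el_complement:
  assumes c: "sub_complement E X m n"
    and m: "m \<in> hom E M X" "is_mono E m" and n: "n \<in> hom E N X" "is_mono E n"
  shows "act m ` el M \<inter> act n ` el N = {}" "act m ` el M \<union> act n ` el N = el X"
proof -
  have X: "X \<in> Obj E" using hom_obj(2)[OF m(1)] .
  show "act m ` el M \<inter> act n ` el N = {}"
  proof (rule ccontr)
    assume ne: "act m ` el M \<inter> act n ` el N \<noteq> {}"
    obtain W w where least: "\<forall>L. \<forall>l \<in> hom E L X. is_mono E l \<longrightarrow> (\<exists>h \<in> hom E W L. l \<cdot> h = w)"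
      and W: "el W \<noteq> {}"
      using meet_least[OF c m n] ne by blast
    obtain K k where k: "k \<in> hom E K X" "is_mono E k" "act k ` el K \<subseteq> {}"
      using sub_of[OF X empty_subsetI] by blast
    then obtain h where "h \<in> hom E W K" using least by blast
    then show False using W act_in k(3) by blast
  qed
  define T where "T = act m ` el M \<union> act n ` el N"
  have mT: "act m ` el M \<subseteq> T" and nT: "act n ` el N \<subseteq> T" by (simp_all add: T_def)
  have T: "T \<subseteq> el X" unfolding T_def using act_in[OF m(1)] act_in[OF n(1)] by blast
  obtain K k where k: "k \<in> hom E K X" "is_mono E k" "act k ` el K \<subseteq> T"
    and fac: "\<forall>Y. \<forall>f \<in> hom E Y X. act f ` el Y \<subseteq> T \<longrightarrow> (\<exists>h \<in> hom E Y K. k \<cdot> h = f)"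
    using sub_of[OF X T] by (elim exE conjE)
  obtain a where a: "a \<in> hom E M K" "k \<cdot> a = m" using fac m(1) mT by blast
  obtain b where b: "b \<in> hom E N K" "k \<cdot> b = n" using fac n(1) nT by blast
  obtain h where h: "h \<in> hom E X K" "k \<cdot> h = Id E X"
    using complement_upper[OF c m(1) n(1) k(1,2) a b] by blast
  have "x \<in> T" if x: "x \<in> el X" for x
  proof -
    have "x = act k (act h x)" using act_comp[OF h(1) k(1) x] h(2) act_id[OF X x] by simp
    then show ?thesis using k(3) act_in[OF h(1) x] by blast
  qed
  then show "act m ` el M \<union> act n ` el N = el X" using T unfolding T_def by blast
qed

lemma product_ex:
  assumes X: "X \<in> Obj E" and Y: "Y \<in> Obj E"
  shows "\<exists>P p q. is_binary_product E X Y P p q \<and> p \<in> hom E P X \<and> q \<in> hom E P Y \<and>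
    (\<forall>T. \<forall>f \<in> hom E T X. \<forall>g \<in> hom E T Y. \<exists>!h. h \<in> hom E T P \<and> p \<cdot> h = f \<and> q \<cdot> h = g) \<and>
    (\<forall>x \<in> el X. \<forall>y \<in> el Y. \<exists>!e. e \<in> el P \<and> act p e = x \<and> act q e = y)"
proof -
  obtain T where T: "is_terminal E T" using terminal by blast
  obtain f g where f: "f \<in> hom E X T" and g: "g \<in> hom E Y T"
    using terminal_map[OF T X] terminal_map[OF T Y] by blast
  obtain P p q where p: "p \<in> hom E P X" and q: "q \<in> hom E P Y"
    and univ: "\<forall>T. \<forall>a \<in> hom E T X. \<forall>b \<in> hom E T Y. f \<cdot> a = g \<cdot> b \<longrightarrow>
      (\<exists>!h. h \<in> hom E T P \<and> p \<cdot> h = a \<and> q \<cdot> h = b)"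
    and e: "\<forall>x \<in> el X. \<forall>y \<in> el Y. act f x = act g y \<longrightarrow> (\<exists>!e. e \<in> el P \<and> act p e = x \<and> act q e = y)"
    using pullback_ex[OF f g] by (elim exE conjE)
  have univ': "\<exists>!h. h \<in> hom E T' P \<and> p \<cdot> h = a \<and> q \<cdot> h = b"
    if "a \<in> hom E T' X" "b \<in> hom E T' Y" for T' a b
    using univ that terminal_uniq[OF T comp_hom[OF that(1) f] comp_hom[OF that(2) g]] by simp
  have e': "\<exists>!e. e \<in> el P \<and> act p e = x \<and> act q e = y" if "x \<in> el X" "y \<in> el Y" for x y
  proof -
    have "act f x = act g y"
      using el_terminal[OF T] act_in[OF f that(1)] act_in[OF g that(2)] by blast
    then show ?thesis using e that by simp
  qed
  have "is_binary_product E X Y P p q"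
    unfolding is_binary_product_def using hom_obj(1)[OF p] p q univ' by simp
  then show ?thesis using p q univ' e' by (intro exI conjI ballI allI) simp_all
qed

lemma equalizer_ex:
  assumes f: "f \<in> hom E X Y" and g: "g \<in> hom E X Y"
  shows "\<exists>K k. k \<in> hom E K X \<and> is_mono E k \<and> f \<cdot> k = g \<cdot> k \<and>
    act k ` el K = {x \<in> el X. act f x = act g x}"
proof -
  have X: "X \<in> Obj E" and Y: "Y \<in> Obj E" using hom_obj[OF f] by auto
  note id = id_hom[OF X]
  obtain P p q where p: "p \<in> hom E P X" and q: "q \<in> hom E P Y"
    and univ: "\<forall>T. \<forall>f \<in> hom E T X. \<forall>g \<in> hom E T Y. \<exists>!h. h \<in> hom E T P \<and> p \<cdot> h = f \<and> q \<cdot> h = g"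
    and el: "\<forall>x \<in> el X. \<forall>y \<in> el Y. \<exists>!e. e \<in> el P \<and> act p e = x \<and> act q e = y"
    using product_ex[OF X Y] by (elim exE conjE)
  \<comment> \<open>The equalizer arises as the pullback of the graphs \<open>a\<close> and
    \<open>b\<close> of \<open>f\<close> and \<open>g\<close> in the product; the first projection
    forces the two legs \<open>r\<close> and \<open>s\<close> to coincide.\<close>
  obtain a where a: "a \<in> hom E X P" "p \<cdot> a = Id E X" "q \<cdot> a = f" using univ id f by blast
  obtain b where b: "b \<in> hom E X P" "p \<cdot> b = Id E X" "q \<cdot> b = g" using univ id g by blast
  obtain K r s where pb: "is_pullback E a b K r s" and r: "r \<in> hom E K X" and s: "s \<in> hom E K X"
    and sq: "a \<cdot> r = b \<cdot> s"
    and elK: "\<forall>x \<in> el X. \<forall>y \<in> el X. act a x = act b y \<longrightarrow> (\<exists>!e. e \<in> el K \<and> act r e = x \<and> act s e = y)"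
    using pullback_ex[OF a(1) b(1)] by (elim exE conjE)
  have "p \<cdot> (a \<cdot> r) = r" "p \<cdot> (b \<cdot> s) = s"
    using assoc[OF r a(1) p] assoc[OF s b(1) p] a(2) b(2) id_left[OF r] id_left[OF s] by simp_all
  then have rs: "r = s" using sq by simp
  have "q \<cdot> (a \<cdot> r) = f \<cdot> r" "q \<cdot> (b \<cdot> s) = g \<cdot> s"
    using assoc[OF r a(1) q] assoc[OF s b(1) q] a(3) b(3) by simp_all
  then have eq: "f \<cdot> r = g \<cdot> r" using sq rs by simp
  have "is_mono E r"
    using pullback_mono[OF pb a(1) b(1) split_mono[OF b(1) p b(2)]] .
  moreover have "act r ` el K = {x \<in> el X. act f x = act g x}"
  proof (intro equalityI subsetI)
    fix x assume "x \<in> act r ` el K"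
    then obtain e where e: "e \<in> el K" "x = act r e" by blast
    then show "x \<in> {x \<in> el X. act f x = act g x}"
      using act_in[OF r] act_comp[OF r f e(1)] act_comp[OF r g e(1)] eq by simp
  next
    fix x assume "x \<in> {x \<in> el X. act f x = act g x}"
    then have x: "x \<in> el X" "act f x = act g x" by auto
    have pa: "act p (act a x) = x" "act q (act a x) = act f x"
      using act_comp[OF a(1) p x(1)] act_comp[OF a(1) q x(1)] a(2,3) act_id[OF X x(1)] by simp_all
    have pb: "act p (act b x) = x" "act q (act b x) = act g x"
      using act_comp[OF b(1) p x(1)] act_comp[OF b(1) q x(1)] b(2,3) act_id[OF X x(1)] by simp_all
    have "act a x = act b x"
      using el[rule_format, OF x(1) act_in[OF f x(1)]] pa pb x(2) act_in[OF a(1) x(1)] act_in[OF b(1) x(1)]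
      by metis
    then show "x \<in> act r ` el K" using elK x(1) by blast
  qed
  ultimately show ?thesis using r eq by blast
qed

text \<open>The only place where connectedness of the topos enters: the subterminal object \<open>U\<close> on which
  the point is trivial and its complement \<open>V\<close> glue the two global points of \<open>\<gamma>\<^sup>*2\<close> to a third
  one, which cannot be new, so the two points agree on \<open>U\<close>.\<close>

lemma initial_of_el_empty:
  assumes C: "C \<in> Obj E" "el C = {}"
  shows "is_initial E C"
proof -
  obtain T D s t where T: "is_terminal E T" and s: "s \<in> hom E T D" and t: "t \<in> hom E T D"
    and st: "hom E T D \<subseteq> {s, t}" and ne: "\<forall>x \<in> el T. act s x \<noteq> act t x"
    and eq_ini: "\<forall>Y. \<forall>f \<in> hom E Y T. s \<cdot> f = t \<cdot> f \<longrightarrow> (\<exists>Z. is_initial E Z \<and> hom E Y Z \<noteq> {})"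
    using two_points by (elim exE conjE)
  have TO: "T \<in> Obj E" and DO: "D \<in> Obj E" using hom_obj[OF s] by auto
  obtain U u where u: "u \<in> hom E U T" "is_mono E u" "act u ` el U \<subseteq> {}"
    and facU: "\<forall>Y. \<forall>f \<in> hom E Y T. act f ` el Y \<subseteq> {} \<longrightarrow> (\<exists>h \<in> hom E Y U. u \<cdot> h = f)"
    using sub_of[OF TO empty_subsetI] by (elim exE conjE)
  obtain c where c: "c \<in> hom E C U"
    using terminal_map[OF T C(1)] facU C(2) by blast
  obtain V v where v: "v \<in> hom E V T" "is_mono E v" and compl: "sub_complement E T u v"
    using complement_ex[OF u(1,2)] by blast
  obtain W w where w: "w \<in> hom E W T" "is_mono E w"
    and facW: "\<forall>T. \<forall>a \<in> hom E T U. \<forall>b \<in> hom E T V. u \<cdot> a = v \<cdot> b \<longrightarrow> (\<exists>h \<in> hom E T W. w \<cdot> h = u \<cdot> a)"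
    and least: "\<forall>L. \<forall>l \<in> hom E L T. is_mono E l \<longrightarrow> (\<exists>h \<in> hom E W L. l \<cdot> h = w)"
    using meet_least[OF compl u(1,2) v] by (elim exE conjE) (rule that)
  \<comment> \<open>The equalizer of \<open>s \<cdot> w\<close> and \<open>t \<cdot> w\<close> is
    again a subobject of \<open>T\<close>, so the least subobject \<open>W\<close> factors through
    it.\<close>
  have sw: "s \<cdot> w = t \<cdot> w"
  proof -
    obtain K k where k: "k \<in> hom E K W" "is_mono E k" "(s \<cdot> w) \<cdot> k = (t \<cdot> w) \<cdot> k"
      using equalizer_ex[OF comp_hom[OF w(1) s] comp_hom[OF w(1) t]] by blast
    obtain r where r: "r \<in> hom E W K" "w \<cdot> k \<cdot> r = w"
      using least comp_hom[OF k(1) w(1)] mono_comp[OF k(1) w(1) k(2) w(2)] by blast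
    have "x \<cdot> w = (x \<cdot> w) \<cdot> k \<cdot> r" if x: "x \<in> hom E T D" for x
      using assoc[OF k(1) w(1) x] assoc[OF r(1) comp_hom[OF k(1) w(1)] x] r(2) by simp
    then show ?thesis using s t k(3) by metis
  qed
  have mixed: "t \<cdot> u \<cdot> a = s \<cdot> v \<cdot> b"
    if a: "a \<in> hom E T' U" and b: "b \<in> hom E T' V" and eq: "u \<cdot> a = v \<cdot> b" for T' a b
  proof -
    obtain h where h: "h \<in> hom E T' W" "w \<cdot> h = u \<cdot> a" using facW a b eq by blast
    have "t \<cdot> u \<cdot> a = (t \<cdot> w) \<cdot> h"
      using assoc[OF a u(1) t] assoc[OF h(1) w(1) t] h(2) by simp
    also have "\<dots> = s \<cdot> v \<cdot> b"
      using assoc[OF b v(1) s] assoc[OF h(1) w(1) s] h(2) eq sw by simp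
    finally show ?thesis .
  qed
  \<comment> \<open>Prescribing \<open>t\<close> on \<open>U\<close> and \<open>s\<close> on
    \<open>V\<close> is consistent, since the overlap factors through \<open>W\<close>, where the
    two points agree.\<close>
  have "compatible_family E T D {(u, t \<cdot> u), (v, s \<cdot> v)}"
    unfolding compatible_family_def
  proof (intro conjI)
    have d: "Dom E u = U" "Dom E v = V" using homD(2)[OF u(1)] homD(2)[OF v(1)] .
    show "\<forall>(m, x) \<in> {(u, t \<cdot> u), (v, s \<cdot> v)}. m \<in> hom E (Dom E m) T \<and> x \<in> hom E (Dom E m) D"
      using u(1) v(1) comp_hom[OF u(1) t] comp_hom[OF v(1) s] by (simp add: d)
    have uu: "a = b" if "a \<in> hom E T' U" "b \<in> hom E T' U" "u \<cdot> a = u \<cdot> b" for T' a b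
      using monoD[OF u(2,1) that] .
    have vv: "a = b" if "a \<in> hom E T' V" "b \<in> hom E T' V" "v \<cdot> a = v \<cdot> b" for T' a b
      using monoD[OF v(2,1) that] .
    show "\<forall>(m, x) \<in> {(u, t \<cdot> u), (v, s \<cdot> v)}. \<forall>(m', x') \<in> {(u, t \<cdot> u), (v, s \<cdot> v)}.
        \<forall>T. \<forall>a \<in> hom E T (Dom E m). \<forall>b \<in> hom E T (Dom E m'). m \<cdot> a = m' \<cdot> b \<longrightarrow> x \<cdot> a = x' \<cdot> b"
    proof (intro ballI, clarify)
      fix m x m' x' T' a b
      assume mx: "(m, x) \<in> {(u, t \<cdot> u), (v, s \<cdot> v)}" "(m', x') \<in> {(u, t \<cdot> u), (v, s \<cdot> v)}"
        and ab: "a \<in> hom E T' (Dom E m)" "b \<in> hom E T' (Dom E m')" and eq: "m \<cdot> a = m' \<cdot> b"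
      consider "m = u" "x = t \<cdot> u" "m' = u" "x' = t \<cdot> u" | "m = u" "x = t \<cdot> u" "m' = v" "x' = s \<cdot> v"
        | "m = v" "x = s \<cdot> v" "m' = u" "x' = t \<cdot> u" | "m = v" "x = s \<cdot> v" "m' = v" "x' = s \<cdot> v"
        using mx by auto
      then show "x \<cdot> a = x' \<cdot> b"
      proof cases
        case 1
        then show ?thesis using uu[of a T' b] ab eq d by simp
      next
        case 2
        then show ?thesis using mixed[of a T' b] ab eq d by simp
      next
        case 3
        then show ?thesis using mixed[of b T' a] ab eq d by simp
      next
        case 4
        then show ?thesis using vv[of a T' b] ab eq d by simp
      qed
    qed
  qed
  then have "extends_to_subobject E T D {(u, t \<cdot> u), (v, s \<cdot> v)}"
    using unions TO DO unfolding has_effective_unions_def by blast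
  then obtain K k z where k: "k \<in> hom E K T" "is_mono E k" and z: "z \<in> hom E K D"
    and "\<exists>h \<in> hom E (Dom E u) K. k \<cdot> h = u \<and> z \<cdot> h = t \<cdot> u"
    and "\<exists>h \<in> hom E (Dom E v) K. k \<cdot> h = v \<and> z \<cdot> h = s \<cdot> v"
    unfolding extends_to_subobject_def by auto
  then obtain h h' where h: "h \<in> hom E U K" "k \<cdot> h = u" "z \<cdot> h = t \<cdot> u"
    and h': "h' \<in> hom E V K" "k \<cdot> h' = v" "z \<cdot> h' = s \<cdot> v"
    using homD(2)[OF u(1)] homD(2)[OF v(1)] by auto
  \<comment> \<open>\<open>K\<close> contains both members of the complemented pair, so
    \<open>k\<close> has a section, and \<open>z \<cdot> r\<close> is a global point of
    \<open>D\<close>.\<close>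
  obtain r where r: "r \<in> hom E T K" "k \<cdot> r = Id E T" using complement_upper[OF compl u(1) v(1) k h(1,2) h'(1,2)] by blast
  have glue: "z \<cdot> r \<cdot> y = z \<cdot> x" if x: "x \<in> hom E Y K" "k \<cdot> x = y" for x y Y
  proof -
    have "k \<cdot> (r \<cdot> y) = k \<cdot> x"
      using assoc[OF comp_hom[OF x(1) k(1)] r(1) k(1)] x(2) r(2) id_left[OF comp_hom[OF x(1) k(1)]] by simp
    then have "r \<cdot> y = x"
      using monoD[OF k(2,1) comp_hom[OF comp_hom[OF x(1) k(1)] r(1)] x(1)] x(2) by simp
    then show ?thesis using assoc[OF comp_hom[OF x(1) k(1)] r(1) z] x(2) by simp
  qed
  have zr: "z \<cdot> r \<in> hom E T D" using comp_hom[OF r(1) z] .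
  have zu: "z \<cdot> r \<cdot> u = t \<cdot> u" and zv: "z \<cdot> r \<cdot> v = s \<cdot> v"
    using glue[OF h(1,2)] glue[OF h'(1,2)] h(3) h'(3) by simp_all
  \<comment> \<open>The single element of the fibre of \<open>T\<close> lies in \<open>V\<close>,
    because the fibre of \<open>U\<close> is empty. There the glued point acts as \<open>s\<close>,
    so of the two global points it can only be \<open>s\<close>; on \<open>U\<close>, however, it
    was prescribed to be \<open>t\<close>.\<close>
  obtain x where x: "x \<in> el T" using el_terminal[OF T] by blast
  then have "x \<in> act v ` el V"
    using el_complement(2)[OF compl u(1,2) v] u(3) by simp
  then obtain e where e: "e \<in> el V" "act v e = x" by auto
  have "act (z \<cdot> r) x = act s x"
    using act_comp[OF v(1) zr e(1)] act_comp[OF v(1) s e(1)] zv e(2) by simp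
  then have "z \<cdot> r \<noteq> t" using ne x by auto
  then have "z \<cdot> r = s" using st zr by blast
  then have "s \<cdot> u = t \<cdot> u" using zu by simp
  then obtain Z where "is_initial E Z" "hom E U Z \<noteq> {}" using eq_ini u(1) by blast
  then show ?thesis using initial_strict comp_hom[OF c] by blast
qed

section \<open>Reflection of isomorphisms and arrows defined on fibres\<close>

text \<open>The complement has an empty fibre, hence is initial and lies below \<open>m\<close>. So
  \<open>m\<close> is an upper bound of itself and its complement, which gives it a section.\<close>

lemma iso_of_mono_surj:
  assumes m: "m \<in> hom E M X" "is_mono E m" and surj: "act m ` el M = el X"
  shows "is_iso E m"
proof -
  obtain N n where n: "n \<in> hom E N X" "is_mono E n" and c: "sub_complement E X m n"
    using complement_ex[OF m] by blast
  have "el N = {}"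
    using el_complement(1)[OF c m n] surj act_in[OF n(1)] by blast
  then have N: "is_initial E N" using initial_of_el_empty hom_obj(1)[OF n(1)] by blast
  obtain j where j: "j \<in> hom E N M" using initial_map[OF N hom_obj(1)[OF m(1)]] by blast
  have mj: "m \<cdot> j = n" using initial_uniq[OF N comp_hom[OF j m(1)] n(1)] .
  obtain h where "h \<in> hom E X M" "m \<cdot> h = Id E X"
    using complement_upper[OF c m(1) n(1) m id_hom[OF hom_obj(1)[OF m(1)]] id_right[OF m(1)] j mj]
    by blast
  then show ?thesis using iso_of_split_mono[OF m] by blast
qed

text \<open>The equalizer of two arrows that agree on fibres is surjective on fibres, hence an
  isomorphism.\<close>

lemma faithful:
  assumes f: "f \<in> hom E X Y" and g: "g \<in> hom E X Y" and eq: "\<And>x. x \<in> el X \<Longrightarrow> act f x = act g x"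
  shows "f = g"
proof -
  obtain K k where k: "k \<in> hom E K X" "is_mono E k" "f \<cdot> k = g \<cdot> k"
    "act k ` el K = {x \<in> el X. act f x = act g x}"
    using equalizer_ex[OF f g] by blast
  have "is_iso E k" using iso_of_mono_surj[OF k(1,2)] k(4) eq by blast
  then obtain j where j: "j \<in> hom E X K" "k \<cdot> j = Id E X" using isoE[OF _ k(1)] by metis
  then show ?thesis
    using assoc[OF j(1) k(1) f] assoc[OF j(1) k(1) g] k(3) id_right[OF f] id_right[OF g] by simp
qed

lemma mono_of_inj:
  assumes f: "f \<in> hom E X Y" and inj: "inj_on (act f) (el X)"
  shows "is_mono E f"
proof (rule monoI[OF f])
  fix T u v assume u: "u \<in> hom E T X" and v: "v \<in> hom E T X" and eq: "f \<cdot> u = f \<cdot> v"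
  show "u = v"
  proof (rule faithful[OF u v])
    fix x assume x: "x \<in> el T"
    have "act f (act u x) = act f (act v x)" using act_comp[OF u f x] act_comp[OF v f x] eq by simp
    then show "act u x = act v x" using inj_onD[OF inj] act_in[OF u x] act_in[OF v x] by blast
  qed
qed

lemma iso_of_bij:
  assumes f: "f \<in> hom E X Y" and bij: "bij_betw (act f) (el X) (el Y)"
  shows "is_iso E f"
  using iso_of_mono_surj[OF f mono_of_inj[OF f]] bij by (simp add: bij_betw_def)

text \<open>In the product, \<open>K\<close> is the largest subobject whose fibre lies in the graph
  of \<phi>. Its projection to \<open>X\<close> is injective on fibres because a graph is single
  valued, and surjective because every local representation \<open>(m, u)\<close> factors through
  \<open>K\<close>. So the projection is an isomorphism, and its inverse followed by the other
  projection is the arrow sought.\<close>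

lemma map_of_graph:
  assumes X: "X \<in> Obj E" and Z: "Z \<in> Obj E"
    and loc: "\<And>x. x \<in> el X \<Longrightarrow> \<exists>M m u. m \<in> hom E M X \<and> u \<in> hom E M Z \<and> x \<in> act m ` el M \<and>
      (\<forall>y \<in> el M. \<phi> (act m y) = act u y)"
  shows "\<exists>w \<in> hom E X Z. \<forall>x \<in> el X. act w x = \<phi> x"
proof -
  obtain P p q where p: "p \<in> hom E P X" and q: "q \<in> hom E P Z"
    and univ: "\<forall>T. \<forall>f \<in> hom E T X. \<forall>g \<in> hom E T Z. \<exists>!h. h \<in> hom E T P \<and> p \<cdot> h = f \<and> q \<cdot> h = g"
    and el: "\<forall>x \<in> el X. \<forall>y \<in> el Z. \<exists>!e. e \<in> el P \<and> act p e = x \<and> act q e = y"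
    using product_ex[OF X Z] by (elim exE conjE)
  define T where "T = {e \<in> el P. act q e = \<phi> (act p e)}"
  have "T \<subseteq> el P" by (auto simp: T_def)
  from sub_of[OF hom_obj(1)[OF p] this] obtain K k
    where k: "k \<in> hom E K P" "is_mono E k" "act k ` el K \<subseteq> T"
      and fac: "\<forall>Y. \<forall>f \<in> hom E Y P. act f ` el Y \<subseteq> T \<longrightarrow> (\<exists>h \<in> hom E Y K. k \<cdot> h = f)"
    by (elim exE conjE)
  have kT: "act k e \<in> el P" "act q (act k e) = \<phi> (act p (act k e))" if "e \<in> el K" for e
    using k(3) that by (auto simp: T_def)
  note pk = comp_hom[OF k(1) p]
  have "inj_on (act (p \<cdot> k)) (el K)"
  proof (rule inj_onI)
    fix e e' assume e: "e \<in> el K" and e': "e' \<in> el K" and eq: "act (p \<cdot> k) e = act (p \<cdot> k) e'"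
    have pp: "act p (act k e) = act p (act k e')"
      using eq act_comp[OF k(1) p e] act_comp[OF k(1) p e'] by simp
    then have "act q (act k e) = act q (act k e')" using kT e e' by simp
    then have "act k e = act k e'"
      using el[rule_format, OF act_in[OF p kT(1)[OF e]] act_in[OF q kT(1)[OF e]]] pp kT(1)[OF e] kT(1)[OF e'] by metis
    then show "e = e'" using inj_onD[OF mono_inj[OF k(1,2)]] e e' by blast
  qed
  moreover have "act (p \<cdot> k) ` el K = el X"
  proof (intro equalityI subsetI)
    fix x assume "x \<in> el X"
    then obtain M m u y where m: "m \<in> hom E M X" and u: "u \<in> hom E M Z" and y: "y \<in> el M" "x = act m y"
      and \<phi>: "\<And>y. y \<in> el M \<Longrightarrow> \<phi> (act m y) = act u y"
      using loc by blast
    obtain r where r: "r \<in> hom E M P" "p \<cdot> r = m" "q \<cdot> r = u" using univ m u by blast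
    have pr: "act p (act r y) = act m y" "act q (act r y) = act u y" if "y \<in> el M" for y
      using act_comp[OF r(1) p that] act_comp[OF r(1) q that] r by simp_all
    have "act r ` el M \<subseteq> T" using pr \<phi> act_in[OF r(1)] by (auto simp: T_def)
    then obtain h where h: "h \<in> hom E M K" "k \<cdot> h = r" using fac r(1) by blast
    have "act (p \<cdot> k) (act h y) = x"
      using act_comp[OF k(1) p act_in[OF h(1) y(1)]] act_comp[OF h(1) k(1) y(1)] h(2) pr[OF y(1)] y(2)
      by simp
    then show "x \<in> act (p \<cdot> k) ` el K" using act_in[OF h(1) y(1)] by blast
  qed (use act_in[OF pk] in blast)
  ultimately have "is_iso E (p \<cdot> k)" using iso_of_bij[OF pk] by (simp add: bij_betw_def)
  then obtain j where j: "j \<in> hom E X K" "p \<cdot> k \<cdot> j = Id E X" using isoE[OF _ pk] by metis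
  note qk = comp_hom[OF k(1) q]
  have "act (q \<cdot> k \<cdot> j) x = \<phi> x" if x: "x \<in> el X" for x
  proof -
    note jx = act_in[OF j(1) x]
    have "act (q \<cdot> k \<cdot> j) x = \<phi> (act p (act k (act j x)))"
      using act_comp[OF j(1) qk x] act_comp[OF k(1) q jx] kT(2)[OF jx] by simp
    also have "act p (act k (act j x)) = x"
      using act_comp[OF j(1) pk x] act_comp[OF k(1) p jx] j(2) act_id[OF X x] by simp
    finally show ?thesis .
  qed
  then show ?thesis using comp_hom[OF j(1) qk] by blast
qed

section \<open>Coproduct decompositions, images and connected objects\<close>

text \<open>The copairing is defined on fibres, and each of the two pairs \<open>(m, f)\<close> and
  \<open>(n, g)\<close> is a local representation of it. This turns complements into the
  decompositions that connectedness speaks about.\<close>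

lemma coproduct_of_complement:
  assumes m: "m \<in> hom E M X" "inj_on (act m) (el M)" and n: "n \<in> hom E N X" "inj_on (act n) (el N)"
    and disj: "act m ` el M \<inter> act n ` el N = {}" and un: "act m ` el M \<union> act n ` el N = el X"
  shows "is_binary_coproduct E M N X m n"
proof -
  have X: "X \<in> Obj E" using hom_obj(2)[OF m(1)] .
  have "\<exists>!h. h \<in> hom E X T \<and> h \<cdot> m = f \<and> h \<cdot> n = g"
    if T: "T \<in> Obj E" and f: "f \<in> hom E M T" and g: "g \<in> hom E N T" for T f g
  proof -
    define \<phi> where "\<phi> x = (if x \<in> act m ` el M then act f (inv_into (el M) (act m) x)
      else act g (inv_into (el N) (act n) x))" for x
    have \<phi>m: "\<phi> (act m y) = act f y" if "y \<in> el M" for y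
      using that m(2) by (simp add: \<phi>_def)
    have \<phi>n: "\<phi> (act n y) = act g y" if y: "y \<in> el N" for y
    proof -
      have "act n y \<notin> act m ` el M" using disj y by blast
      then show ?thesis using y n(2) by (simp add: \<phi>_def)
    qed
    have "\<exists>w \<in> hom E X T. \<forall>x \<in> el X. act w x = \<phi> x"
    proof (rule map_of_graph[OF X T])
      fix x assume "x \<in> el X"
      then consider "x \<in> act m ` el M" | "x \<in> act n ` el N" using un by blast
      then show "\<exists>M m u. m \<in> hom E M X \<and> u \<in> hom E M T \<and> x \<in> act m ` el M \<and>
          (\<forall>y \<in> el M. \<phi> (act m y) = act u y)"
        using m(1) n(1) f g \<phi>m \<phi>n by cases blast+
    qed
    then obtain w where w: "w \<in> hom E X T" and ww: "\<And>x. x \<in> el X \<Longrightarrow> act w x = \<phi> x" by blast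
    have "w \<cdot> m = f"
      by (rule faithful[OF comp_hom[OF m(1) w] f])
        (simp add: act_comp[OF m(1) w] ww act_in[OF m(1)] \<phi>m)
    moreover have "w \<cdot> n = g"
      by (rule faithful[OF comp_hom[OF n(1) w] g])
        (simp add: act_comp[OF n(1) w] ww act_in[OF n(1)] \<phi>n)
    moreover have "h = w" if h: "h \<in> hom E X T" "h \<cdot> m = f" "h \<cdot> n = g" for h
    proof (rule faithful[OF h(1) w])
      fix x assume x: "x \<in> el X"
      then consider y where "y \<in> el M" "x = act m y" | y where "y \<in> el N" "x = act n y"
        using un by blast
      then show "act h x = act w x"
      proof cases
        case 1
        then show ?thesis using act_comp[OF m(1) h(1)] ww[OF x] \<phi>m h(2) by metis
      next
        case 2
        then show ?thesis using act_comp[OF n(1) h(1)] ww[OF x] \<phi>n h(3) by metis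
      qed
    qed
    ultimately show ?thesis using w by blast
  qed
  then show ?thesis
    unfolding is_binary_coproduct_iff using X m(1) n(1) by simp
qed

text \<open>For the covering, the largest subobject with fibre inside the union of the two images
  receives both injections, so the coproduct property gives it a section. For disjointness, the
  arrow \<open>X\<close> -> \<open>D\<close> that is \<open>s\<close> on \<open>A\<close> and
  \<open>t\<close> on \<open>B\<close> separates the images, as \<open>s\<close> and
  \<open>t\<close> differ on the fibre of \<open>T\<close>.\<close>

lemma coproduct_cover:
  assumes cop: "is_binary_coproduct E A B X i j"
  shows "i \<in> hom E A X" "j \<in> hom E B X"
    and "act i ` el A \<union> act j ` el B = el X" "act i ` el A \<inter> act j ` el B = {}"
proof -
  have X: "X \<in> Obj E" and i: "i \<in> hom E A X" and j: "j \<in> hom E B X"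
    and univ': "\<forall>T \<in> Obj E. \<forall>f \<in> hom E A T. \<forall>g \<in> hom E B T.
      \<exists>!h. h \<in> hom E X T \<and> h \<cdot> i = f \<and> h \<cdot> j = g"
    using cop unfolding is_binary_coproduct_iff by simp_all
  have univ: "\<exists>!h. h \<in> hom E X T \<and> h \<cdot> i = f \<and> h \<cdot> j = g"
    if "f \<in> hom E A T" "g \<in> hom E B T" for T f g
    using univ' that hom_obj(2)[OF that(1)] by simp
  show "i \<in> hom E A X" "j \<in> hom E B X" by fact+
  define T where "T = act i ` el A \<union> act j ` el B"
  have iT: "act i ` el A \<subseteq> T" and jT: "act j ` el B \<subseteq> T" by (simp_all add: T_def)
  have T: "T \<subseteq> el X" unfolding T_def using act_in[OF i] act_in[OF j] by blast
  obtain K k where k: "k \<in> hom E K X" "is_mono E k" "act k ` el K \<subseteq> T"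
    and fac: "\<forall>Y. \<forall>f \<in> hom E Y X. act f ` el Y \<subseteq> T \<longrightarrow> (\<exists>h \<in> hom E Y K. k \<cdot> h = f)"
    using sub_of[OF X T] by (elim exE conjE)
  obtain i' where i': "i' \<in> hom E A K" "k \<cdot> i' = i" using fac i iT by blast
  obtain j' where j': "j' \<in> hom E B K" "k \<cdot> j' = j" using fac j jT by blast
  obtain h where h: "h \<in> hom E X K" "h \<cdot> i = i'" "h \<cdot> j = j'" using univ[OF i'(1) j'(1)] by blast
  have "k \<cdot> h = Id E X"
    using univ[OF i j] comp_hom[OF h(1) k(1)] id_hom[OF X] assoc[OF i h(1) k(1)] assoc[OF j h(1) k(1)]
      h i' j' id_left[OF i] id_left[OF j] by metis
  then have "x \<in> T" if x: "x \<in> el X" for x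
    using act_comp[OF h(1) k(1) x] act_id[OF X x] k(3) act_in[OF h(1) x] by auto
  then show "act i ` el A \<union> act j ` el B = el X" using T unfolding T_def by blast
  show "act i ` el A \<inter> act j ` el B = {}"
  proof (rule ccontr)
    assume "act i ` el A \<inter> act j ` el B \<noteq> {}"
    then obtain a b where a: "a \<in> el A" and b: "b \<in> el B" and ab: "act i a = act j b" by force
    obtain T D s t where T: "is_terminal E T" and s: "s \<in> hom E T D" and t: "t \<in> hom E T D"
      and ne: "\<forall>x \<in> el T. act s x \<noteq> act t x"
      using two_points by (elim exE conjE) (rule that)
    obtain f g where f: "f \<in> hom E A T" and g: "g \<in> hom E B T"
      using terminal_map[OF T] hom_obj(1)[OF i] hom_obj(1)[OF j] by blast
    obtain h where h: "h \<in> hom E X D" "h \<cdot> i = s \<cdot> f" "h \<cdot> j = t \<cdot> g"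
      using univ[OF comp_hom[OF f s] comp_hom[OF g t]] by blast
    have "act s (act f a) = act t (act g b)"
      using act_comp[OF i h(1) a] act_comp[OF j h(1) b] act_comp[OF f s a] act_comp[OF g t b] h(2,3) ab
      by simp
    moreover have "act f a = act g b"
      using el_terminal[OF T] act_in[OF f a] act_in[OF g b] by blast
    ultimately show False using ne act_in[OF g b] by simp
  qed
qed

text \<open>The image is taken to be the largest subobject whose fibre lies in the set of values of
  \<open>f\<close>: as \<open>f\<close> factors through it, its fibre is no smaller than that
  set.\<close>

lemma image_ex:
  assumes f: "f \<in> hom E A X"
  shows "\<exists>K k h. k \<in> hom E K X \<and> is_mono E k \<and> act k ` el K = act f ` el A \<and> h \<in> hom E A K \<and> k \<cdot> h = f"
proof -
  have "act f ` el A \<subseteq> el X" using act_in[OF f] by blast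
  from sub_of[OF hom_obj(2)[OF f] this] obtain K k
    where k: "k \<in> hom E K X" "is_mono E k" "act k ` el K \<subseteq> act f ` el A"
      and fac: "\<forall>Y. \<forall>g \<in> hom E Y X. act g ` el Y \<subseteq> act f ` el A \<longrightarrow> (\<exists>h \<in> hom E Y K. k \<cdot> h = g)"
    by (elim exE conjE)
  obtain h where h: "h \<in> hom E A K" "k \<cdot> h = f" using fac f by blast
  have "act f ` el A \<subseteq> act k ` el K"
    using act_comp[OF h(1) k(1)] act_in[OF h(1)] h(2) by force
  then show ?thesis using k h by blast
qed

text \<open>The image and its complement decompose \<open>X\<close>. The image has an element, so it
  is not initial and the complement must be.\<close>

lemma surj_onto_connected:
  assumes X: "connected_object E X" and f: "f \<in> hom E A X" and ne: "el A \<noteq> {}"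
  shows "act f ` el A = el X"
proof -
  obtain K k h where k: "k \<in> hom E K X" "is_mono E k" and im: "act k ` el K = act f ` el A"
    using image_ex[OF f] by blast
  obtain N n where n: "n \<in> hom E N X" "is_mono E n" and c: "sub_complement E X k n"
    using complement_ex[OF k] by blast
  note kn = el_complement[OF c k n]
  have "is_binary_coproduct E K N X k n"
    using coproduct_of_complement[OF k(1) mono_inj[OF k] n(1) mono_inj[OF n] kn] .
  then have "is_initial E K \<or> is_initial E N" using X unfolding connected_object_def by blast
  then have "el N = {}" using el_initial im ne by auto
  then show ?thesis using kn(2) im by simp
qed

lemma epi_of_surj:
  assumes f: "f \<in> hom E A X" and surj: "act f ` el A = el X"
    and g: "g \<in> hom E X Z" and h: "h \<in> hom E X Z" and eq: "g \<cdot> f = h \<cdot> f"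
  shows "g = h"
proof (rule faithful[OF g h])
  fix x assume "x \<in> el X"
  then obtain a where a: "a \<in> el A" "x = act f a" using surj by blast
  then show "act g x = act h x" using act_comp[OF f g a(1)] act_comp[OF f h a(1)] eq by simp
qed

text \<open>The kernel pair of \<open>f\<close> is an admissible test pair, so \<open>g\<close>
  identifies all elements that \<open>f\<close> identifies. Hence \<open>g\<close> induces a
  function on \<open>el X\<close>, which \<open>map_of_graph\<close> lifts with the single local
  representation \<open>(f, g)\<close>.\<close>

lemma strict_epi_of_surj:
  assumes f: "f \<in> hom E A X" and surj: "act f ` el A = el X"
  shows "is_strict_epi E f"
proof -
  have X: "X \<in> Obj E" using hom_obj(2)[OF f] .
  have main: "\<exists>!h. h \<in> hom E X Z \<and> h \<cdot> f = g"
    if g: "g \<in> hom E A Z"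
      and coeq: "\<forall>T \<in> Obj E. \<forall>u \<in> hom E T A. \<forall>v \<in> hom E T A. f \<cdot> u = f \<cdot> v \<longrightarrow> g \<cdot> u = g \<cdot> v" for Z g
  proof -
    have g_eq: "act g a = act g b" if a: "a \<in> el A" and b: "b \<in> el A" and ab: "act f a = act f b" for a b
    proof -
      obtain P p q where p: "p \<in> hom E P A" and q: "q \<in> hom E P A" and sq: "f \<cdot> p = f \<cdot> q"
        and e: "\<forall>x \<in> el A. \<forall>y \<in> el A. act f x = act f y \<longrightarrow> (\<exists>!e. e \<in> el P \<and> act p e = x \<and> act q e = y)"
        using pullback_ex[OF f f] by (elim exE conjE) (rule that)
      obtain e where e: "e \<in> el P" "act p e = a" "act q e = b" using e a b ab by blast
      have "g \<cdot> p = g \<cdot> q" using coeq hom_obj(1)[OF p] p q sq by blast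
      then show ?thesis using act_comp[OF p g e(1)] act_comp[OF q g e(1)] e(2,3) by simp
    qed
    define \<phi> where "\<phi> x = act g (inv_into (el A) (act f) x)" for x
    have \<phi>: "\<phi> (act f a) = act g a" if "a \<in> el A" for a
      unfolding \<phi>_def using that by (intro g_eq) (auto intro: inv_into_into f_inv_into_f)
    have "\<exists>w \<in> hom E X Z. \<forall>x \<in> el X. act w x = \<phi> x"
      by (rule map_of_graph[OF X hom_obj(2)[OF g]]) (use f g surj \<phi> in blast)
    then obtain w where w: "w \<in> hom E X Z" and ww: "\<And>x. x \<in> el X \<Longrightarrow> act w x = \<phi> x" by blast
    have wf: "w \<cdot> f = g"
      by (rule faithful[OF comp_hom[OF f w] g]) (simp add: act_comp[OF f w] ww act_in[OF f] \<phi>)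
    show ?thesis
    proof (rule ex1I[of _ w])
      show "h = w" if "h \<in> hom E X Z \<and> h \<cdot> f = g" for h
        using epi_of_surj[OF f surj _ w] that wf by simp
    qed (use w wf in simp)
  qed
  show ?thesis
    unfolding is_strict_epi_def homD(2,3)[OF f]
    by (intro conjI ballI impI; (rule homD(1)[OF f] | rule main; assumption))
qed

section \<open>Objects generated by an element of their fibre\<close>

text \<open>A form of connectedness relative to \<open>a\<close>, and it implies connectedness. It
  suits minimality arguments at \<open>a\<close>: an equalizer or a pulled-back subobject whose
  fibre contains \<open>a\<close> is everything.\<close>

definition generated_by :: "'o \<Rightarrow> 'u \<Rightarrow> bool" where
  "generated_by A a \<longleftrightarrow> A \<in> Obj E \<and> a \<in> el A \<and>
    (\<forall>K. \<forall>k \<in> hom E K A. is_mono E k \<and> a \<in> act k ` el K \<longrightarrow> act k ` el K = el A)"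

text \<open>The component is the complement of the largest subobject avoiding \<open>a\<close>; no infinite union of
  subobjects is needed.\<close>

lemma component_ex:
  assumes P: "P \<in> Obj E" and a: "a \<in> el P"
  shows "\<exists>A i b. i \<in> hom E A P \<and> is_mono E i \<and> generated_by A b \<and> act i b = a"
proof -
  obtain N n where n: "n \<in> hom E N P" "is_mono E n" "act n ` el N \<subseteq> el P - {a}"
    and fac: "\<forall>Y. \<forall>f \<in> hom E Y P. act f ` el Y \<subseteq> el P - {a} \<longrightarrow> (\<exists>h \<in> hom E Y N. n \<cdot> h = f)"
    using sub_of[OF P, of "el P - {a}"] by blast
  obtain A i where i: "i \<in> hom E A P" "is_mono E i" and c: "sub_complement E P n i"
    using complement_ex[OF n(1,2)] by blast
  note ni = el_complement[OF c n(1,2) i]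
  obtain b where b: "b \<in> el A" "act i b = a" using ni(2) n(3) a by blast
  \<comment> \<open>As \<open>k\<close> contains \<open>b\<close>, its complement \<open>l\<close>,
    seen in \<open>P\<close>, avoids \<open>a\<close> and so factors through \<open>N\<close>. But
    it also factors through \<open>A\<close>, whose image is disjoint from that of \<open>N\<close>;
    hence its fibre is empty.\<close>
  have "act k ` el K = el A" if k: "k \<in> hom E K A" "is_mono E k" and bk: "b \<in> act k ` el K" for K k
  proof -
    obtain L l where l: "l \<in> hom E L A" "is_mono E l" and cl: "sub_complement E A k l"
      using complement_ex[OF k] by blast
    note kl = el_complement[OF cl k l]
    note il = comp_hom[OF l(1) i(1)]
    have il_eq: "act (i \<cdot> l) x = act i (act l x)" if "x \<in> el L" for x
      using act_comp[OF l(1) i(1) that] .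
    have "act i (act l x) \<noteq> a" if x: "x \<in> el L" for x
    proof
      assume "act i (act l x) = a"
      then have "act l x = b" using inj_onD[OF mono_inj[OF i]] b act_in[OF l(1) x] by blast
      then show False using bk x kl(1) by blast
    qed
    then have "act (i \<cdot> l) ` el L \<subseteq> el P - {a}" using il_eq act_in[OF il] by auto
    then obtain h where h: "h \<in> hom E L N" "n \<cdot> h = i \<cdot> l" using fac il by blast
    have "el L = {}"
    proof (rule ccontr)
      assume "el L \<noteq> {}"
      then obtain x where x: "x \<in> el L" by blast
      have "act n (act h x) = act i (act l x)" using act_comp[OF h(1) n(1) x] h(2) il_eq[OF x] by simp
      then show False using ni(1) act_in[OF h(1) x] act_in[OF l(1) x] by blast
    qed
    then show ?thesis using kl(2) by simp
  qed
  then have "generated_by A b" unfolding generated_by_def using b(1) hom_obj(1)[OF i(1)] by blast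
  then show ?thesis using i b(2) by blast
qed

context
  fixes A a assumes gen: "generated_by A a"
begin

lemma generator: "a \<in> el A" "A \<in> Obj E"
  using gen by (simp_all add: generated_by_def)

lemma generated_surj: "k \<in> hom E K A \<Longrightarrow> is_mono E k \<Longrightarrow> a \<in> act k ` el K \<Longrightarrow> act k ` el K = el A"
  using gen unfolding generated_by_def by blast

text \<open>One of the two summands contains \<open>a\<close> in its image, which is therefore
  everything; the other has an empty fibre and is initial.\<close>

lemma generated_nonempty_connected: "nonempty_connected E A"
proof -
  have empty: "el C = {}"
    if cov: "i \<in> hom E B A" "act i ` el B \<inter> act j ` el C = {}" "j \<in> hom E C A" "a \<in> act i ` el B" for B C i j
  proof -
    obtain K k h where k: "k \<in> hom E K A" "is_mono E k" "act k ` el K = act i ` el B"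
      using image_ex[OF cov(1)] by blast
    then have "act i ` el B = el A" using generated_surj cov(4) by simp
    then show ?thesis using cov(2) act_in[OF cov(3)] by blast
  qed
  have "is_initial E B \<or> is_initial E C" if cop: "is_binary_coproduct E B C A i j" for B C i j
  proof -
    note c = coproduct_cover[OF cop]
    consider "a \<in> act i ` el B" | "a \<in> act j ` el C" using c(3) generator(1) by blast
    then show ?thesis
    proof cases
      case 1
      then show ?thesis using empty[OF c(1) c(4) c(2)] initial_of_el_empty hom_obj(1)[OF c(2)] by blast
    next
      case 2
      have "act j ` el C \<inter> act i ` el B = {}" using c(4) by blast
      then show ?thesis using empty[OF c(2) _ c(1) 2] initial_of_el_empty hom_obj(1)[OF c(1)] by blast
    qed
  qed
  moreover have "\<not> is_initial E A" using el_initial generator(1) by blast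
  ultimately show ?thesis
    unfolding nonempty_connected_def connected_object_def using generator(2) by blast
qed

text \<open>The equalizer of \<open>f\<close> and \<open>g\<close> contains \<open>a\<close>, hence
  has the full fibre, and its inclusion can be cancelled.\<close>

lemma generated_hom_eq:
  assumes f: "f \<in> hom E A X" and g: "g \<in> hom E A X" and eq: "act f a = act g a"
  shows "f = g"
proof -
  obtain K k where k: "k \<in> hom E K A" "is_mono E k" "f \<cdot> k = g \<cdot> k"
    "act k ` el K = {x \<in> el A. act f x = act g x}"
    using equalizer_ex[OF f g] by blast
  have "act k ` el K = el A" using generated_surj[OF k(1,2)] k(4) generator(1) eq by blast
  then show ?thesis using epi_of_surj[OF k(1) _ f g k(3)] by blast
qed

text \<open>The pullback of \<open>i\<close> along \<open>h\<close> is a subobject of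
  \<open>A\<close> containing \<open>a\<close>, so it is all of \<open>A\<close>. One element thus
  decides whether an arrow out of \<open>A\<close> factors through a subobject.\<close>

lemma generated_lift:
  assumes i: "i \<in> hom E B P" "is_mono E i" and h: "h \<in> hom E A P" and ha: "act h a \<in> act i ` el B"
  shows "\<exists>h' \<in> hom E A B. i \<cdot> h' = h"
proof -
  obtain K k q where pb: "is_pullback E h i K k q" and k: "k \<in> hom E K A" and q: "q \<in> hom E K B"
    and sq: "h \<cdot> k = i \<cdot> q"
    and e: "\<forall>x \<in> el A. \<forall>y \<in> el B. act h x = act i y \<longrightarrow> (\<exists>!e. e \<in> el K \<and> act k e = x \<and> act q e = y)"
    using pullback_ex[OF h i(1)] by (elim exE conjE) (rule that)
  note mono = pullback_mono[OF pb h i]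
  have "a \<in> act k ` el K" using e ha generator(1) by blast
  then have "act k ` el K = el A" using generated_surj[OF k mono] by blast
  then obtain j where j: "j \<in> hom E A K" "k \<cdot> j = Id E A"
    using isoE[OF iso_of_mono_surj[OF k mono] k] by blast
  have "i \<cdot> (q \<cdot> j) = h"
    using assoc[OF j(1) q i(1)] assoc[OF j(1) k h] sq j(2) id_right[OF h] by simp
  then show ?thesis using comp_hom[OF j(1) q] by blast
qed

text \<open>A right inverse of \<open>h\<close> is found by choosing \<open>c\<close> over
  \<open>a\<close> and an endomorphism sending \<open>a\<close> to \<open>c\<close>; the composite
  fixes \<open>a\<close>, so it is the identity. A monoid in which every element has a right inverse
  is a group.\<close>

lemma endo_iso:
  assumes endo: "\<And>b. b \<in> el A \<Longrightarrow> \<exists>h \<in> hom E A A. act h a = b" and h: "h \<in> hom E A A"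
  shows "is_iso E h"
proof -
  have conn: "connected_object E A" using generated_nonempty_connected by (simp add: nonempty_connected_def)
  have rinv: "\<exists>g \<in> hom E A A. h \<cdot> g = Id E A" if h: "h \<in> hom E A A" for h
  proof -
    have "act h ` el A = el A" using surj_onto_connected[OF conn h] generator(1) by blast
    then obtain c where c: "c \<in> el A" "act h c = a" using generator(1) by force
    obtain g where g: "g \<in> hom E A A" "act g a = c" using endo[OF c(1)] by blast
    have "act (h \<cdot> g) a = act (Id E A) a"
      using act_comp[OF g(1) h generator(1)] g(2) c(2) act_id[OF generator(2,1)] by simp
    then show ?thesis
      using generated_hom_eq[OF comp_hom[OF g(1) h] id_hom[OF generator(2)]] g(1) by blast
  qed
  obtain g where g: "g \<in> hom E A A" "h \<cdot> g = Id E A" using rinv[OF h] by blast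
  obtain k where k: "k \<in> hom E A A" "g \<cdot> k = Id E A" using rinv[OF g(1)] by blast
  have "h = h \<cdot> (g \<cdot> k)" using k(2) id_right[OF h] by simp
  also have "\<dots> = k" using assoc[OF k(1) g(1) h] g(2) id_left[OF k(1)] by simp
  finally show ?thesis using isoI[OF h g(1)] g(2) k(2) by simp
qed

end

end

section \<open>Galois objects\<close>

text \<open>Constant objects enter through their fibres. The last assumption says that the fibre of
  the constant object on \<open>G\<close> is the disjoint union of the images of the fibres over the
  points of \<open>G\<close>. Each of those is a singleton, so the fibre is a copy of
  \<open>G\<close>.\<close>

locale pointed_boolean_topos = pointed_boolean_category E el act
  for E :: "('o, 'm) category_data" and el :: "'o \<Rightarrow> 'u set" and act :: "'m \<Rightarrow> 'u \<Rightarrow> 'u" +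
  fixes \<gamma> :: "('o, 'm, 'u set, 'u arrow) geometric_data"
  assumes el_small: "X \<in> Obj E \<Longrightarrow> el X \<prec> (UNIV :: 'u set)"
    and const_terminal: "is_terminal E (FO (inverse_image \<gamma>) {g})"
    and const_incl: "G \<prec> (UNIV :: 'u set) \<Longrightarrow> g \<in> G \<Longrightarrow>
      FA (inverse_image \<gamma>) (inclusion {g} G) \<in> hom E (FO (inverse_image \<gamma>) {g}) (FO (inverse_image \<gamma>) G)"
    and const_el: "G \<prec> (UNIV :: 'u set) \<Longrightarrow> e \<in> el (FO (inverse_image \<gamma>) G) \<Longrightarrow>
      \<exists>!g. g \<in> G \<and> e \<in> act (FA (inverse_image \<gamma>) (inclusion {g} G)) ` el (FO (inverse_image \<gamma>) {g})"
begin

lemma galois_of_generated: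
  assumes gen: "generated_by A a"
    and endo: "\<And>b. b \<in> el A \<Longrightarrow> \<exists>h \<in> hom E A A. act h a = b"
  shows "galois_object E \<gamma> A"
proof -
  note a = generator[OF gen]
  note idA = id_hom[OF a(2)]
  have conn: "connected_object E A"
    using generated_nonempty_connected[OF gen] by (simp add: nonempty_connected_def)
  \<comment> \<open>As \<open>a\<close> determines endomorphisms and every \<open>b\<close> is
    attained, \<open>el A\<close> itself is in bijection with the automorphisms of \<open>A\<close>;
    being a small set of elements of \<open>'u\<close>, it can be taken as their index set.\<close>
  define G where "G = el A"
  have small: "G \<prec> (UNIV :: 'u set)" unfolding G_def using el_small[OF a(2)] .
  define \<sigma> where "\<sigma> b = (SOME h. h \<in> hom E A A \<and> act h a = b)" for b
  have \<sigma>: "\<sigma> b \<in> hom E A A" "act (\<sigma> b) a = b" if "b \<in> G" for b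
    using someI_ex[of "\<lambda>h. h \<in> hom E A A \<and> act h a = b"] endo that unfolding \<sigma>_def G_def by blast+
  have \<sigma>_eq: "\<sigma> (act h a) = h" if h: "h \<in> hom E A A" for h
  proof -
    have "act h a \<in> G" unfolding G_def using act_in[OF h a(1)] .
    then show ?thesis using generated_hom_eq[OF gen \<sigma>(1) h] \<sigma>(2) by blast
  qed
  have \<sigma>_aut: "bij_betw \<sigma> G (automorphisms E A)"
    unfolding bij_betw_def
  proof (intro conjI equalityI subsetI)
    show "inj_on \<sigma> G" using \<sigma>(2) by (intro inj_onI) metis
    show "h \<in> automorphisms E A" if "h \<in> \<sigma> ` G" for h
      using that \<sigma>(1) endo_iso[OF gen endo] by (auto simp: automorphisms_def)
    show "h \<in> \<sigma> ` G" if "h \<in> automorphisms E A" for h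
    proof -
      have h: "h \<in> hom E A A" using that by (simp add: automorphisms_def)
      then show ?thesis using \<sigma>_eq[OF h] act_in[OF h a(1)] unfolding G_def by (metis imageI)
    qed
  qed
  let ?pt = "\<lambda>g. FO (inverse_image \<gamma>) {g}" and ?\<Gamma> = "FO (inverse_image \<gamma>) G"
    and ?c = "\<lambda>g. FA (inverse_image \<gamma>) (inclusion {g} G)"
  note c = const_incl[OF small]
  have aG: "a \<in> G" using a(1) by (simp add: G_def)
  note \<Gamma> = hom_obj(2)[OF c[OF aG]]
  \<comment> \<open>The identification of the fibre of the constant object with \<open>G\<close>:
    \<open>idx e\<close> names the point over which \<open>e\<close> lies.\<close>
  define idx where "idx e = (THE g. g \<in> G \<and> e \<in> act (?c g) ` el (?pt g))" for e
  have idx: "idx e \<in> G" "e \<in> act (?c (idx e)) ` el (?pt (idx e))" if "e \<in> el ?\<Gamma>" for e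
    using theI'[OF const_el[OF small that]] unfolding idx_def by blast+
  have idx_eq: "idx (act (?c g) t) = g" if "g \<in> G" "t \<in> el (?pt g)" for g t
    unfolding idx_def using const_el[OF small act_in[OF c[OF that(1)] that(2)]] that
    by (intro the1_equality) auto
  have pt_eq: "t = t'" if "t \<in> el (?pt g)" "t' \<in> el (?pt g)" for g t t'
    using el_terminal[OF const_terminal[of g]] that by blast
  obtain P \<pi>1 \<pi>2 where prod: "is_binary_product E A ?\<Gamma> P \<pi>1 \<pi>2"
    and \<pi>1: "\<pi>1 \<in> hom E P A" and \<pi>2: "\<pi>2 \<in> hom E P ?\<Gamma>"
    and univ: "\<forall>T. \<forall>f \<in> hom E T A. \<forall>g \<in> hom E T ?\<Gamma>. \<exists>!h. h \<in> hom E T P \<and> \<pi>1 \<cdot> h = f \<and> \<pi>2 \<cdot> h = g"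
    and elP: "\<forall>x \<in> el A. \<forall>y \<in> el ?\<Gamma>. \<exists>!e. e \<in> el P \<and> act \<pi>1 e = x \<and> act \<pi>2 e = y"
    using product_ex[OF a(2) \<Gamma>] by (elim exE conjE)
  have elP_eq: "e = e'" if "e \<in> el P" "e' \<in> el P" "act \<pi>1 e = act \<pi>1 e'" "act \<pi>2 e = act \<pi>2 e'" for e e'
    using elP[rule_format, OF act_in[OF \<pi>1 that(1)] act_in[OF \<pi>2 that(1)]] that by metis
  \<comment> \<open>The action on fibres: the element of \<open>P\<close> with components
    \<open>b\<close> and \<open>g\<close> is sent to the value of \<open>\<sigma> g\<close> at
    \<open>b\<close>.\<close>
  define \<phi> where "\<phi> e = act (\<sigma> (idx (act \<pi>2 e))) (act \<pi>1 e)" for e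
  \<comment> \<open>The copy of \<open>A\<close> in the product with index \<open>g\<close>. These
    copies cover the fibre of \<open>P\<close>, and on each of them \<phi> is given by the arrow
    \<open>\<sigma> g\<close>; this is the local representation needed to lift \<phi>.\<close>
  have sect: "\<exists>s \<in> hom E A P. \<forall>y \<in> el A. act \<pi>1 (act s y) = y \<and> idx (act \<pi>2 (act s y)) = g"
    if g: "g \<in> G" for g
  proof -
    obtain t where t: "t \<in> hom E A (?pt g)" using terminal_map[OF const_terminal a(2)] by blast
    note ct = comp_hom[OF t c[OF g]]
    obtain s where s: "s \<in> hom E A P" "\<pi>1 \<cdot> s = Id E A" "\<pi>2 \<cdot> s = ?c g \<cdot> t"
      using univ idA ct by blast
    have "act \<pi>1 (act s y) = y \<and> idx (act \<pi>2 (act s y)) = g" if y: "y \<in> el A" for y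
      using act_comp[OF s(1) \<pi>1 y] act_comp[OF s(1) \<pi>2 y] act_comp[OF t c[OF g] y] s(2,3)
        act_id[OF a(2) y] idx_eq[OF g act_in[OF t y]] by simp
    then show ?thesis using s(1) by blast
  qed
  have idx_inj: "y = y'" if y: "y \<in> el ?\<Gamma>" "y' \<in> el ?\<Gamma>" and eq: "idx y = idx y'" for y y'
  proof -
    obtain t where t: "t \<in> el (?pt (idx y))" "y = act (?c (idx y)) t"
      using idx(2)[OF y(1)] by blast
    obtain t' where t': "t' \<in> el (?pt (idx y))" "y' = act (?c (idx y)) t'"
      using idx(2)[OF y(2)] unfolding eq[symmetric] by blast
    show ?thesis using pt_eq[OF t(1) t'(1)] t(2) t'(2) by simp
  qed
  have "\<exists>w \<in> hom E P A. \<forall>e \<in> el P. act w e = \<phi> e"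
  proof (rule map_of_graph[OF hom_obj(1)[OF \<pi>1] a(2)])
    fix e assume e: "e \<in> el P"
    note e1 = act_in[OF \<pi>1 e] and e2 = act_in[OF \<pi>2 e]
    obtain s where s: "s \<in> hom E A P"
      and ss: "\<And>y. y \<in> el A \<Longrightarrow> act \<pi>1 (act s y) = y \<and> idx (act \<pi>2 (act s y)) = idx (act \<pi>2 e)"
      using sect[OF idx(1)[OF e2]] by blast
    note se = act_in[OF s e1]
    have "e = act s (act \<pi>1 e)"
      using elP_eq[OF e se] ss[OF e1] idx_inj[OF e2 act_in[OF \<pi>2 se]] by simp
    then have "e \<in> act s ` el A" using e1 by blast
    moreover have "\<forall>y \<in> el A. \<phi> (act s y) = act (\<sigma> (idx (act \<pi>2 e))) y"
      using ss by (simp add: \<phi>_def)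
    ultimately show "\<exists>M m u. m \<in> hom E M P \<and> u \<in> hom E M A \<and> e \<in> act m ` el M \<and>
        (\<forall>y \<in> el M. \<phi> (act m y) = act u y)"
      using s \<sigma>(1)[OF idx(1)[OF e2]] by blast
  qed
  then obtain \<rho> where \<rho>: "\<rho> \<in> hom E P A" and act_\<rho>: "\<And>e. e \<in> el P \<Longrightarrow> act \<rho> e = \<phi> e" by blast
  have action: "\<rho> \<cdot> s = \<sigma> g"
    if g: "g \<in> G" and s: "s \<in> hom E A P" and k: "k \<in> hom E A (?pt g)"
      and eq: "\<pi>1 \<cdot> s = Id E A" "\<pi>2 \<cdot> s = ?c g \<cdot> k" for g s k
  proof (rule generated_hom_eq[OF gen comp_hom[OF s \<rho>] \<sigma>(1)[OF g]])
    have "act \<pi>1 (act s a) = a" "act \<pi>2 (act s a) = act (?c g) (act k a)"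
      using act_comp[OF s \<pi>1 a(1)] act_comp[OF s \<pi>2 a(1)] act_comp[OF k c[OF g] a(1)] eq
        act_id[OF a(2,1)] by simp_all
    then show "act (\<rho> \<cdot> s) a = act (\<sigma> g) a"
      using act_comp[OF s \<rho> a(1)] act_\<rho>[OF act_in[OF s a(1)]] idx_eq[OF g act_in[OF k a(1)]]
      by (simp add: \<phi>_def)
  qed
  have aut: "is_aut_action E \<gamma> A G \<sigma> P \<pi>1 \<pi>2 \<rho>"
    unfolding is_aut_action_def using small \<sigma>_aut prod \<rho> action by (simp add: Sets_def)
  obtain Q q1 q2 where prodQ: "is_binary_product E A A Q q1 q2"
    and q1: "q1 \<in> hom E Q A" and q2: "q2 \<in> hom E Q A"
    and univQ: "\<forall>T. \<forall>f \<in> hom E T A. \<forall>g \<in> hom E T A. \<exists>!h. h \<in> hom E T Q \<and> q1 \<cdot> h = f \<and> q2 \<cdot> h = g"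
    and elQ: "\<forall>x \<in> el A. \<forall>y \<in> el A. \<exists>!e. e \<in> el Q \<and> act q1 e = x \<and> act q2 e = y"
    using product_ex[OF a(2,2)] by (elim exE conjE)
  obtain \<theta> where \<theta>: "\<theta> \<in> hom E P Q" "q1 \<cdot> \<theta> = \<pi>1" "q2 \<cdot> \<theta> = \<rho>" using univQ \<pi>1 \<rho> by blast
  have act_\<theta>: "act q1 (act \<theta> e) = act \<pi>1 e" "act q2 (act \<theta> e) = \<phi> e" if "e \<in> el P" for e
    using act_comp[OF \<theta>(1) q1 that] act_comp[OF \<theta>(1) q2 that] \<theta>(2,3) act_\<rho>[OF that] by simp_all
  \<comment> \<open>Freeness of the action: if \<open>\<sigma> g\<close> and
    \<open>\<sigma> g'\<close> agree at \<open>b\<close>, then after composition with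
    \<open>\<sigma> b\<close> they agree at the generator \<open>a\<close>, so the composites are
    equal, and \<open>\<sigma> b\<close>, being surjective on fibres, can be cancelled.\<close>
  have "inj_on (act \<theta>) (el P)"
  proof (rule inj_onI)
    fix e e' assume e: "e \<in> el P" and e': "e' \<in> el P" and eq: "act \<theta> e = act \<theta> e'"
    define b where "b = act \<pi>1 e"
    define g where "g = idx (act \<pi>2 e)"
    define g' where "g' = idx (act \<pi>2 e')"
    have b: "b \<in> G" unfolding b_def G_def using act_in[OF \<pi>1 e] .
    have gG: "g \<in> G" "g' \<in> G" unfolding g_def g'_def using idx(1) act_in[OF \<pi>2] e e' by blast+
    have b': "act \<pi>1 e' = b" using act_\<theta>(1)[OF e] act_\<theta>(1)[OF e'] eq by (simp add: b_def)
    have "act (\<sigma> g) b = act (\<sigma> g') b"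
      using act_\<theta>(2)[OF e] act_\<theta>(2)[OF e'] eq b' by (simp add: \<phi>_def b_def g_def g'_def)
    then have "\<sigma> g \<cdot> \<sigma> b = \<sigma> g' \<cdot> \<sigma> b"
      using generated_hom_eq[OF gen comp_hom[OF \<sigma>(1)[OF b] \<sigma>(1)[OF gG(1)]]
          comp_hom[OF \<sigma>(1)[OF b] \<sigma>(1)[OF gG(2)]]]
        act_comp[OF \<sigma>(1)[OF b] \<sigma>(1)[OF gG(1)] a(1)] act_comp[OF \<sigma>(1)[OF b] \<sigma>(1)[OF gG(2)] a(1)]
        \<sigma>(2)[OF b] by simp
    moreover have "act (\<sigma> b) ` el A = el A"
      using surj_onto_connected[OF conn \<sigma>(1)[OF b]] a(1) by blast
    ultimately have "\<sigma> g = \<sigma> g'"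
      using epi_of_surj[OF \<sigma>(1)[OF b] _ \<sigma>(1)[OF gG(1)] \<sigma>(1)[OF gG(2)]] by blast
    then have "g = g'" using \<sigma>(2) gG by metis
    then have "act \<pi>2 e = act \<pi>2 e'"
      using idx_inj[OF act_in[OF \<pi>2 e] act_in[OF \<pi>2 e']] by (simp add: g_def g'_def)
    then show "e = e'" using elP_eq[OF e e'] b' by (simp add: b_def)
  qed
  \<comment> \<open>Transitivity of the action: \<open>b'\<close> is reached from \<open>b\<close>
    by \<open>h = \<sigma> b' \<cdot> j\<close>, where \<open>j\<close> is the inverse of
    \<open>\<sigma> b\<close>. The index of \<open>h\<close> is its value at
    \<open>a\<close>.\<close>
  moreover have "act \<theta> ` el P = el Q"
  proof (intro equalityI subsetI)
    fix z assume z: "z \<in> el Q"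
    define b where "b = act q1 z"
    define b' where "b' = act q2 z"
    have b: "b \<in> G" "b' \<in> G" unfolding b_def b'_def G_def using act_in[OF q1 z] act_in[OF q2 z] by auto
    obtain j where j: "j \<in> hom E A A" "j \<cdot> \<sigma> b = Id E A"
      using isoE[OF endo_iso[OF gen endo \<sigma>(1)[OF b(1)]] \<sigma>(1)[OF b(1)]] by blast
    have jb: "act j b = a"
      using act_comp[OF \<sigma>(1)[OF b(1)] j(1) a(1)] \<sigma>(2)[OF b(1)] j(2) act_id[OF a(2,1)] by simp
    define h where "h = \<sigma> b' \<cdot> j"
    have h: "h \<in> hom E A A" unfolding h_def using comp_hom[OF j(1) \<sigma>(1)[OF b(2)]] .
    have hb: "act h b = b'"
      unfolding h_def using act_comp[OF j(1) \<sigma>(1)[OF b(2)]] b(1) jb \<sigma>(2)[OF b(2)] by (simp add: G_def)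
    have hG: "act h a \<in> G" unfolding G_def using act_in[OF h a(1)] .
    obtain s where s: "s \<in> hom E A P"
      and ss: "\<And>y. y \<in> el A \<Longrightarrow> act \<pi>1 (act s y) = y \<and> idx (act \<pi>2 (act s y)) = act h a"
      using sect[OF hG] by blast
    have bA: "b \<in> el A" using b(1) by (simp add: G_def)
    let ?e = "act s b"
    note e = act_in[OF s bA]
    have "act q1 (act \<theta> ?e) = b" "act q2 (act \<theta> ?e) = b'"
      using act_\<theta>[OF e] ss[OF bA] \<sigma>_eq[OF h] hb by (simp_all add: \<phi>_def)
    then have "act \<theta> ?e = z"
      using elQ[rule_format, OF act_in[OF q1 z] act_in[OF q2 z]] z act_in[OF \<theta>(1) e]
      unfolding b_def b'_def by metis
    then show "z \<in> act \<theta> ` el P" using e by blast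
  qed (use act_in[OF \<theta>(1)] in blast)
  ultimately have iso: "is_iso E \<theta>" using iso_of_bij[OF \<theta>(1)] by (simp add: bij_betw_def)
  obtain T where T: "is_terminal E T" using terminal by blast
  obtain t where t: "t \<in> hom E A T" using terminal_map[OF T a(2)] by blast
  have surj: "act t ` el A = el T"
    using el_terminal[OF T] act_in[OF t] a(1) by blast
  have "is_epi E t"
    unfolding is_epi_def is_mono_def using homD[OF t] epi_of_surj[OF t surj] by simp
  then have epi: "\<exists>T. is_terminal E T \<and> (\<exists>t \<in> hom E A T. is_epi E t)" using T t by blast
  show ?thesis
    unfolding galois_object_def
  proof (rule conjI[OF generated_nonempty_connected[OF gen] conjI[OF epi]])
    show "\<exists>G \<sigma> P \<pi>\<^sub>1 \<pi>\<^sub>2 \<rho> Q q\<^sub>1 q\<^sub>2 \<theta>. is_aut_action E \<gamma> A G \<sigma> P \<pi>\<^sub>1 \<pi>\<^sub>2 \<rho> \<and>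
        is_binary_product E A A Q q\<^sub>1 q\<^sub>2 \<and> \<theta> \<in> hom E P Q \<and> q\<^sub>1 \<cdot> \<theta> = \<pi>\<^sub>1 \<and> q\<^sub>2 \<cdot> \<theta> = \<rho> \<and> is_iso E \<theta>"
      using aut prodQ \<theta> iso by (intro exI conjI)
  qed
qed

text \<open>One \<open>A\<close> serves all \<open>x\<close> at once because the projection at
  \<open>x\<close> sends \<open>a\<close> to \<open>x\<close>. Uniqueness of the arrow comes from
  generation by \<open>a\<close>, and strictness from surjectivity onto the connected object
  \<open>X\<close>.\<close>

lemma galois_cover:
  assumes X: "connected_object E X" and prod: "is_product E (el X) (\<lambda>_. X) P \<pi>"
    and bij: "bij_betw (\<lambda>y. \<lambda>s \<in> el X. act (\<pi> s) y) (el P) (el X \<rightarrow>\<^sub>E el X)"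
  shows "\<exists>A a. galois_object E \<gamma> A \<and> a \<in> el A \<and>
    (\<forall>x \<in> el X. \<exists>f \<in> hom E A X. act f a = x \<and> is_strict_epi E f \<and>
      (\<forall>g \<in> hom E A X. act g a = x \<longrightarrow> g = f))"
proof -
  have P: "P \<in> Obj E" and \<pi>: "\<And>x. x \<in> el X \<Longrightarrow> \<pi> x \<in> hom E P X"
    using prod by (simp_all add: is_product_def)
  have P_eq: "y = y'"
    if y: "y \<in> el P" "y' \<in> el P" and eq: "\<And>x. x \<in> el X \<Longrightarrow> act (\<pi> x) y = act (\<pi> x) y'" for y y'
  proof -
    have "(\<lambda>s \<in> el X. act (\<pi> s) y) = (\<lambda>s \<in> el X. act (\<pi> s) y')"
      using eq by (intro restrict_ext)
    then show ?thesis using inj_onD[OF bij_betw_imp_inj_on[OF bij]] y by blast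
  qed
  \<comment> \<open>Surjectivity of the comparison map yields an element whose coordinate at every
    index is that index.\<close>
  have "(\<lambda>s \<in> el X. s) \<in> el X \<rightarrow>\<^sub>E el X" by simp
  then obtain y where y: "y \<in> el P" "(\<lambda>s \<in> el X. act (\<pi> s) y) = (\<lambda>s \<in> el X. s)"
    using bij unfolding bij_betw_def by (metis (no_types, lifting) imageE)
  have \<pi>y: "act (\<pi> x) y = x" if "x \<in> el X" for x
    using fun_cong[OF y(2), of x] that by simp
  obtain A i a where i: "i \<in> hom E A P" "is_mono E i" and gen: "generated_by A a" and ia: "act i a = y"
    using component_ex[OF P y(1)] by blast
  note a = generator[OF gen]
  have f: "\<pi> x \<cdot> i \<in> hom E A X" if "x \<in> el X" for x
    using comp_hom[OF i(1) \<pi>[OF that]] .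
  have fa: "act (\<pi> x \<cdot> i) a = x" if "x \<in> el X" for x
    using act_comp[OF i(1) \<pi>[OF that] a(1)] ia \<pi>y[OF that] by simp
  have endo: "\<exists>h \<in> hom E A A. act h a = b" if b: "b \<in> el A" for b
  proof -
    define z where "z x = act (\<pi> x \<cdot> i) b" for x
    have z: "z x \<in> el X" if "x \<in> el X" for x unfolding z_def using act_in[OF f[OF that] b] .
    have "\<forall>x \<in> el X. \<pi> (z x) \<cdot> i \<in> hom E A X" using f z by blast
    then have "\<exists>!h. h \<in> hom E A P \<and> (\<forall>x \<in> el X. \<pi> x \<cdot> h = \<pi> (z x) \<cdot> i)"
      using prod a(2) unfolding is_product_def by simp
    then obtain h where h: "h \<in> hom E A P" "\<And>x. x \<in> el X \<Longrightarrow> \<pi> x \<cdot> h = \<pi> (z x) \<cdot> i" by blast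
    have ib: "act i b \<in> el P" using act_in[OF i(1) b] .
    have ha: "act h a = act i b"
    proof (rule P_eq[OF act_in[OF h(1) a(1)] ib])
      fix x assume x: "x \<in> el X"
      have "act (\<pi> x) (act h a) = z x"
        using act_comp[OF h(1) \<pi>[OF x] a(1)] h(2)[OF x] fa[OF z[OF x]] by simp
      then show "act (\<pi> x) (act h a) = act (\<pi> x) (act i b)"
        using act_comp[OF i(1) \<pi>[OF x] b] by (simp add: z_def)
    qed
    \<comment> \<open>The arrow \<open>h\<close> sends \<open>a\<close> into the fibre of the
      subobject \<open>A\<close>, and this alone makes it factor through \<open>A\<close>.\<close>
    obtain h' where h': "h' \<in> hom E A A" "i \<cdot> h' = h"
      using generated_lift[OF gen i h(1)] ha b by blast
    have "act i (act h' a) = act i b" using act_comp[OF h'(1) i(1) a(1)] h'(2) ha by simp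
    then have "act h' a = b" using inj_onD[OF mono_inj[OF i]] act_in[OF h'(1) a(1)] b by blast
    then show ?thesis using h'(1) by blast
  qed
  have "\<exists>f \<in> hom E A X. act f a = x \<and> is_strict_epi E f \<and> (\<forall>g \<in> hom E A X. act g a = x \<longrightarrow> g = f)"
    if x: "x \<in> el X" for x
  proof (intro bexI[of _ "\<pi> x \<cdot> i"] conjI ballI impI)
    show "is_strict_epi E (\<pi> x \<cdot> i)"
      using strict_epi_of_surj[OF f[OF x]] surj_onto_connected[OF X f[OF x]] a(1) by blast
    show "g = \<pi> x \<cdot> i" if "g \<in> hom E A X" "act g a = x" for g
      using generated_hom_eq[OF gen that(1) f[OF x]] fa[OF x] that(2) by simp
  qed (use f fa x in auto)
  then show ?thesis using galois_of_generated[OF gen endo] a(1) by blast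
qed

end

section \<open>Limits in the category of sets\<close>

text \<open>Elements are turned into arrows from one fixed singleton, so that universal properties
  in sets can be read on elements. Here \<open>undefined\<close> only serves as some element of
  \<open>'u\<close>.\<close>

definition point_at :: "'u set \<Rightarrow> 'u \<Rightarrow> 'u arrow" where
  "point_at A x = ({undefined}, \<lambda>_ \<in> {undefined}. x, A)"

lemma point_at_hom:
  assumes "{undefined :: 'u} \<prec> (UNIV :: 'u set)" "(A :: 'u set) \<prec> (UNIV :: 'u set)" "x \<in> A"
  shows "point_at A x \<in> hom Sets {undefined} A"
  unfolding point_at_def by (rule hom_SetsI) (use assms in auto)

lemma app_point_at: "app (point_at A x) undefined = x"
  by (simp add: point_at_def)

lemma terminal_Sets_singleton:
  assumes inacc: "inaccessible TYPE('u)" and T: "is_terminal (Sets :: ('u set, 'u arrow) category_data) T"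
  shows "\<exists>!x. x \<in> T"
proof -
  have small: "{undefined :: 'u} \<prec> (UNIV :: 'u set)" by (rule small_finite[OF inacc]) simp
  have TO: "T \<prec> (UNIV :: 'u set)" using T by (simp add: is_terminal_def)
  have ex1: "\<exists>!f. f \<in> hom Sets {undefined :: 'u} T" using T small by (simp add: is_terminal_def)
  then obtain f where f: "f \<in> hom Sets {undefined :: 'u} T" by blast
  have "app f undefined \<in> T" using app_in[OF f] by simp
  moreover have "x = y" if "x \<in> T" "y \<in> T" for x y
  proof -
    have "point_at T x = point_at T y"
      using ex1 point_at_hom[OF small TO that(1)] point_at_hom[OF small TO that(2)] by blast
    then show ?thesis using app_point_at by metis
  qed
  ultimately show ?thesis by blast
qed

lemma singleton_terminal_Sets:
  assumes inacc: "inaccessible TYPE('u)"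
  shows "is_terminal (Sets :: ('u set, 'u arrow) category_data) {g}"
  unfolding is_terminal_def
proof (intro conjI ballI)
  have small: "{g} \<prec> (UNIV :: 'u set)" by (rule small_finite[OF inacc]) simp
  then show "{g} \<in> Obj Sets" by simp
  fix X :: "'u set" assume "X \<in> Obj Sets"
  then have X: "X \<prec> (UNIV :: 'u set)" by simp
  have "(X, restrict (\<lambda>_. g) X, {g}) \<in> hom Sets X {g}" by (rule hom_SetsI[OF X small]) simp
  moreover have "f = f'" if f: "f \<in> hom Sets X {g}" "f' \<in> hom Sets X {g}" for f f'
  proof (rule arrow_eqI[OF f])
    fix x assume "x \<in> X"
    then show "app f x = app f' x" using app_in[OF f(1)] app_in[OF f(2)] by simp
  qed
  ultimately show "\<exists>!f. f \<in> hom Sets X {g}" by blast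
qed

lemma empty_initial_Sets:
  assumes inacc: "inaccessible TYPE('u)"
  shows "is_initial (Sets :: ('u set, 'u arrow) category_data) {}"
  unfolding is_initial_def
proof (intro conjI ballI)
  have small: "({} :: 'u set) \<prec> (UNIV :: 'u set)" by (rule small_finite[OF inacc]) simp
  then show "{} \<in> Obj (Sets :: ('u set, 'u arrow) category_data)" by simp
  fix X :: "'u set" assume "X \<in> Obj Sets"
  then have "({}, restrict (\<lambda>x. x) {}, X) \<in> hom Sets {} X" using small by (intro hom_SetsI) simp_all
  moreover have "f = f'" if f: "f \<in> hom Sets {} X" "f' \<in> hom Sets {} X" for f f'
    by (rule arrow_eqI[OF f]) simp
  ultimately show "\<exists>!f. f \<in> hom Sets {} X" by blast
qed

lemma initial_Sets_empty:
  assumes inacc: "inaccessible TYPE('u)" and Z: "is_initial (Sets :: ('u set, 'u arrow) category_data) Z"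
  shows "Z = {}"
proof -
  have "({} :: 'u set) \<prec> (UNIV :: 'u set)" by (rule small_finite[OF inacc]) simp
  then have "\<exists>!f. f \<in> hom Sets Z {}" using Z by (simp add: is_initial_def)
  then obtain f where f: "f \<in> hom Sets Z {}" by blast
  show ?thesis using app_in[OF f] by blast
qed

lemma pullback_Sets_elements:
  assumes inacc: "inaccessible TYPE('u)"
    and pb: "is_pullback (Sets :: ('u set, 'u arrow) category_data) f g P p q"
    and f: "f \<in> hom Sets X Z" and g: "g \<in> hom Sets Y Z"
    and x: "x \<in> X" and y: "y \<in> Y" and eq: "app f x = app g y"
  shows "\<exists>!e. e \<in> P \<and> app p e = x \<and> app q e = y"
proof -
  interpret Sets: category "Sets :: ('u set, 'u arrow) category_data" by (rule category_Sets)
  have small: "{undefined :: 'u} \<prec> (UNIV :: 'u set)" by (rule small_finite[OF inacc]) simp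
  have p: "p \<in> hom Sets P X" and q: "q \<in> hom Sets P Y"
    and univ: "\<forall>T. \<forall>a \<in> hom Sets T X. \<forall>b \<in> hom Sets T Y. Comp Sets f a = Comp Sets g b \<longrightarrow>
      (\<exists>!h. h \<in> hom Sets T P \<and> Comp Sets p h = a \<and> Comp Sets q h = b)"
    using pb homD(2)[OF f] homD(2)[OF g] unfolding is_pullback_def by simp_all
  have X: "X \<prec> (UNIV :: 'u set)" and Y: "Y \<prec> (UNIV :: 'u set)" and P: "P \<prec> (UNIV :: 'u set)"
    using Sets.hom_obj[OF f] Sets.hom_obj[OF g] Sets.hom_obj[OF p] by simp_all
  note px = point_at_hom[OF small X x] and py = point_at_hom[OF small Y y]
  have "Comp Sets f (point_at X x) = Comp Sets g (point_at Y y)"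
    by (rule arrow_eqI[OF Sets.comp_hom[OF px f] Sets.comp_hom[OF py g]])
      (simp add: app_comp[OF px] app_comp[OF py] app_point_at eq)
  then have ex1: "\<exists>!h. h \<in> hom Sets {undefined} P \<and>
      Comp Sets p h = point_at X x \<and> Comp Sets q h = point_at Y y"
    using univ px py by blast
  then obtain h where h: "h \<in> hom Sets {undefined} P" "Comp Sets p h = point_at X x"
    "Comp Sets q h = point_at Y y" by blast
  have "app p (app h undefined) = x" "app q (app h undefined) = y"
    using app_comp[OF h(1), of undefined p] app_comp[OF h(1), of undefined q] h(2,3)
    by (simp_all add: app_point_at)
  moreover have "e = app h undefined" if e: "e \<in> P" "app p e = x" "app q e = y" for e
  proof -
    note pe = point_at_hom[OF small P e(1)]
    have "Comp Sets p (point_at P e) = point_at X x"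
      by (rule arrow_eqI[OF Sets.comp_hom[OF pe p] px]) (simp add: app_comp[OF pe] app_point_at e)
    moreover have "Comp Sets q (point_at P e) = point_at Y y"
      by (rule arrow_eqI[OF Sets.comp_hom[OF pe q] py]) (simp add: app_comp[OF pe] app_point_at e)
    ultimately have "point_at P e = h" using ex1 h pe by blast
    then show ?thesis using app_point_at by metis
  qed
  ultimately show ?thesis using app_in[OF h(1)] by blast
qed

lemma inclusion_hom:
  assumes "(B :: 'u set) \<prec> (UNIV :: 'u set)" "A \<subseteq> B"
  shows "inclusion A B \<in> hom Sets A B" and "x \<in> A \<Longrightarrow> app (inclusion A B) x = x"
  using hom_SetsI[OF lesspoll_subset[OF assms(2,1)] assms(1), of "\<lambda>x. x"] assms(2)
  by (auto simp: inclusion_def)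

text \<open>Disjointness of images is recorded as an empty pullback because in this form it passes
  through any functor that preserves finite limits.\<close>

lemma empty_pullback_Sets:
  assumes inacc: "inaccessible TYPE('u)"
    and f: "f \<in> hom (Sets :: ('u set, 'u arrow) category_data) A C" and g: "g \<in> hom Sets B C"
    and disj: "\<And>a b. a \<in> A \<Longrightarrow> b \<in> B \<Longrightarrow> app f a \<noteq> app g b"
  shows "is_pullback Sets f g {} (inclusion {} A) (inclusion {} B)"
proof -
  interpret Sets: category "Sets :: ('u set, 'u arrow) category_data" by (rule category_Sets)
  note fA = homD(2)[OF f] and gB = homD(2)[OF g]
  have A: "A \<prec> (UNIV :: 'u set)" and B: "B \<prec> (UNIV :: 'u set)"
    using Sets.hom_obj[OF f] Sets.hom_obj[OF g] by simp_all
  note p = inclusion_hom(1)[OF A empty_subsetI] and q = inclusion_hom(1)[OF B empty_subsetI]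
  have ini: "\<exists>!h. h \<in> hom Sets {} X" if "X \<prec> (UNIV :: 'u set)" for X :: "'u set"
    using empty_initial_Sets[OF inacc] that by (simp add: is_initial_def)
  have "\<exists>!h. h \<in> hom Sets T {} \<and> Comp Sets (inclusion {} A) h = a \<and> Comp Sets (inclusion {} B) h = b"
    if a: "a \<in> hom Sets T A" and b: "b \<in> hom Sets T B" and eq: "Comp Sets f a = Comp Sets g b" for T a b
  proof -
    have "T = {}"
    proof (rule ccontr)
      assume "T \<noteq> {}"
      then obtain t where t: "t \<in> T" by blast
      have "app f (app a t) = app g (app b t)"
        using app_comp[OF a t, of f] app_comp[OF b t, of g] eq by simp
      then show False using disj app_in[OF a t] app_in[OF b t] by blast
    qed
    note a' = a[unfolded this] and b' = b[unfolded this] and T = this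
    have 0: "({} :: 'u set) \<prec> (UNIV :: 'u set)" using Sets.hom_obj(1)[OF a'] by simp
    obtain h where h: "h \<in> hom Sets {} {}" "\<And>h'. h' \<in> hom Sets {} {} \<Longrightarrow> h' = (h :: 'u arrow)"
      using ini[OF 0] by blast
    have "Comp Sets (inclusion {} A) h = a" "Comp Sets (inclusion {} B) h = b"
      using ini[OF A] ini[OF B] Sets.comp_hom[OF h(1) p] Sets.comp_hom[OF h(1) q] a' b' by blast+
    then show ?thesis unfolding T using h by blast
  qed
  moreover have "Comp Sets f (inclusion {} A) = Comp Sets g (inclusion {} B)"
    by (rule arrow_eqI[OF Sets.comp_hom[OF p f] Sets.comp_hom[OF q g]]) simp
  ultimately show ?thesis unfolding is_pullback_def fA gB using p q by blast
qed

section \<open>Preservation of terminal objects and pullbacks\<close>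

text \<open>Preservation of finite limits is formulated for shapes made of natural numbers; terminal
  objects correspond to the shape without objects, on which the structure maps are
  arbitrary.\<close>

definition empty_shape :: "(nat, nat) category_data" where
  "empty_shape = \<lparr>Obj = {}, Arr = {}, Dom = (\<lambda>i. i), Cod = (\<lambda>i. i), Id = (\<lambda>i. i), Comp = (\<lambda>g f. g)\<rparr>"

lemma is_limit_empty_shape: "is_limit empty_shape C D T leg \<longleftrightarrow> is_terminal C T"
  unfolding is_limit_def is_cone_def is_terminal_def empty_shape_def by auto

lemma preserves_finite_limitsD:
  fixes K :: "(nat, nat) category_data"
  assumes "preserves_finite_limits C C' F" "finite (Obj K)" "finite (Arr K)" "is_functor K C D"
    and "is_limit K C D L leg"
  shows "is_limit K C' (comp_functor F D) (FO F L) (\<lambda>i. FA F (leg i))"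
  using assms unfolding preserves_finite_limits_def by simp

lemma preserves_terminal:
  fixes C :: "('o, 'm) category_data"
  assumes pres: "preserves_finite_limits C C' F" and F: "is_functor C C' F" and T: "is_terminal C T"
  shows "is_terminal C' (FO F T)"
proof -
  interpret F: is_functor C C' F by fact
  define D :: "(nat, nat, 'o, 'm) functor_data" where "D = \<lparr>FO = (\<lambda>_ :: nat. undefined), FA = (\<lambda>_ :: nat. undefined)\<rparr>"
  have D: "is_functor empty_shape C D"
    by unfold_locales (simp_all add: empty_shape_def hom_def)
  have fin: "finite (Obj empty_shape)" "finite (Arr empty_shape)" by (simp_all add: empty_shape_def)
  have "is_limit empty_shape C D T (\<lambda>_. undefined)" unfolding is_limit_empty_shape by (rule T)
  from preserves_finite_limitsD[OF pres fin D this] show ?thesis unfolding is_limit_empty_shape .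
qed

text \<open>The cospan with objects \<open>0, 1, 2\<close>, whose identities have the same names, and the two
  arrows \<open>3 : 0 \<rightarrow> 2\<close> and \<open>4 : 1 \<rightarrow> 2\<close>.\<close>

definition cospan_shape :: "(nat, nat) category_data" where
  "cospan_shape = \<lparr>Obj = {0, 1, 2}, Arr = {0, 1, 2, 3, 4},
    Dom = (\<lambda>i. if i = 3 then 0 else if i = 4 then 1 else i),
    Cod = (\<lambda>i. if i = 3 \<or> i = 4 then 2 else i),
    Id = (\<lambda>i. i), Comp = (\<lambda>g f. if f \<le> 2 then g else f)\<rparr>"

lemma cospan_simps [simp]:
  "Obj cospan_shape = {0, 1, 2}" "Arr cospan_shape = {0, 1, 2, 3, 4}"
  "Dom cospan_shape i = (if i = 3 then 0 else if i = 4 then 1 else i)"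
  "Cod cospan_shape i = (if i = 3 \<or> i = 4 then 2 else i)"
  "Id cospan_shape i = i" "Comp cospan_shape g f = (if f \<le> 2 then g else f)"
  by (simp_all add: cospan_shape_def)

lemma hom_cospan: "f \<in> hom cospan_shape i j \<longleftrightarrow>
    (i = j \<and> f = i \<and> i \<in> {0, 1, 2}) \<or> (f = 3 \<and> i = 0 \<and> j = 2) \<or> (f = 4 \<and> i = 1 \<and> j = 2)"
  by (auto simp: hom_def)

lemma category_cospan: "category cospan_shape"
  by unfold_locales (auto simp: hom_cospan)

context
  fixes C :: "('o, 'm) category_data" and f g :: 'm and X Y Z :: 'o
  assumes C: "category C" and f: "f \<in> hom C X Z" and g: "g \<in> hom C Y Z"
begin

interpretation category C by (rule C)

definition cospan_diagram :: "(nat, nat, 'o, 'm) functor_data" where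
  "cospan_diagram = \<lparr>FO = (\<lambda>i. if i = 0 then X else if i = 1 then Y else Z),
    FA = (\<lambda>i. if i = 0 then Id C X else if i = 1 then Id C Y else if i = 2 then Id C Z
      else if i = 3 then f else g)\<rparr>"

lemma functor_cospan: "is_functor cospan_shape C cospan_diagram"
proof -
  interpret K: category cospan_shape by (rule category_cospan)
  note XYZ = hom_obj[OF f] hom_obj[OF g]
  note ids = id_hom[OF XYZ(1)] id_hom[OF XYZ(2)] id_hom[OF XYZ(3)]
  show ?thesis
    by unfold_locales
      (auto simp: hom_cospan cospan_diagram_def XYZ ids f g id_left[OF f] id_left[OF g]
        id_right[OF f] id_right[OF g] id_left[OF ids(1)] id_left[OF ids(2)] id_left[OF ids(3)])
qed

lemma is_cone_cospan:
  "is_cone cospan_shape C cospan_diagram T \<mu> \<longleftrightarrow> \<mu> 0 \<in> hom C T X \<and> \<mu> 1 \<in> hom C T Y \<and>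
    \<mu> 2 = Comp C f (\<mu> 0) \<and> \<mu> 2 = Comp C g (\<mu> 1)"
proof -
  have "is_cone cospan_shape C cospan_diagram T \<mu> \<longleftrightarrow> T \<in> Obj C \<and> \<mu> 0 \<in> hom C T X \<and>
      \<mu> 1 \<in> hom C T Y \<and> \<mu> 2 \<in> hom C T Z \<and> Comp C (Id C X) (\<mu> 0) = \<mu> 0 \<and> Comp C (Id C Y) (\<mu> 1) = \<mu> 1 \<and>
      Comp C (Id C Z) (\<mu> 2) = \<mu> 2 \<and> Comp C f (\<mu> 0) = \<mu> 2 \<and> Comp C g (\<mu> 1) = \<mu> 2"
    by (auto simp: is_cone_def cospan_diagram_def)
  then show ?thesis using hom_obj(1) id_left comp_hom[OF _ f] by metis
qed

text \<open>The leg at the corner \<open>2\<close> is determined by the other two, so cones over the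
  cospan amount to commuting squares.\<close>

lemma is_limit_cospan:
  assumes "\<mu> 0 = p" "\<mu> 1 = q" "\<mu> 2 = Comp C f p"
  shows "is_limit cospan_shape C cospan_diagram P \<mu> \<longleftrightarrow> is_pullback C f g P p q"
proof -
  have key: "h \<in> hom C T P \<and> (\<forall>i \<in> Obj cospan_shape. Comp C (\<mu> i) h = \<nu> i) \<longleftrightarrow>
      h \<in> hom C T P \<and> Comp C p h = \<nu> 0 \<and> Comp C q h = \<nu> 1"
    if "is_cone cospan_shape C cospan_diagram T \<nu>" "p \<in> hom C P X" for h T \<nu>
  proof -
    have "Comp C (Comp C f p) h = \<nu> 2" if h: "h \<in> hom C T P" "Comp C p h = \<nu> 0"
      using assoc[OF h(1) \<open>p \<in> hom C P X\<close> f] h(2) \<open>is_cone cospan_shape C cospan_diagram T \<nu>\<close>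
      by (simp add: is_cone_cospan)
    then show ?thesis using assms by auto
  qed
  have cone_iff: "is_cone cospan_shape C cospan_diagram P \<mu> \<longleftrightarrow>
      p \<in> hom C P X \<and> q \<in> hom C P Y \<and> Comp C f p = Comp C g q"
    unfolding is_cone_cospan assms by auto
  have univ_iff: "(\<forall>T \<nu>. is_cone cospan_shape C cospan_diagram T \<nu> \<longrightarrow>
        (\<exists>!h. h \<in> hom C T P \<and> (\<forall>i \<in> Obj cospan_shape. Comp C (\<mu> i) h = \<nu> i))) \<longleftrightarrow>
      (\<forall>T. \<forall>a \<in> hom C T X. \<forall>b \<in> hom C T Y. Comp C f a = Comp C g b \<longrightarrow>
        (\<exists>!h. h \<in> hom C T P \<and> Comp C p h = a \<and> Comp C q h = b))" (is "?L \<longleftrightarrow> ?R")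
    if p: "p \<in> hom C P X"
  proof
    assume L: ?L
    show ?R
    proof (intro allI ballI impI)
      fix T a b assume a: "a \<in> hom C T X" and b: "b \<in> hom C T Y" and eq: "Comp C f a = Comp C g b"
      define \<nu> where "\<nu> i = (if i = 0 then a else if i = 1 then b else Comp C f a)" for i :: nat
      have cone: "is_cone cospan_shape C cospan_diagram T \<nu>"
        unfolding is_cone_cospan using a b eq by (simp add: \<nu>_def)
      then show "\<exists>!h. h \<in> hom C T P \<and> Comp C p h = a \<and> Comp C q h = b"
        using L[rule_format, OF cone] unfolding key[OF cone p] by (simp add: \<nu>_def)
    qed
  next
    assume R: ?R
    show ?L
    proof (intro allI impI)
      fix T \<nu> assume cone: "is_cone cospan_shape C cospan_diagram T \<nu>"
      then have "\<nu> 0 \<in> hom C T X" "\<nu> 1 \<in> hom C T Y" "Comp C f (\<nu> 0) = Comp C g (\<nu> 1)"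
        unfolding is_cone_cospan by auto
      then show "\<exists>!h. h \<in> hom C T P \<and> (\<forall>i \<in> Obj cospan_shape. Comp C (\<mu> i) h = \<nu> i)"
        using R unfolding key[OF cone p] by simp
    qed
  qed
  show ?thesis
    unfolding is_limit_def is_pullback_def homD(2)[OF f] homD(2)[OF g] cone_iff
    using univ_iff by (simp only: conj_assoc cong: conj_cong)
qed

end

lemma preserves_pullback:
  assumes pres: "preserves_finite_limits C C' F" and F: "is_functor C C' F"
    and f: "f \<in> hom C X Z" and g: "g \<in> hom C Y Z" and pb: "is_pullback C f g P p q"
  shows "is_pullback C' (FA F f) (FA F g) (FO F P) (FA F p) (FA F q)"
proof -
  interpret F: is_functor C C' F by fact
  let ?D = "cospan_diagram C f g X Y Z"
  let ?D' = "cospan_diagram C' (FA F f) (FA F g) (FO F X) (FO F Y) (FO F Z)"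
  define \<mu> where "\<mu> i = (if i = 0 then p else if i = 1 then q else Comp C f p)" for i :: nat
  have p: "p \<in> hom C P X" using pb homD(2)[OF f] by (simp add: is_pullback_def)
  note XYZ = F.source.hom_obj[OF f] F.source.hom_obj[OF g]
  have lim: "is_limit cospan_shape C ?D P \<mu>"
    using pb is_limit_cospan[OF F.source.category_axioms f g, of \<mu> p q P] by (simp add: \<mu>_def)
  have fin: "finite (Obj cospan_shape)" "finite (Arr cospan_shape)" by simp_all
  have "is_limit cospan_shape C' (comp_functor F ?D) (FO F P) (\<lambda>i. FA F (\<mu> i))"
    using preserves_finite_limitsD[OF pres fin functor_cospan[OF F.source.category_axioms f g] lim] .
  moreover have "comp_functor F ?D = ?D'"
    unfolding comp_functor_def cospan_diagram_def[OF F.source.category_axioms f g]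
      cospan_diagram_def[OF F.target.category_axioms F.map_hom[OF f] F.map_hom[OF g]]
    using F.map_id XYZ by auto
  ultimately have "is_limit cospan_shape C' ?D' (FO F P) (\<lambda>i. FA F (\<mu> i))" by simp
  then show ?thesis
    using is_limit_cospan[OF F.target.category_axioms F.map_hom[OF f] F.map_hom[OF g],
        of "\<lambda>i. FA F (\<mu> i)" "FA F p" "FA F q" "FO F P"] F.map_comp[OF p f]
    by (simp add: \<mu>_def)
qed

section \<open>Adjunctions\<close>

lemma left_adjoint_unit_counit:
  assumes "left_adjoint C D L R"
  shows "is_functor C D L" "is_functor D C R"
    and "\<exists>\<eta> \<epsilon>. (\<forall>X \<in> Obj C. \<eta> X \<in> hom C X (FO R (FO L X))) \<and>
      (\<forall>X Y. \<forall>f \<in> hom C X Y. Comp C (\<eta> Y) f = Comp C (FA R (FA L f)) (\<eta> X)) \<and>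
      (\<forall>Y \<in> Obj D. \<epsilon> Y \<in> hom D (FO L (FO R Y)) Y) \<and>
      (\<forall>Y Z. \<forall>g \<in> hom D Y Z. Comp D (\<epsilon> Z) (FA L (FA R g)) = Comp D g (\<epsilon> Y)) \<and>
      (\<forall>X \<in> Obj C. Comp D (\<epsilon> (FO L X)) (FA L (\<eta> X)) = Id D (FO L X)) \<and>
      (\<forall>Y \<in> Obj D. Comp C (FA R (\<epsilon> Y)) (\<eta> (FO R Y)) = Id C (FO R Y))"
proof -
  show "is_functor C D L" "is_functor D C R" using assms by (simp_all add: left_adjoint_def)
  obtain \<eta> \<epsilon> where \<eta>: "natural_transformation C C id_functor (comp_functor R L) \<eta>"
    and \<epsilon>: "natural_transformation D D (comp_functor L R) id_functor \<epsilon>"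
    and tri: "\<forall>X \<in> Obj C. Comp D (\<epsilon> (FO L X)) (FA L (\<eta> X)) = Id D (FO L X)"
      "\<forall>Y \<in> Obj D. Comp C (FA R (\<epsilon> Y)) (\<eta> (FO R Y)) = Id C (FO R Y)"
    using assms unfolding left_adjoint_def by blast
  have "\<forall>X \<in> Obj C. \<eta> X \<in> hom C X (FO R (FO L X))"
    using \<eta> by (simp add: natural_transformation_def id_functor_def comp_functor_def)
  moreover have "\<forall>X Y. \<forall>f \<in> hom C X Y. Comp C (\<eta> Y) f = Comp C (FA R (FA L f)) (\<eta> X)"
    using \<eta> unfolding natural_transformation_def id_functor_def comp_functor_def hom_def by simp
  moreover have "\<forall>Y \<in> Obj D. \<epsilon> Y \<in> hom D (FO L (FO R Y)) Y"
    using \<epsilon> by (simp add: natural_transformation_def id_functor_def comp_functor_def)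
  moreover have "\<forall>Y Z. \<forall>g \<in> hom D Y Z. Comp D (\<epsilon> Z) (FA L (FA R g)) = Comp D g (\<epsilon> Y)"
    using \<epsilon> unfolding natural_transformation_def id_functor_def comp_functor_def hom_def by simp
  ultimately show "\<exists>\<eta> \<epsilon>. (\<forall>X \<in> Obj C. \<eta> X \<in> hom C X (FO R (FO L X))) \<and>
      (\<forall>X Y. \<forall>f \<in> hom C X Y. Comp C (\<eta> Y) f = Comp C (FA R (FA L f)) (\<eta> X)) \<and>
      (\<forall>Y \<in> Obj D. \<epsilon> Y \<in> hom D (FO L (FO R Y)) Y) \<and>
      (\<forall>Y Z. \<forall>g \<in> hom D Y Z. Comp D (\<epsilon> Z) (FA L (FA R g)) = Comp D g (\<epsilon> Y)) \<and>
      (\<forall>X \<in> Obj C. Comp D (\<epsilon> (FO L X)) (FA L (\<eta> X)) = Id D (FO L X)) \<and>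
      (\<forall>Y \<in> Obj D. Comp C (FA R (\<epsilon> Y)) (\<eta> (FO R Y)) = Id C (FO R Y))"
    using tri by (intro exI conjI)
qed

section \<open>Jointly epic families and initial objects under left adjoints\<close>

text \<open>This stands in for coproducts: that a set is the union of its points is expressed by
  cancellation, which left adjoints preserve. Two applications, to the constant object functor and
  to the inverse image of the point, show that the points of \<open>G\<close> cover the fibre of the
  constant object on \<open>G\<close>.\<close>

definition jointly_epic :: "('o, 'm) category_data \<Rightarrow> 'o \<Rightarrow> 'm set \<Rightarrow> bool" where
  "jointly_epic C X H \<longleftrightarrow> (\<forall>m \<in> H. m \<in> Arr C \<and> Cod C m = X) \<and>
    (\<forall>Z. \<forall>u \<in> hom C X Z. \<forall>v \<in> hom C X Z. (\<forall>m \<in> H. Comp C u m = Comp C v m) \<longrightarrow> u = v)"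

lemma jointly_epic_hom:
  assumes "jointly_epic C X H" "m \<in> H"
  shows "m \<in> hom C (Dom C m) X"
  using conjunct1[OF assms(1)[unfolded jointly_epic_def], rule_format, OF assms(2)]
  by (simp add: hom_def)

lemma jointly_epicD:
  assumes "jointly_epic C X H" "u \<in> hom C X Z" "v \<in> hom C X Z"
    and "\<And>m. m \<in> H \<Longrightarrow> Comp C u m = Comp C v m"
  shows "u = v"
  using assms unfolding jointly_epic_def by blast

lemma jointly_epicI:
  assumes "\<And>m. m \<in> H \<Longrightarrow> m \<in> hom C (Dom C m) X"
    and "\<And>Z u v. u \<in> hom C X Z \<Longrightarrow> v \<in> hom C X Z \<Longrightarrow>
      (\<And>m. m \<in> H \<Longrightarrow> Comp C u m = Comp C v m) \<Longrightarrow> u = v"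
  shows "jointly_epic C X H"
  unfolding jointly_epic_def using homD(1,3)[OF assms(1)] assms(2) by blast

text \<open>Two arrows out of \<open>FO L X\<close> that agree on the images of \<open>H\<close>
  have transposes that agree on \<open>H\<close>, hence equal transposes; transposing back gives
  equality.\<close>

lemma left_adjoint_jointly_epic:
  assumes adj: "left_adjoint C D L R" and X: "X \<in> Obj C" and H: "jointly_epic C X H"
  shows "jointly_epic D (FO L X) (FA L ` H)"
proof -
  interpret L: is_functor C D L using left_adjoint_unit_counit(1)[OF adj] .
  interpret R: is_functor D C R using left_adjoint_unit_counit(2)[OF adj] .
  obtain \<eta> \<epsilon> where \<eta>: "\<forall>X \<in> Obj C. \<eta> X \<in> hom C X (FO R (FO L X))"
    and \<eta>n: "\<forall>X Y. \<forall>f \<in> hom C X Y. Comp C (\<eta> Y) f = Comp C (FA R (FA L f)) (\<eta> X)"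
    and \<epsilon>: "\<forall>Y \<in> Obj D. \<epsilon> Y \<in> hom D (FO L (FO R Y)) Y"
    and \<epsilon>n: "\<forall>Y Z. \<forall>g \<in> hom D Y Z. Comp D (\<epsilon> Z) (FA L (FA R g)) = Comp D g (\<epsilon> Y)"
    and tri: "\<forall>X \<in> Obj C. Comp D (\<epsilon> (FO L X)) (FA L (\<eta> X)) = Id D (FO L X)"
    using left_adjoint_unit_counit(3)[OF adj] by (elim exE conjE) (rule that)
  note \<eta>X = \<eta>[rule_format, OF X]
  note mH = jointly_epic_hom[OF H]
  have transpose: "Comp D (\<epsilon> Z) (FA L (Comp C (FA R u) (\<eta> X))) = u" if u: "u \<in> hom D (FO L X) Z" for u Z
  proof -
    note Z = L.target.hom_obj(2)[OF u] and LX = L.map_obj[OF X]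
    note \<epsilon>Z = \<epsilon>[rule_format, OF Z] and \<epsilon>X = \<epsilon>[rule_format, OF LX]
    note Ru = R.map_hom[OF u]
    have "Comp D (\<epsilon> Z) (FA L (Comp C (FA R u) (\<eta> X))) = Comp D (Comp D (\<epsilon> Z) (FA L (FA R u))) (FA L (\<eta> X))"
      using L.map_comp[OF \<eta>X Ru] L.target.assoc[OF L.map_hom[OF \<eta>X] L.map_hom[OF Ru] \<epsilon>Z] by simp
    also have "\<dots> = Comp D u (Comp D (\<epsilon> (FO L X)) (FA L (\<eta> X)))"
      using \<epsilon>n u L.target.assoc[OF L.map_hom[OF \<eta>X] \<epsilon>X u] by simp
    finally show ?thesis using tri X L.target.id_right[OF u] by simp
  qed
  have "u = v"
    if u: "u \<in> hom D (FO L X) Z" and v: "v \<in> hom D (FO L X) Z"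
      and eq: "\<And>m. m \<in> H \<Longrightarrow> Comp D u (FA L m) = Comp D v (FA L m)" for Z u v
  proof -
    have key: "Comp C (Comp C (FA R w) (\<eta> X)) m = Comp C (FA R (Comp D w (FA L m))) (\<eta> (Dom C m))"
      if w: "w \<in> hom D (FO L X) Z" and m: "m \<in> H" for w m
    proof -
      note h = mH[OF m]
      note \<eta>M = \<eta>[rule_format, OF L.source.hom_obj(1)[OF h]]
      note Lm = L.map_hom[OF h]
      show ?thesis
        using L.source.assoc[OF h \<eta>X R.map_hom[OF w]] \<eta>n[rule_format, OF h]
          L.source.assoc[OF \<eta>M R.map_hom[OF Lm] R.map_hom[OF w]] R.map_comp[OF Lm w] by simp
    qed
    have "Comp C (FA R u) (\<eta> X) = Comp C (FA R v) (\<eta> X)"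
    proof (rule jointly_epicD[OF H])
      show "Comp C (FA R u) (\<eta> X) \<in> hom C X (FO R Z)" "Comp C (FA R v) (\<eta> X) \<in> hom C X (FO R Z)"
        using L.source.comp_hom[OF \<eta>X R.map_hom[OF u]] L.source.comp_hom[OF \<eta>X R.map_hom[OF v]] .
      show "Comp C (Comp C (FA R u) (\<eta> X)) m = Comp C (Comp C (FA R v) (\<eta> X)) m" if m: "m \<in> H" for m
        unfolding key[OF u m] key[OF v m] eq[OF m] ..
    qed
    from transpose[OF u, unfolded this] transpose[OF v] show ?thesis by (rule trans[OF sym])
  qed
  note epi = this
  show ?thesis
  proof (rule jointly_epicI)
    fix n assume "n \<in> FA L ` H"
    then obtain m where m: "m \<in> H" "n = FA L m" by blast
    show "n \<in> hom D (Dom D n) (FO L X)"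
      using L.map_hom[OF mH[OF m(1)]] homD(2)[OF L.map_hom[OF mH[OF m(1)]]] m(2) by simp
  next
    fix Z u v assume uv: "u \<in> hom D (FO L X) Z" "v \<in> hom D (FO L X) Z"
      and eq: "\<And>m. m \<in> FA L ` H \<Longrightarrow> Comp D u m = Comp D v m"
    show "u = v" using epi[OF uv eq] by simp
  qed
qed

text \<open>Uniqueness is the preservation of joint epicness for the empty family, which is jointly
  epic exactly when parallel arrows out of the object are equal. Existence uses the counit.\<close>

lemma left_adjoint_initial:
  assumes adj: "left_adjoint C D L R" and Z: "is_initial C Z"
  shows "is_initial D (FO L Z)"
proof -
  interpret L: is_functor C D L using left_adjoint_unit_counit(1)[OF adj] .
  interpret R: is_functor D C R using left_adjoint_unit_counit(2)[OF adj] .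
  have ZO: "Z \<in> Obj C" using Z by (simp add: is_initial_def)
  have "u = v" if "u \<in> hom C Z Y" "v \<in> hom C Z Y" for u v Y
    using Z L.source.hom_obj(2)[OF that(1)] that unfolding is_initial_def by blast
  then have epi: "jointly_epic C Z {}" by (intro jointly_epicI) simp_all
  have uniq: "u = v" if "u \<in> hom D (FO L Z) Y" "v \<in> hom D (FO L Z) Y" for u v Y
    using jointly_epicD[OF left_adjoint_jointly_epic[OF adj ZO epi] that] by simp
  have "\<exists>!f. f \<in> hom D (FO L Z) Y" if Y: "Y \<in> Obj D" for Y
  proof -
    obtain f where f: "f \<in> hom C Z (FO R Y)" using Z R.map_obj[OF Y] unfolding is_initial_def by blast
    obtain \<epsilon> where "\<forall>Y \<in> Obj D. \<epsilon> Y \<in> hom D (FO L (FO R Y)) Y"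
      using left_adjoint_unit_counit(3)[OF adj] by (elim exE conjE) (rule that)
    then have "\<epsilon> Y \<in> hom D (FO L (FO R Y)) Y" using Y by simp
    then show ?thesis using uniq L.target.comp_hom[OF L.map_hom[OF f]] by blast
  qed
  then show ?thesis unfolding is_initial_def using L.map_obj[OF ZO] by simp
qed

text \<open>The largest subobject of \<open>X\<close> sent into \<open>T\<close> by the inverse image \<open>L\<close> is the pullback of
  \<open>R T \<rightarrow> R (L X)\<close> along the unit.\<close>

lemma largest_subobject_into:
  fixes E :: "('o, 'm) category_data" and L :: "('o, 'm, 'u set, 'u arrow) functor_data"
  assumes adj: "left_adjoint E Sets L R"
    and pullbacks: "\<And>f g X Y Z. f \<in> hom E X Z \<Longrightarrow> g \<in> hom E Y Z \<Longrightarrow> \<exists>P p q. is_pullback E f g P p q"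
    and X: "X \<in> Obj E" and T: "T \<subseteq> FO L X"
  shows "\<exists>K k. k \<in> hom E K X \<and> is_mono E k \<and> app (FA L k) ` FO L K \<subseteq> T \<and>
    (\<forall>Y. \<forall>f \<in> hom E Y X. app (FA L f) ` FO L Y \<subseteq> T \<longrightarrow> (\<exists>h \<in> hom E Y K. Comp E k h = f))"
proof -
  interpret L: is_functor E Sets L using left_adjoint_unit_counit(1)[OF adj] .
  interpret R: is_functor Sets E R using left_adjoint_unit_counit(2)[OF adj] .
  obtain \<eta> \<epsilon> where \<eta>: "\<forall>X \<in> Obj E. \<eta> X \<in> hom E X (FO R (FO L X))"
    and \<eta>n: "\<forall>X Y. \<forall>f \<in> hom E X Y. Comp E (\<eta> Y) f = Comp E (FA R (FA L f)) (\<eta> X)"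
    and \<epsilon>: "\<forall>Y \<in> Obj Sets. \<epsilon> Y \<in> hom Sets (FO L (FO R Y)) Y"
    and \<epsilon>n: "\<forall>Y Z. \<forall>g \<in> hom Sets Y Z. Comp Sets (\<epsilon> Z) (FA L (FA R g)) = Comp Sets g (\<epsilon> Y)"
    and tri1: "\<forall>X \<in> Obj E. Comp Sets (\<epsilon> (FO L X)) (FA L (\<eta> X)) = Id Sets (FO L X)"
    and tri2: "\<forall>Y \<in> Obj Sets. Comp E (FA R (\<epsilon> Y)) (\<eta> (FO R Y)) = Id E (FO R Y)"
    using left_adjoint_unit_counit(3)[OF adj] by (elim exE conjE)
  have small: "FO L X \<prec> (UNIV :: 'u set)" using L.map_obj[OF X] by simp
  define i where "i = inclusion T (FO L X)"
  have i: "i \<in> hom Sets T (FO L X)" and app_i: "\<And>x. x \<in> T \<Longrightarrow> app i x = x"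
    unfolding i_def using inclusion_hom[OF small T] by auto
  note TO = L.target.hom_obj(1)[OF i] and Ri = R.map_hom[OF i]
  note \<eta>X = \<eta>[rule_format, OF X] and \<epsilon>T = \<epsilon>[rule_format, OF TO]
    and \<epsilon>X = \<epsilon>[rule_format, OF L.map_obj[OF X]] and RT = R.map_obj[OF TO]
  have i_counit: "Comp Sets (\<epsilon> (FO L X)) (FA L (Comp E (FA R i) u)) = Comp Sets i (Comp Sets (\<epsilon> T) (FA L u))"
    if u: "u \<in> hom E Y (FO R T)" for u Y
    using L.map_comp[OF u Ri] L.target.assoc[OF L.map_hom[OF u] L.map_hom[OF Ri] \<epsilon>X]
      L.target.assoc[OF L.map_hom[OF u] \<epsilon>T i] \<epsilon>n[rule_format, OF i] by simp
  have transpose: "Comp E (FA R (Comp Sets (\<epsilon> T) (FA L u))) (\<eta> Y) = u"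
    if u: "u \<in> hom E Y (FO R T)" for u Y
  proof -
    note \<eta>Y = \<eta>[rule_format, OF L.source.hom_obj(1)[OF u]] and \<eta>T = \<eta>[rule_format, OF RT]
    note Lu = L.map_hom[OF u]
    have "Comp E (FA R (Comp Sets (\<epsilon> T) (FA L u))) (\<eta> Y) = Comp E (FA R (\<epsilon> T)) (Comp E (FA R (FA L u)) (\<eta> Y))"
      using R.map_comp[OF Lu \<epsilon>T] L.source.assoc[OF \<eta>Y R.map_hom[OF Lu] R.map_hom[OF \<epsilon>T]] by simp
    also have "\<dots> = Comp E (Comp E (FA R (\<epsilon> T)) (\<eta> (FO R T))) u"
      using \<eta>n[rule_format, OF u] L.source.assoc[OF u \<eta>T R.map_hom[OF \<epsilon>T]] by simp
    finally show ?thesis using tri2[rule_format, OF TO] L.source.id_left[OF u] by simp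
  qed
  \<comment> \<open>Right adjoints preserve monomorphisms: after transposing, \<open>u\<close> and
    \<open>v\<close> become functions into \<open>T\<close> that agree after the injective inclusion
    \<open>i\<close>.\<close>
  have mono_Ri: "is_mono E (FA R i)"
  proof (rule L.source.monoI[OF Ri])
    fix Y u v assume u: "u \<in> hom E Y (FO R T)" and v: "v \<in> hom E Y (FO R T)"
      and eq: "Comp E (FA R i) u = Comp E (FA R i) v"
    note u' = L.target.comp_hom[OF L.map_hom[OF u] \<epsilon>T] and v' = L.target.comp_hom[OF L.map_hom[OF v] \<epsilon>T]
    have "Comp Sets (\<epsilon> T) (FA L u) = Comp Sets (\<epsilon> T) (FA L v)"
    proof (rule arrow_eqI[OF u' v'])
      fix y assume y: "y \<in> FO L Y"
      have "app i (app (Comp Sets (\<epsilon> T) (FA L u)) y) = app i (app (Comp Sets (\<epsilon> T) (FA L v)) y)"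
        using i_counit[OF u] i_counit[OF v] eq app_comp[OF u' y, of i] app_comp[OF v' y, of i] by simp
      then show "app (Comp Sets (\<epsilon> T) (FA L u)) y = app (Comp Sets (\<epsilon> T) (FA L v)) y"
        using app_i[OF app_in[OF u' y]] app_i[OF app_in[OF v' y]] by simp
    qed
    from transpose[OF u, unfolded this] transpose[OF v] show "u = v" by (rule trans[OF sym])
  qed
  obtain K k l where pb: "is_pullback E (\<eta> X) (FA R i) K k l" using pullbacks[OF \<eta>X Ri] by blast
  then have k: "k \<in> hom E K X" and l: "l \<in> hom E K (FO R T)" and sq: "Comp E (\<eta> X) k = Comp E (FA R i) l"
    and univ: "\<forall>Y. \<forall>a \<in> hom E Y X. \<forall>b \<in> hom E Y (FO R T). Comp E (\<eta> X) a = Comp E (FA R i) b \<longrightarrow>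
      (\<exists>!h. h \<in> hom E Y K \<and> Comp E k h = a \<and> Comp E l h = b)"
    unfolding is_pullback_def homD(2)[OF \<eta>X] homD(2)[OF Ri] by auto
  have "is_mono E k" using L.source.pullback_mono[OF pb \<eta>X Ri mono_Ri] .
  moreover have "app (FA L k) ` FO L K \<subseteq> T"
  proof -
    note Lk = L.map_hom[OF k] and l' = L.target.comp_hom[OF L.map_hom[OF l] \<epsilon>T]
    have "FA L k = Comp Sets (Comp Sets (\<epsilon> (FO L X)) (FA L (\<eta> X))) (FA L k)"
      using tri1[rule_format, OF X] L.target.id_left[OF Lk] by simp
    also have "\<dots> = Comp Sets (\<epsilon> (FO L X)) (FA L (Comp E (FA R i) l))"
      using L.target.assoc[OF Lk L.map_hom[OF \<eta>X] \<epsilon>X] L.map_comp[OF k \<eta>X] sq by simp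
    also have "\<dots> = Comp Sets i (Comp Sets (\<epsilon> T) (FA L l))" using i_counit[OF l] .
    finally have eq: "FA L k = Comp Sets i (Comp Sets (\<epsilon> T) (FA L l))" .
    have "app (FA L k) y \<in> T" if y: "y \<in> FO L K" for y
      unfolding eq using app_comp[OF l' y, of i] app_in[OF l' y] app_i by simp
    then show ?thesis by blast
  qed
  moreover have "\<exists>h \<in> hom E Y K. Comp E k h = f"
    if f: "f \<in> hom E Y X" and im: "app (FA L f) ` FO L Y \<subseteq> T" for Y f
  proof -
    note Lf = L.map_hom[OF f] and Y = L.source.hom_obj(1)[OF f]
    note \<eta>Y = \<eta>[rule_format, OF Y]
    \<comment> \<open>The function induced by \<open>f\<close> takes its values in \<open>T\<close>
      and corestricts to \<open>g\<close>; the transpose of \<open>g\<close> is the second component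
      of the arrow into the pullback.\<close>
    define g where "g = (FO L Y, restrict (app (FA L f)) (FO L Y), T)"
    have g: "g \<in> hom Sets (FO L Y) T"
      unfolding g_def using im TO L.map_obj[OF Y] by (intro hom_SetsI) auto
    have "Comp Sets i g = FA L f"
    proof (rule arrow_eqI[OF L.target.comp_hom[OF g i] Lf])
      fix y assume y: "y \<in> FO L Y"
      have "app g y = app (FA L f) y" using y by (simp add: g_def)
      then show "app (Comp Sets i g) y = app (FA L f) y"
        using app_comp[OF g y, of i] app_i[OF app_in[OF g y]] by simp
    qed
    then have "Comp E (\<eta> X) f = Comp E (FA R i) (Comp E (FA R g) (\<eta> Y))"
      using \<eta>n[rule_format, OF f] R.map_comp[OF g i] L.source.assoc[OF \<eta>Y R.map_hom[OF g] Ri] by simp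
    then have "\<exists>!h. h \<in> hom E Y K \<and> Comp E k h = f \<and> Comp E l h = Comp E (FA R g) (\<eta> Y)"
      using univ f L.source.comp_hom[OF \<eta>Y R.map_hom[OF g]] by simp
    then show ?thesis by blast
  qed
  ultimately show ?thesis using k by blast
qed

section \<open>Exactness properties of a Grothendieck topos\<close>

lemma pullback_of_graph_limits:
  assumes C: "category C" and lim: "has_graph_limits C {0, 1, 2 :: nat}"
    and f: "f \<in> hom C X Z" and g: "g \<in> hom C Y Z"
  shows "\<exists>P p q. is_pullback C f g P p q"
proof -
  interpret category C by fact
  define A where "A = (\<lambda>i :: nat. if i = 0 then X else if i = 1 then Y else Z)"
  define R where "R = {(0 :: nat, f, 2 :: nat), (1, g, 2)}"
  have "is_graph C {0, 1, 2} A R"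
    unfolding is_graph_def using hom_obj[OF f] hom_obj[OF g] f g by (simp add: A_def R_def)
  then obtain P leg where L: "is_graph_limit C {0, 1, 2} A R P leg"
    using lim unfolding has_graph_limits_def by blast
  then have leg: "leg 0 \<in> hom C P X" "leg 1 \<in> hom C P Y" "Comp C f (leg 0) = leg 2" "Comp C g (leg 1) = leg 2"
    unfolding is_graph_limit_def is_graph_cone_def by (simp_all add: A_def R_def)
  have "\<exists>!h. h \<in> hom C T P \<and> Comp C (leg 0) h = a \<and> Comp C (leg 1) h = b"
    if a: "a \<in> hom C T X" and b: "b \<in> hom C T Y" and eq: "Comp C f a = Comp C g b" for T a b
  proof -
    define \<mu> where "\<mu> = (\<lambda>i :: nat. if i = 0 then a else if i = 1 then b else Comp C f a)"
    have "is_graph_cone C {0, 1, 2} A R T \<mu>"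
      unfolding is_graph_cone_def using hom_obj(1)[OF a] a b comp_hom[OF a f] eq
      by (simp add: A_def R_def \<mu>_def)
    then have "\<exists>!h. h \<in> hom C T P \<and> (\<forall>i \<in> {0, 1, 2}. Comp C (leg i) h = \<mu> i)"
      using L unfolding is_graph_limit_def by blast
    moreover have "(h \<in> hom C T P \<and> (\<forall>i \<in> {0, 1, 2}. Comp C (leg i) h = \<mu> i)) \<longleftrightarrow>
        h \<in> hom C T P \<and> Comp C (leg 0) h = a \<and> Comp C (leg 1) h = b" for h
    proof -
      have "Comp C (leg 2) h = Comp C f a" if "h \<in> hom C T P" "Comp C (leg 0) h = a"
        using assoc[OF that(1) leg(1) f] leg(3) that(2) by simp
      then show ?thesis by (auto simp: \<mu>_def)
    qed
    ultimately show ?thesis by simp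
  qed
  then have "is_pullback C f g P (leg 0) (leg 1)"
    unfolding is_pullback_def homD(2)[OF f] homD(2)[OF g] using leg by simp
  then show ?thesis by blast
qed

lemma terminal_of_graph_limits:
  assumes "has_graph_limits C ({} :: nat set)"
  shows "\<exists>T. is_terminal C T"
proof -
  have "is_graph C ({} :: nat set) (\<lambda>_. undefined) {}" by (simp add: is_graph_def)
  then obtain T leg where "is_graph_limit C ({} :: nat set) (\<lambda>_. undefined) {} T leg"
    using assms unfolding has_graph_limits_def by blast
  then have "is_terminal C T"
    unfolding is_terminal_def is_graph_limit_def is_graph_cone_def by simp
  then show ?thesis by blast
qed

lemma product_of_graph_limits:
  assumes "has_graph_limits C I" "X \<in> I \<rightarrow> Obj C"
  shows "\<exists>P \<pi>. is_product C I X P \<pi>"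
proof -
  have "is_graph C I X {}" using assms(2) by (simp add: is_graph_def)
  then obtain P \<pi> where "is_graph_limit C I X {} P \<pi>"
    using assms(1) unfolding has_graph_limits_def by blast
  then have "is_product C I X P \<pi>"
    unfolding is_product_def is_graph_limit_def is_graph_cone_def by simp
  then show ?thesis by blast
qed

lemma grothendieck_topos_exactness:
  assumes inacc: "inaccessible TYPE('u)" and E: "grothendieck_topos TYPE('u) E"
  shows "category E" "has_effective_unions E" "has_strict_initial E"
    and "(I :: 'i set) \<prec> (UNIV :: 'u set) \<Longrightarrow> has_graph_limits E I"
proof -
  obtain B :: "('u, 'u) category_data" and J where B: "small_category B"
    and J: "grothendieck_topology B J" and eq: "equivalent_categories E (Sheaves B J)"
    using E unfolding grothendieck_topos_def by blast
  interpret site B J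
    using B J by (simp add: site_def site_axioms_def small_category_def)
  obtain \<Phi> where "weak_equivalence E Sh \<Phi>" using weak_equivalence_of_equivalent[OF eq] .
  then interpret weak_equivalence E Sh \<Phi> .
  show "category E" by (rule source.category_axioms)
  show "has_effective_unions E" using reflects_effective_unions[OF Sh_effective_unions[OF inacc]] .
  show "has_strict_initial E" using reflects_strict_initial[OF Sh_strict_initial[OF inacc]] .
  show "has_graph_limits E I" if I: "I \<prec> (UNIV :: 'u set)"
  proof (rule reflects_graph_limits)
    show "has_graph_limits Sh I"
      unfolding has_graph_limits_def using Sh_graph_limit[OF inacc I] by blast
  qed
qed

lemma inclusions_jointly_epic:
  assumes "(G :: 'u set) \<prec> (UNIV :: 'u set)"
  shows "jointly_epic Sets G ((\<lambda>g. inclusion {g} G) ` G)"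
proof -
  have i: "inclusion {g} G \<in> hom Sets {g} G" "app (inclusion {g} G) g = g" if "g \<in> G" for g
    using inclusion_hom[OF assms, of "{g}"] that by simp_all
  have "u = v"
    if u: "u \<in> hom Sets G Z" and v: "v \<in> hom Sets G Z"
      and eq: "\<And>g. g \<in> G \<Longrightarrow> Comp Sets u (inclusion {g} G) = Comp Sets v (inclusion {g} G)" for Z u v
  proof (rule arrow_eqI[OF u v])
    fix g assume g: "g \<in> G"
    show "app u g = app v g"
      using app_comp[OF i(1)[OF g], of g u] app_comp[OF i(1)[OF g], of g v] i(2)[OF g] eq[OF g] by simp
  qed
  note epi = this
  show ?thesis
  proof (rule jointly_epicI)
    show "m \<in> hom Sets (Dom Sets m) G" if "m \<in> (\<lambda>g. inclusion {g} G) ` G" for m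
      using that i(1) homD(2)[OF i(1)] by auto
    show "u = v" if "u \<in> hom Sets G Z" "v \<in> hom Sets G Z"
      "\<And>m. m \<in> (\<lambda>g. inclusion {g} G) ` G \<Longrightarrow> Comp Sets u m = Comp Sets v m" for u v Z
      using epi[OF that(1,2) that(3)] by simp
  qed
qed

text \<open>An \<open>x\<close> outside all images could be given either of two different values,
  \<open>a\<close> or \<open>b\<close>, without any member of the family noticing.\<close>

lemma jointly_epic_Sets_surj:
  assumes inacc: "inaccessible TYPE('u)" and X: "X \<prec> (UNIV :: 'u set)"
    and H: "jointly_epic (Sets :: ('u set, 'u arrow) category_data) X H" and x: "x \<in> X"
  shows "\<exists>m \<in> H. x \<in> app m ` Dom Sets m"
proof (rule ccontr)
  assume no: "\<not> (\<exists>m \<in> H. x \<in> app m ` Dom Sets m)"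
  interpret Sets: category "Sets :: ('u set, 'u arrow) category_data" by (rule category_Sets)
  obtain a b :: 'u where ab: "a \<noteq> b"
    using ex_new_if_finite[OF infinite_UNIV[OF inacc], of "{undefined}"] by auto
  have Y: "{a, b} \<prec> (UNIV :: 'u set)" by (rule small_finite[OF inacc]) simp
  define u where "u = (X, restrict (\<lambda>_. a) X, {a, b})"
  define v where "v = (X, restrict (\<lambda>y. if y = x then b else a) X, {a, b})"
  have u: "u \<in> hom Sets X {a, b}" and v: "v \<in> hom Sets X {a, b}"
    unfolding u_def v_def by (rule hom_SetsI[OF X Y]; simp)+
  have uv: "Comp Sets u m = Comp Sets v m" if m: "m \<in> H" for m
  proof -
    have mh: "m \<in> hom Sets (Dom Sets m) X" using jointly_epic_hom[OF H m] .
    show ?thesis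
    proof (rule arrow_eqI[OF Sets.comp_hom[OF mh u] Sets.comp_hom[OF mh v]])
      fix y assume y: "y \<in> Dom Sets m"
      have "app m y \<noteq> x" using no m y by blast
      then show "app (Comp Sets u m) y = app (Comp Sets v m) y"
        using app_comp[OF mh y, of u] app_comp[OF mh y, of v] app_in[OF mh y] by (simp add: u_def v_def)
    qed
  qed
  have "u = v" by (rule jointly_epicD[OF H u v uv])
  then have "app u x = app v x" by simp
  then show False using ab x by (simp add: u_def v_def)
qed

section \<open>Connected atomic topoi\<close>

text \<open>Connectedness enters through \<open>two_points\<close>: fullness of the constant object
  functor leaves no global points of the constant object on \<open>{a, b}\<close> besides those
  given by \<open>a\<close> and \<open>b\<close>. The remaining assumptions are booleanness itself
  and consequences of the adjunctions, of the preservation of finite limits and of the exactness of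
  sheaf categories.\<close>

lemma connected_atomic_topos_with_point:
  fixes E :: "('o, 'm) category_data" and \<gamma> :: "('o, 'm, 'u set, 'u arrow) geometric_data"
    and p :: "('u set, 'u arrow, 'o, 'm) geometric_data"
  assumes inacc: "inaccessible TYPE('u)" and atomic: "connected_atomic_topos E \<gamma>"
    and point: "is_point E p"
  shows "pointed_boolean_topos E (FO (inverse_image p)) (\<lambda>f. app (FA (inverse_image p) f)) \<gamma>"
proof -
  let ?L = "inverse_image p" and ?\<Gamma> = "inverse_image \<gamma>"
  have topos: "grothendieck_topos TYPE('u) E" and ff: "full_and_faithful Sets E ?\<Gamma>"
    and boolean: "boolean_category E"
    and adj\<Gamma>: "left_adjoint Sets E ?\<Gamma> (direct_image \<gamma>)" and pres\<Gamma>: "preserves_finite_limits Sets E ?\<Gamma>"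
    using atomic by (simp_all add: connected_atomic_topos_def geometric_morphism_def)
  have adj: "left_adjoint E Sets ?L (direct_image p)" and pres: "preserves_finite_limits E Sets ?L"
    using point by (simp_all add: is_point_def geometric_morphism_def)
  note exact = grothendieck_topos_exactness[OF inacc topos]
  interpret L: is_functor E Sets ?L using left_adjoint_unit_counit(1)[OF adj] .
  interpret \<Gamma>: is_functor Sets E ?\<Gamma> using left_adjoint_unit_counit(1)[OF adj\<Gamma>] .
  let ?el = "FO ?L" and ?act = "\<lambda>f. app (FA ?L f)"
  have nat3: "{0, 1, 2 :: nat} \<prec> (UNIV :: 'u set)" and nat0: "({} :: nat set) \<prec> (UNIV :: 'u set)"
    by (rule small_finite[OF inacc]; simp)+
  have pullbacks: "\<exists>P a b. is_pullback E f g P a b" if "f \<in> hom E X Z" "g \<in> hom E Y Z" for f g X Y Z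
    using pullback_of_graph_limits[OF exact(1) exact(4)[OF nat3] that] .
  have el_pullback: "\<exists>!e. e \<in> ?el P \<and> ?act a e = x \<and> ?act b e = y"
    if "is_pullback E f g P a b" "f \<in> hom E X Z" "g \<in> hom E Y Z" "x \<in> ?el X" "y \<in> ?el Y"
      "?act f x = ?act g y" for f g P a b X Y Z x y
    using pullback_Sets_elements[OF inacc preserves_pullback[OF pres L.is_functor_axioms that(2,3,1)]
        L.map_hom[OF that(2)] L.map_hom[OF that(3)] that(4-6)] .
  have const_terminal: "is_terminal E (FO ?\<Gamma> {g})" for g
    using preserves_terminal[OF pres\<Gamma> \<Gamma>.is_functor_axioms singleton_terminal_Sets[OF inacc]] .
  have zero: "is_initial E (FO ?\<Gamma> {})"
    using left_adjoint_initial[OF adj\<Gamma> empty_initial_Sets[OF inacc]] .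
  have el_zero: "?el (FO ?\<Gamma> {}) = {}"
    using initial_Sets_empty[OF inacc left_adjoint_initial[OF adj zero]] .
  \<comment> \<open>Disjoint images in sets stay disjoint in the topos: the empty pullback is
    preserved, and the constant object on the empty set is initial with an empty fibre.\<close>
  have disjoint: "is_pullback E (FA ?\<Gamma> f) (FA ?\<Gamma> g) (FO ?\<Gamma> {}) (FA ?\<Gamma> (inclusion {} A)) (FA ?\<Gamma> (inclusion {} B))"
    if "f \<in> hom Sets A D" "g \<in> hom Sets B D" "\<And>a b. a \<in> A \<Longrightarrow> b \<in> B \<Longrightarrow> app f a \<noteq> app g b" for f g A B D
    using preserves_pullback[OF pres\<Gamma> \<Gamma>.is_functor_axioms that(1,2) empty_pullback_Sets[OF inacc that]] .
  have el_disjoint: "?act (FA ?\<Gamma> f) x \<noteq> ?act (FA ?\<Gamma> g) y"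
    if fg: "f \<in> hom Sets A D" "g \<in> hom Sets B D" "\<And>a b. a \<in> A \<Longrightarrow> b \<in> B \<Longrightarrow> app f a \<noteq> app g b"
      and x: "x \<in> ?el (FO ?\<Gamma> A)" "y \<in> ?el (FO ?\<Gamma> B)" for f g A B D x y
  proof
    assume eq: "?act (FA ?\<Gamma> f) x = ?act (FA ?\<Gamma> g) y"
    show False
      using ex1_implies_ex[OF el_pullback[OF disjoint[OF fg] \<Gamma>.map_hom[OF fg(1)] \<Gamma>.map_hom[OF fg(2)] x eq]]
        el_zero by simp
  qed
  show ?thesis
  proof unfold_locales
    show "\<exists>P a b. is_pullback E f g P a b" if "f \<in> hom E X Z" "g \<in> hom E Y Z" for f g X Y Z
      using pullbacks[OF that] .
    show "\<exists>T. is_terminal E T" using terminal_of_graph_limits[OF exact(4)[OF nat0]] .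
    show "has_effective_unions E" "has_strict_initial E" "boolean_category E"
      using exact(2) exact(3) boolean .
    show "?act f x \<in> ?el Y" if "f \<in> hom E X Y" "x \<in> ?el X" for f X Y x
      using app_in[OF L.map_hom[OF that(1)] that(2)] .
    show "?act (Id E X) x = x" if "X \<in> Obj E" "x \<in> ?el X" for X x
      using L.map_id[OF that(1)] app_id[OF that(2)] by simp
    show "?act (Comp E g f) x = ?act g (?act f x)"
      if "f \<in> hom E X Y" "g \<in> hom E Y Z" "x \<in> ?el X" for f g X Y Z x
      using L.map_comp[OF that(1,2)] app_comp[OF L.map_hom[OF that(1)] that(3)] by simp
    show "\<exists>!x. x \<in> ?el T" if "is_terminal E T" for T
      using terminal_Sets_singleton[OF inacc preserves_terminal[OF pres L.is_functor_axioms that]] .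
    show "\<exists>!e. e \<in> ?el P \<and> ?act a e = x \<and> ?act b e = y"
      if "is_pullback E f g P a b" "f \<in> hom E X Z" "g \<in> hom E Y Z" "x \<in> ?el X" "y \<in> ?el Y"
        "?act f x = ?act g y" for f g P a b X Y Z x y
      using el_pullback[OF that] .
    show "\<exists>K k. k \<in> hom E K X \<and> is_mono E k \<and> ?act k ` ?el K \<subseteq> T \<and>
        (\<forall>Y. \<forall>f \<in> hom E Y X. ?act f ` ?el Y \<subseteq> T \<longrightarrow> (\<exists>h \<in> hom E Y K. Comp E k h = f))"
      if "X \<in> Obj E" "T \<subseteq> ?el X" for X T
      using largest_subobject_into[OF adj pullbacks that] .
    show "?el X \<prec> (UNIV :: 'u set)" if "X \<in> Obj E" for X
      using L.map_obj[OF that] by simp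
    show "is_terminal E (FO ?\<Gamma> {g})" for g using const_terminal .
    fix G :: "'u set" assume G: "G \<prec> (UNIV :: 'u set)"
    have incl: "inclusion {g} G \<in> hom Sets {g} G" "app (inclusion {g} G) g = g" if "g \<in> G" for g
      using inclusion_hom[OF G, of "{g}"] that by simp_all
    show "FA ?\<Gamma> (inclusion {g} G) \<in> hom E (FO ?\<Gamma> {g}) (FO ?\<Gamma> G)" if "g \<in> G" for g
      using \<Gamma>.map_hom[OF incl(1)[OF that]] .
    fix e assume e: "e \<in> ?el (FO ?\<Gamma> G)"
    have GO: "G \<in> Obj Sets" using G by simp
    have small: "?el (FO ?\<Gamma> G) \<prec> (UNIV :: 'u set)" using L.map_obj[OF \<Gamma>.map_obj[OF GO]] by simp
    \<comment> \<open>Both left adjoints preserve the joint epicness of the points of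
      \<open>G\<close>, so \<open>e\<close> lies over some \<open>g\<close>; that there is only one
      follows from disjointness.\<close>
    have "jointly_epic Sets (?el (FO ?\<Gamma> G)) (FA ?L ` FA ?\<Gamma> ` (\<lambda>g. inclusion {g} G) ` G)"
      using left_adjoint_jointly_epic[OF adj \<Gamma>.map_obj[OF GO]
          left_adjoint_jointly_epic[OF adj\<Gamma> GO inclusions_jointly_epic[OF G]]] .
    from jointly_epic_Sets_surj[OF inacc small this e] obtain g
      where g: "g \<in> G" "e \<in> ?act (FA ?\<Gamma> (inclusion {g} G)) ` Dom Sets (FA ?L (FA ?\<Gamma> (inclusion {g} G)))"
      by blast
    have "Dom Sets (FA ?L (FA ?\<Gamma> (inclusion {g} G))) = ?el (FO ?\<Gamma> {g})"
      using homD(2)[OF L.map_hom[OF \<Gamma>.map_hom[OF incl(1)[OF g(1)]]]] .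
    then have eg: "e \<in> ?act (FA ?\<Gamma> (inclusion {g} G)) ` ?el (FO ?\<Gamma> {g})" using g(2) by simp
    show "\<exists>!g. g \<in> G \<and> e \<in> ?act (FA ?\<Gamma> (inclusion {g} G)) ` ?el (FO ?\<Gamma> {g})"
    proof (rule ex1I[of _ g])
      fix g' assume g': "g' \<in> G \<and> e \<in> ?act (FA ?\<Gamma> (inclusion {g'} G)) ` ?el (FO ?\<Gamma> {g'})"
      obtain x where x: "x \<in> ?el (FO ?\<Gamma> {g})" "e = ?act (FA ?\<Gamma> (inclusion {g} G)) x" using eg by blast
      obtain y where y: "y \<in> ?el (FO ?\<Gamma> {g'})" "e = ?act (FA ?\<Gamma> (inclusion {g'} G)) y" using g' by blast
      show "g' = g"
      proof (rule ccontr)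
        assume "g' \<noteq> g"
        then have "app (inclusion {g} G) a \<noteq> app (inclusion {g'} G) b" if "a \<in> {g}" "b \<in> {g'}" for a b
          using that incl(2)[OF g(1)] incl(2)[of g'] g' by simp
        from el_disjoint[OF incl(1)[OF g(1)] incl(1)[of g'] this x(1) y(1)] show False
          using x(2) y(2) g' by simp
      qed
    qed (use g(1) eg in simp)
  next
    obtain a b :: 'u where ab: "a \<noteq> b"
      using ex_new_if_finite[OF infinite_UNIV[OF inacc], of "{undefined}"] by auto
    have G: "{a, b} \<prec> (UNIV :: 'u set)" and one: "{a} \<prec> (UNIV :: 'u set)"
      by (rule small_finite[OF inacc]; simp)+
    define s where "s = ({a}, restrict (\<lambda>_. a) {a}, {a, b})"
    define t where "t = ({a}, restrict (\<lambda>_. b) {a}, {a, b})"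
    have s: "s \<in> hom Sets {a} {a, b}" and t: "t \<in> hom Sets {a} {a, b}"
      unfolding s_def t_def by (rule hom_SetsI[OF one G]; simp)+
    have st: "app s x \<noteq> app t y" if "x \<in> {a}" "y \<in> {a}" for x y
      using that ab by (simp add: s_def t_def)
    have sub: "hom E (FO ?\<Gamma> {a}) (FO ?\<Gamma> {a, b}) \<subseteq> {FA ?\<Gamma> s, FA ?\<Gamma> t}"
    proof
      fix h assume "h \<in> hom E (FO ?\<Gamma> {a}) (FO ?\<Gamma> {a, b})"
      moreover have "bij_betw (FA ?\<Gamma>) (hom Sets {a} {a, b}) (hom E (FO ?\<Gamma> {a}) (FO ?\<Gamma> {a, b}))"
        using ff one G by (simp add: full_and_faithful_def)
      ultimately obtain f where f: "f \<in> hom Sets {a} {a, b}" "h = FA ?\<Gamma> f"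
        unfolding bij_betw_def by blast
      have "app f a = a \<or> app f a = b" using app_in[OF f(1)] by simp
      then have "f = s \<or> f = t"
        using arrow_eqI[OF f(1) s] arrow_eqI[OF f(1) t] by (auto simp: s_def t_def)
      then show "h \<in> {FA ?\<Gamma> s, FA ?\<Gamma> t}" using f(2) by blast
    qed
    \<comment> \<open>Where the two points agree, \<open>f\<close> factors through their pullback,
      which is the constant object on the empty set.\<close>
    have eq: "\<exists>Z. is_initial E Z \<and> hom E Y Z \<noteq> {}"
      if f: "f \<in> hom E Y (FO ?\<Gamma> {a})" and eq: "Comp E (FA ?\<Gamma> s) f = Comp E (FA ?\<Gamma> t) f" for Y f
    proof -
      have "\<exists>!h. h \<in> hom E Y (FO ?\<Gamma> {}) \<and> Comp E (FA ?\<Gamma> (inclusion {} {a})) h = f \<and>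
          Comp E (FA ?\<Gamma> (inclusion {} {a})) h = f"
        using disjoint[OF s t st] f eq
        unfolding is_pullback_def homD(2)[OF \<Gamma>.map_hom[OF s]] homD(2)[OF \<Gamma>.map_hom[OF t]] by blast
      then show ?thesis using zero by blast
    qed
    have eq': "\<forall>Y. \<forall>f \<in> hom E Y (FO ?\<Gamma> {a}). Comp E (FA ?\<Gamma> s) f = Comp E (FA ?\<Gamma> t) f \<longrightarrow>
        (\<exists>Z. is_initial E Z \<and> hom E Y Z \<noteq> {})"
      using eq by simp
    have ne: "\<forall>x \<in> ?el (FO ?\<Gamma> {a}). ?act (FA ?\<Gamma> s) x \<noteq> ?act (FA ?\<Gamma> t) x"
      using el_disjoint[OF s t st] by blast
    show "\<exists>T D s t. is_terminal E T \<and> s \<in> hom E T D \<and> t \<in> hom E T D \<and>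
        hom E T D \<subseteq> {s, t} \<and> (\<forall>x \<in> ?el T. ?act s x \<noteq> ?act t x) \<and>
        (\<forall>Y. \<forall>f \<in> hom E Y T. Comp E s f = Comp E t f \<longrightarrow> (\<exists>Z. is_initial E Z \<and> hom E Y Z \<noteq> {}))"
      by (rule exI[of _ "FO ?\<Gamma> {a}"], rule exI[of _ "FO ?\<Gamma> {a, b}"],
          rule exI[of _ "FA ?\<Gamma> s"], rule exI[of _ "FA ?\<Gamma> t"], intro conjI)
        (fact const_terminal sub ne eq' \<Gamma>.map_hom[OF s] \<Gamma>.map_hom[OF t])+
  qed
qed

theorem theorem3p3p8:
  fixes E :: "('o, 'm) category_data"
    and \<gamma> :: "('o, 'm, 'u set, 'u arrow) geometric_data"
    and p :: "('u set, 'u arrow, 'o, 'm) geometric_data"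
    and C :: "('o, 'm) category_data"
    and F :: "('o, 'm, 'u set, 'u arrow) functor_data"
  assumes "inaccessible TYPE('u)"
    and "connected_atomic_topos E \<gamma>"
    and "is_point E p"
    and "proessential E p"
    and "C = full_subcategory E (nonempty_connected E)"
    and "F = inverse_image p"
  shows "(\<forall>z \<in> Obj (diagram C F). \<exists>A a. galois_object E \<gamma> A \<and>
            (A, a) \<in> Obj (diagram C F) \<and> hom (diagram C F) (A, a) z \<noteq> {}) \<and>
         (\<forall>X \<in> Obj C. \<exists>A a. galois_object E \<gamma> A \<and> a \<in> FO F A \<and>
            (\<forall>x \<in> FO F X. \<exists>f. ((A, a), f, (X, x)) \<in> hom (diagram C F) (A, a) (X, x) \<and>
              (\<forall>g. ((A, a), g, (X, x)) \<in> hom (diagram C F) (A, a) (X, x) \<longrightarrow> g = f) \<and>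
              is_strict_epi E f))"
proof -
  interpret pointed_boolean_topos E "FO F" "\<lambda>f. app (FA F f)" \<gamma>
    using connected_atomic_topos_with_point[OF assms(1-3)] unfolding assms(6) .
  have topos: "grothendieck_topos TYPE('u) E" using assms(2) by (simp add: connected_atomic_topos_def)
  have ObjC: "X \<in> Obj C \<longleftrightarrow> nonempty_connected E X" for X
    by (auto simp: assms(5) full_subcategory_def nonempty_connected_def connected_object_def)
  have homC: "f \<in> hom C A X \<longleftrightarrow> f \<in> hom E A X" if "A \<in> Obj C" "X \<in> Obj C" for f A X
    using that unfolding ObjC unfolding assms(5) full_subcategory_def hom_def by auto
  have hom_diagram: "((A, a), f, (X, x)) \<in> hom (diagram C F) (A, a) (X, x) \<longleftrightarrow>
      a \<in> FO F A \<and> x \<in> FO F X \<and> f \<in> hom E A X \<and> app (FA F f) a = x"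
    if "A \<in> Obj C" "X \<in> Obj C" for A a f X x
    unfolding hom_def[of "diagram C F"] unfolding diagram_def by (simp add: homC[OF that])
  \<comment> \<open>The power of \<open>X\<close> is indexed by its own fibre, a small set because
    the inverse image takes values in \<open>Sets\<close>; with this index set the identity function
    is among the families of coordinates.\<close>
  have cover: "\<exists>A a. galois_object E \<gamma> A \<and> a \<in> FO F A \<and>
      (\<forall>x \<in> FO F X. \<exists>f \<in> hom E A X. app (FA F f) a = x \<and> is_strict_epi E f \<and>
        (\<forall>g \<in> hom E A X. app (FA F g) a = x \<longrightarrow> g = f))"
    if "X \<in> Obj C" for X
  proof -
    have X: "connected_object E X" using that by (simp add: ObjC nonempty_connected_def)
    then have XO: "X \<in> Obj E" by (simp add: connected_object_def)
    note small = el_small[OF XO]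
    have "(\<lambda>_. X) \<in> FO F X \<rightarrow> Obj E" using XO by simp
    from product_of_graph_limits[OF grothendieck_topos_exactness(4)[OF assms(1) topos small] this]
    obtain P \<pi> where P: "is_product E (FO F X) (\<lambda>_. X) P \<pi>" by blast
    have "bij_betw (\<lambda>y. \<lambda>s \<in> FO F X. app (FA F (\<pi> s)) y) (FO F P) (FO F X \<rightarrow>\<^sub>E FO F X)"
      using assms(4) X P small unfolding proessential_def assms(6) by simp
    then show ?thesis using galois_cover[OF X P] by blast
  qed
  have galois_C: "A \<in> Obj C" if "galois_object E \<gamma> A" for A
    using that by (simp add: ObjC galois_object_def)
  have second: "\<exists>A a. galois_object E \<gamma> A \<and> a \<in> FO F A \<and>
      (\<forall>x \<in> FO F X. \<exists>f. ((A, a), f, (X, x)) \<in> hom (diagram C F) (A, a) (X, x) \<and>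
        (\<forall>g. ((A, a), g, (X, x)) \<in> hom (diagram C F) (A, a) (X, x) \<longrightarrow> g = f) \<and> is_strict_epi E f)"
    if X: "X \<in> Obj C" for X
  proof -
    obtain A a where A: "galois_object E \<gamma> A" and a: "a \<in> FO F A"
      and f: "\<forall>x \<in> FO F X. \<exists>f \<in> hom E A X. app (FA F f) a = x \<and> is_strict_epi E f \<and>
        (\<forall>g \<in> hom E A X. app (FA F g) a = x \<longrightarrow> g = f)"
      using cover[OF X] by blast
    show ?thesis

    proof (intro exI[of _ A] exI[of _ a] conjI ballI A a)
      fix x assume x: "x \<in> FO F X"
      show "\<exists>f. ((A, a), f, (X, x)) \<in> hom (diagram C F) (A, a) (X, x) \<and>
          (\<forall>g. ((A, a), g, (X, x)) \<in> hom (diagram C F) (A, a) (X, x) \<longrightarrow> g = f) \<and> is_strict_epi E f"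
        unfolding hom_diagram[OF galois_C[OF A] X] using f x a by blast
    qed
  qed
  have first: "\<exists>A a. galois_object E \<gamma> A \<and> (A, a) \<in> Obj (diagram C F) \<and> hom (diagram C F) (A, a) z \<noteq> {}"
    if z: "z \<in> Obj (diagram C F)" for z
  proof -
    obtain X x where z_eq: "z = (X, x)" and X: "X \<in> Obj C" and x: "x \<in> FO F X"
      using z by (auto simp: diagram_def)
    obtain A a where A: "galois_object E \<gamma> A" and a: "a \<in> FO F A"
      and f: "\<forall>x \<in> FO F X. \<exists>f. ((A, a), f, (X, x)) \<in> hom (diagram C F) (A, a) (X, x) \<and>
        (\<forall>g. ((A, a), g, (X, x)) \<in> hom (diagram C F) (A, a) (X, x) \<longrightarrow> g = f) \<and> is_strict_epi E f"
      using second[OF X] by blast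
    have "(A, a) \<in> Obj (diagram C F)" using galois_C[OF A] a by (simp add: diagram_def)
    then show ?thesis using A f x unfolding z_eq by blast
  qed
  show ?thesis using first second by blast
qed

end
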